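(* Let $K$ be a field, let $\mathcal{P}$ be a closed path, let $m,n\in\mathbb{Z}^+$, and let $\mathcal{Q}=\mathcal{P}\otimes\mathcal{R}_{m,n}$ be the corresponding dilated closed path. Then the polyomino ideal $I_{\mathcal{Q}}$ is prime if and only if $\mathcal{Q}$ contains no zig-zag walks.
   Context: Notation: $\mathbb{N}=\{0,1,2,\dots\}$, $\mathbb{Z}^+=\{1,2,\dots\}$; $\mathbb{N}^2$ carries the product order $\le$. Cells and polyominoes. For $a=(i,j)$, $b=(k,\ell)$ in $\mathbb{N}^2$ with $a\le b$, the interval is $[a,b]=\{c\in\mathbb{N}^2: a\le c\le b\}$; it is proper if $i<k$ and $j<\ell$. For a proper interval, $a,b$ are its diagonal corners and $(i,\ell),(k,j)$ its anti-diagonal corners. A cell is an interval $C=[a,a+(1,1)]$; $V(C)$ is its set of four vertices and $E(C)$ its set of four sides (each a pair of vertices at distance 1). A walk between cells $C$ and $D$ is a sequence of cells $C=C_1,\dots,C_r=D$ with $E(C_i)\cap E(C_{i+1})\ne\emptyset$ for all $i$. A polyomino is a finite nonempty collection $\mathcal{P}$ of cells in which any two distinct cells are joined by a walk of cells of $\mathcal{P}$. $V(\mathcal{P})$ and $E(\mathcal{P})$ are the unions of $V(C)$, resp. $E(C)$, over $C\in\mathcal{P}$. An inner interval of $\mathcal{P}$ is a proper interval $[a,b]$ with $a,b\in V(\mathcal{P})$ all of whose cells belong to $\mathcal{P}$. A horizontal (vertical) edge interval of $\mathcal{P}$ is an interval $[a,b]$ with $a,b \in V(\mathcal{P})$ having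 equal second (first) coordinates, such that all unit edges between consecutive points of $[a,b]$ are in $E(\mathcal{P})$; an edge interval is either of these. Tensor product. For a finite collection of cells $\mathcal{P}$ with $(k,\ell)=\sup V(\mathcal{P})$ (componentwise supremum), the associated binary matrix $M_{\mathcal{P}}$ is the $\ell\times k$ matrix with $[M_{\mathcal{P}}]_{i,j}=1$ if $[(j-1,\ell-i),(j,\ell-i+1)]\in\mathcal{P}$ and $0$ otherwise. A polyomino is in minimal position if $\inf V=(0,0)$. For $\mathcal{Q}$ in minimal position, $\mathcal{P}\otimes\mathcal{Q}$ is the unique collection of cells whose associated binary matrix is the Kronecker product $M_{\mathcal{P}}\otimes M_{\mathcal{Q}}$. $\mathcal{R}_{m,n}$ is the full rectangle of cells of width $m$ and height $n$ (in cells) in minimal position. Closed path. A polyomino $\mathcal{P}$ is a closed path if it is a sequence of cells $A_1,\dots,A_n,A_{n+1}$ with $n>5$ such that: (i) $A_1=A_{n+1}$; (ii) for all $i\in\{1,\dots,n\}$, $A_i\cap A_{i+1}$ is a common edge; (iii) $A_i\ne A_j$ for distinct $i,j\in\{1,\dots,n\}$; (iv) for all $i\in\{1,\dots,n\}$ and all $j\notin\{i-2,i-1,i,i+1,i+2\}$ (indices read cyclically modulo $n$), $A_i\cap A_j=\emptyset$ (no common vertex). A dilated closed path is a polyomino of the form $\mathcal{P}\otimes\mathcal{R}_{m,n}$ with $\mathcal{P}$ a closed path. Polyomino ideal. For a polyomino $\mathcal{P}$, $I_{\mathcal{P}}\subset K[x_v : v\in V(\mathcal{P})]$ is the ideal generated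 by all binomials $x_ax_b-x_cx_d$ where $[a,b]$ is an inner interval of $\mathcal{P}$ with anti-diagonal corners $c,d$. Zig-zag walk. A zig-zag walk of $\mathcal{P}$ is a sequence $I_1,\dots,I_r$ of distinct inner intervals of $\mathcal{P}$ such that, for each $i$, either $v_i,z_i$ are the diagonal corners and $u_i,v_{i+1}$ the anti-diagonal corners of $I_i$, or vice versa, and: (i) $I_1\cap I_r=\{v_1\}=\{v_{r+1}\}$ and $I_i\cap I_{i+1}=\{v_{i+1}\}$ for $1\le i\le r-1$; (ii) $v_i$ and $v_{i+1}$ lie on a common edge interval of $\mathcal{P}$ for all $1\le i\le r$; (iii) for all $i\ne j$ there is no inner interval $J$ of $\mathcal{P}$ with $z_i,z_j\in J$. *)

theory Defs
  imports
    "HOL-Algebra.Ideal"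
    "HOL-Library.Poly_Mapping"
    "Jordan_Normal_Form.Matrix"
begin

section \<open>Intervals and cells\<close>

type_synonym point = "nat \<times> nat"

text \<open>The interval for the product order on pairs.  It is written out instead of using
  the order type class, so that no particular order instance on pairs is imposed.\<close>

definition interval :: "point \<Rightarrow> point \<Rightarrow> point set" where
  "interval a b = {fst a..fst b} \<times> {snd a..snd b}"

definition proper :: "point \<Rightarrow> point \<Rightarrow> bool" where
  "proper a b \<longleftrightarrow> fst a < fst b \<and> snd a < snd b"

definition diag_corners :: "point \<Rightarrow> point \<Rightarrow> point set" where
  "diag_corners a b = {a, b}"

definition antidiag_corners :: "point \<Rightarrow> point \<Rightarrow> point set" where
  "antidiag_corners a b = {(fst a, snd b), (fst b, snd a)}"

text \<open>A cell is a set of lattice points, so it coincides with its own vertex set.\<close>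

definition cell :: "point \<Rightarrow> point set" where
  "cell a = interval a (Suc (fst a), Suc (snd a))"

definition cells :: "point set set" where
  "cells = range cell"

text \<open>Edges are unordered pairs, hence it suffices to let \<open>v\<close> be the right or the upper
  neighbour of \<open>u\<close>.\<close>

definition cell_edges :: "point set \<Rightarrow> point set set" where
  "cell_edges C = {{u, v} | u v. u \<in> C \<and> v \<in> C \<and>
     (v = (Suc (fst u), snd u) \<or> v = (fst u, Suc (snd u)))}"

definition vertices :: "point set set \<Rightarrow> point set" where
  "vertices P = \<Union> P"

definition edges :: "point set set \<Rightarrow> point set set" where
  "edges P = (\<Union>C\<in>P. cell_edges C)"


section \<open>Polyominoes\<close>

definition cell_walk :: "point set list \<Rightarrow> point set \<Rightarrow> point set \<Rightarrow> bool" where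
  "cell_walk Cs C D \<longleftrightarrow> Cs \<noteq> [] \<and> hd Cs = C \<and> last Cs = D \<and> set Cs \<subseteq> cells \<and>
     (\<forall>i. Suc i < length Cs \<longrightarrow> cell_edges (Cs ! i) \<inter> cell_edges (Cs ! Suc i) \<noteq> {})"

definition polyomino :: "point set set \<Rightarrow> bool" where
  "polyomino P \<longleftrightarrow> finite P \<and> P \<noteq> {} \<and> P \<subseteq> cells \<and>
     (\<forall>C\<in>P. \<forall>D\<in>P. C \<noteq> D \<longrightarrow> (\<exists>Cs. set Cs \<subseteq> P \<and> cell_walk Cs C D))"

definition inner_interval :: "point set set \<Rightarrow> point \<Rightarrow> point \<Rightarrow> bool" where
  "inner_interval P a b \<longleftrightarrow> proper a b \<and> a \<in> vertices P \<and> b \<in> vertices P \<and>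
     (\<forall>C\<in>cells. C \<subseteq> interval a b \<longrightarrow> C \<in> P)"

definition horizontal_edge_interval :: "point set set \<Rightarrow> point \<Rightarrow> point \<Rightarrow> bool" where
  "horizontal_edge_interval P a b \<longleftrightarrow> a \<in> vertices P \<and> b \<in> vertices P \<and>
     fst a \<le> fst b \<and> snd a = snd b \<and>
     (\<forall>x\<in>{fst a..<fst b}. {(x, snd a), (Suc x, snd a)} \<in> edges P)"

definition vertical_edge_interval :: "point set set \<Rightarrow> point \<Rightarrow> point \<Rightarrow> bool" where
  "vertical_edge_interval P a b \<longleftrightarrow> a \<in> vertices P \<and> b \<in> vertices P \<and>
     fst a = fst b \<and> snd a \<le> snd b \<and>
     (\<forall>y\<in>{snd a..<snd b}. {(fst a, y), (fst a, Suc y)} \<in> edges P)"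

definition edge_interval :: "point set set \<Rightarrow> point \<Rightarrow> point \<Rightarrow> bool" where
  "edge_interval P a b \<longleftrightarrow> horizontal_edge_interval P a b \<or> vertical_edge_interval P a b"


section \<open>Tensor product\<close>

text \<open>The pair \<open>(sup_x P, sup_y P)\<close> is the componentwise supremum of the vertices; it is only
  meaningful for finite nonempty \<open>P\<close>.\<close>

definition sup_x :: "point set set \<Rightarrow> nat" where
  "sup_x P = Max (fst ` vertices P)"

definition sup_y :: "point set set \<Rightarrow> nat" where
  "sup_y P = Max (snd ` vertices P)"

text \<open>Library matrices are indexed from \<open>0\<close>: the entry at \<open>(i, j)\<close> below is the entry in row
  \<open>i + 1\<close> and column \<open>j + 1\<close> in the usual numbering.  Row \<open>0\<close> describes the top row of cells.\<close>

definition assoc_matrix :: "point set set \<Rightarrow> nat mat" where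
  "assoc_matrix P = mat (sup_y P) (sup_x P)
     (\<lambda>(i, j). if interval (j, sup_y P - (i + 1)) (j + 1, sup_y P - i) \<in> P then 1 else 0)"

definition kronecker :: "nat mat \<Rightarrow> nat mat \<Rightarrow> nat mat" where
  "kronecker A B = mat (dim_row A * dim_row B) (dim_col A * dim_col B)
     (\<lambda>(i, j). A $$ (i div dim_row B, j div dim_col B) * B $$ (i mod dim_row B, j mod dim_col B))"

definition tensor :: "point set set \<Rightarrow> point set set \<Rightarrow> point set set" where
  "tensor P Q = (THE S. finite S \<and> S \<subseteq> cells \<and>
     assoc_matrix S = kronecker (assoc_matrix P) (assoc_matrix Q))"

definition rectangle :: "nat \<Rightarrow> nat \<Rightarrow> point set set" where
  "rectangle m n = {cell (x, y) | x y. x < m \<and> y < n}"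


section \<open>Closed paths\<close>

text \<open>In the last condition, \<open>int i + d\<close> with \<open>d\<close> from \<open>-2\<close> to \<open>2\<close> runs through the five excluded
  indices, read cyclically modulo \<open>n\<close>.\<close>

definition closed_path :: "point set set \<Rightarrow> bool" where
  "closed_path P \<longleftrightarrow> polyomino P \<and>
     (\<exists>(n::nat) A. n > 5 \<and> P = A ` {1..n + 1} \<and>
        A 1 = A (n + 1) \<and>
        (\<forall>i\<in>{1..n}. A i \<inter> A (i + 1) \<in> cell_edges (A i) \<inter> cell_edges (A (i + 1))) \<and>
        (\<forall>i\<in>{1..n}. \<forall>j\<in>{1..n}. i \<noteq> j \<longrightarrow> A i \<noteq> A j) \<and>
        (\<forall>i\<in>{1..n}. \<forall>j\<in>{1..n}.
           (\<forall>d\<in>{-2..2}. int j mod int n \<noteq> (int i + d) mod int n) \<longrightarrow> A i \<inter> A j = {}))"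


section \<open>Zig-zag walks\<close>

text \<open>The sequence is the restriction of \<open>I\<close> to \<open>{1..r}\<close>; the points \<open>v\<close> are used on
  \<open>{1..r + 1}\<close>, the points \<open>z\<close> and \<open>u\<close> on \<open>{1..r}\<close>.\<close>

definition zigzag_walk :: "point set set \<Rightarrow> nat \<Rightarrow> (nat \<Rightarrow> point set) \<Rightarrow> bool" where
  "zigzag_walk P r I \<longleftrightarrow> r \<ge> 1 \<and> inj_on I {1..r} \<and>
     (\<exists>v z u :: nat \<Rightarrow> point.
        (\<forall>i\<in>{1..r}. \<exists>a b. inner_interval P a b \<and> I i = interval a b \<and>
           ({v i, z i} = diag_corners a b \<and> {u i, v (i + 1)} = antidiag_corners a b \<or>
            {v i, z i} = antidiag_corners a b \<and> {u i, v (i + 1)} = diag_corners a b)) \<and>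
        I 1 \<inter> I r = {v 1} \<and> v 1 = v (r + 1) \<and>
        (\<forall>i\<in>{1..<r}. I i \<inter> I (i + 1) = {v (i + 1)}) \<and>
        (\<forall>i\<in>{1..r}. \<exists>a b. edge_interval P a b \<and> v i \<in> interval a b \<and> v (i + 1) \<in> interval a b) \<and>
        (\<forall>i\<in>{1..r}. \<forall>j\<in>{1..r}. i \<noteq> j \<longrightarrow>
           \<not> (\<exists>a b. inner_interval P a b \<and> z i \<in> interval a b \<and> z j \<in> interval a b)))"


section \<open>The polyomino ideal\<close>

text \<open>Polynomials are finitely supported maps from monomials (exponent maps) to coefficients.
  The type allows one variable for every lattice point; the carrier of \<open>poly_ring V\<close> consists
  of the polynomials whose variables all lie in \<open>V\<close>.\<close>

type_synonym 'k mpoly = "(point \<Rightarrow>\<^sub>0 nat) \<Rightarrow>\<^sub>0 'k"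

definition poly_ring :: "point set \<Rightarrow> 'k::field mpoly ring" where
  "poly_ring V = \<lparr>carrier = {p. \<forall>t\<in>Poly_Mapping.keys p. Poly_Mapping.keys t \<subseteq> V},
     monoid.mult = (*), one = 1, zero = 0, add = (+)\<rparr>"

definition Var :: "point \<Rightarrow> 'k::field mpoly" where
  "Var v = Poly_Mapping.single (Poly_Mapping.single v 1) 1"

definition inner_binomials :: "point set set \<Rightarrow> 'k::field mpoly set" where
  "inner_binomials P =
     {Var a * Var b - Var (fst a, snd b) * Var (fst b, snd a) | a b. inner_interval P a b}"

definition polyomino_ideal :: "point set set \<Rightarrow> 'k::field mpoly set" where
  "polyomino_ideal P = genideal (poly_ring (vertices P)) (inner_binomials P)"

end

theory Submission
  imports Defs "HOL-Library.Multiset" "HOL-Library.Nat_Bijection"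
begin

text \<open>If \<open>v\<^sub>i, z\<^sub>i, u\<^sub>i\<close> come from a zig-zag walk, then \<open>x\<^bsub>v 1\<^esub> (\<Prod>z\<^sub>i - \<Prod>u\<^sub>i)\<close> lies in the ideal, while
  neither factor does, since no inner binomial applies to \<open>\<Prod>z\<^sub>i\<close>; so the ideal is not prime.

  Conversely, compare two monomials by their height function \<open>c\<close>, the excess of exponents in each
  lower left quadrant; those for which \<open>c\<close> vanishes off the cells of \<open>\<Q>\<close> are the pairs identified by a
  certain monomial map. Take such a pair that cannot be moved to share a point by applying inner
  binomials. If some block of the path ends in an L-configuration or a ladder, then \<open>c\<close> vanishes at
  that corner, for otherwise the two monomials could be moved to meet; this zero propagates cell by
  cell around the closed path, so \<open>c = 0\<close> and both monomials are trivial. Hence the ideal is the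
  kernel of that map, whose target is a domain. If no block ends in this way, the corners at
  consecutive block ends form a zig-zag walk.\<close>

section \<open>Zig-zag walks obstruct primality\<close>

text \<open>The value c (x, y) belongs to the cell with lower left corner (x, y): an inner binomial
  changes c by one on exactly the cells of its rectangle, so vanishing off the cells of Q is
  invariant, and the question is whether nothing else is. The alternating sum of c over the four
  corners of a rectangle is the excess of one monomial over the other in it, so wherever the
  boundary values cancel, a point of one forces a point of the other. Inside a full rectangle, a row
  and a column met by both monomials can be completed to a common point. The obstacle is the end of
  a block, where the path turns away: beyond it c cancels in every row of vertices but possibly one,
  and a point in that row must be treated through its partner in another row. At a turn one unknown
  value remains, on the tile diagonally ahead of the corner; L-configurations and ladders are the
  shapes that force it to be zero. Ends are tested only in the direction of travel: one good end
  starts a forward sweep, and if every end is bad, the path between consecutive ends is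
  rigid.\<close>

abbreviation mon :: "(point \<Rightarrow>\<^sub>0 nat) \<Rightarrow> 'k::field mpoly" where
  "mon t \<equiv> Poly_Mapping.single t 1"

abbreviation ev :: "point \<Rightarrow> (point \<Rightarrow>\<^sub>0 nat)" where
  "ev v \<equiv> Poly_Mapping.single v 1"

section \<open>The polynomial ring on a point set and the polyomino ideal\<close>

lemma keys_add_nat: "Poly_Mapping.keys (s + t :: 'a \<Rightarrow>\<^sub>0 nat) = Poly_Mapping.keys s \<union> Poly_Mapping.keys t"
  by (auto simp: in_keys_iff lookup_add)

lemma poly_ring_simps [simp]:
  "\<one>\<^bsub>poly_ring V\<^esub> = 1" "\<zero>\<^bsub>poly_ring V\<^esub> = 0" "x \<oplus>\<^bsub>poly_ring V\<^esub> y = x + y" "x \<otimes>\<^bsub>poly_ring V\<^esub> y = x * y"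
  by (simp_all add: poly_ring_def)

lemma poly_ring_carrier:
  "p \<in> carrier (poly_ring V) \<longleftrightarrow> (\<forall>t\<in>Poly_Mapping.keys p. Poly_Mapping.keys t \<subseteq> V)"
  by (simp add: poly_ring_def)

lemma mpoly_keys_mult:
  assumes "t \<in> Poly_Mapping.keys (p * q :: 'k::field mpoly)"
  obtains a b where "t = a + b" "a \<in> Poly_Mapping.keys p" "b \<in> Poly_Mapping.keys q"
  using keys_mult[of p q] assms by blast

lemma poly_ring_closed:
  fixes p q :: "'k::field mpoly"
  assumes "p \<in> carrier (poly_ring V)" "q \<in> carrier (poly_ring V)"
  shows "p + q \<in> carrier (poly_ring V)" "p * q \<in> carrier (poly_ring V)"
    "p - q \<in> carrier (poly_ring V)"
proof -
  show "p + q \<in> carrier (poly_ring V)" "p - q \<in> carrier (poly_ring V)"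
    using assms keys_add[of p q] keys_diff[of p q] unfolding poly_ring_carrier by auto
  show "p * q \<in> carrier (poly_ring V)"
    unfolding poly_ring_carrier
  proof
    fix t assume "t \<in> Poly_Mapping.keys (p * q)"
    then obtain a b where "t = a + b" "a \<in> Poly_Mapping.keys p" "b \<in> Poly_Mapping.keys q"
      by (rule mpoly_keys_mult)
    then show "Poly_Mapping.keys t \<subseteq> V"
      using assms unfolding poly_ring_carrier by (simp add: keys_add_nat)
  qed
qed

lemma poly_ring_uminus:
  "(p :: 'k::field mpoly) \<in> carrier (poly_ring V) \<Longrightarrow> - p \<in> carrier (poly_ring V)"
  by (simp add: poly_ring_carrier)

lemma poly_ring_cring: "cring (poly_ring V :: 'k::field mpoly ring)"
proof (rule cringI)
  show "abelian_group (poly_ring V :: 'k mpoly ring)"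
  proof (rule abelian_groupI)
    fix x :: "'k mpoly" assume "x \<in> carrier (poly_ring V)"
    then show "\<exists>y\<in>carrier (poly_ring V). y \<oplus>\<^bsub>poly_ring V\<^esub> x = \<zero>\<^bsub>poly_ring V\<^esub>"
      by (intro bexI[of _ "- x"]) (auto simp: poly_ring_uminus)
  qed (auto simp: poly_ring_closed algebra_simps, auto simp: poly_ring_carrier)
  show "comm_monoid (poly_ring V :: 'k mpoly ring)"
    by (rule comm_monoidI) (auto simp: poly_ring_closed algebra_simps, auto simp: poly_ring_carrier)
qed (auto simp: algebra_simps)

lemma mon_carrier: "Poly_Mapping.keys t \<subseteq> V \<Longrightarrow> (mon t :: 'k::field mpoly) \<in> carrier (poly_ring V)"
  by (simp add: poly_ring_carrier)

lemma mon_mult: "(mon s :: 'k::field mpoly) * mon t = mon (s + t)"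
  by (simp add: mult_single)

lemma Var_mult: "(Var a :: 'k::field mpoly) * Var b = mon (ev a + ev b)"
  by (simp add: Var_def mult_single)

text \<open>An anti-diagonal corner is a vertex of the extreme cell at that corner of the interval,
  and this cell belongs to \<open>P\<close>.\<close>

lemma inner_interval_corners:
  assumes "inner_interval P a b"
  shows "a \<in> vertices P" "b \<in> vertices P" "(fst a, snd b) \<in> vertices P" "(fst b, snd a) \<in> vertices P"
proof -
  have p: "fst a < fst b" "snd a < snd b" and c: "\<And>C. C \<in> cells \<Longrightarrow> C \<subseteq> interval a b \<Longrightarrow> C \<in> P"
    using assms unfolding inner_interval_def proper_def by auto
  show "a \<in> vertices P" "b \<in> vertices P" using assms unfolding inner_interval_def by auto
  have s: "cell (fst a, snd b - 1) \<subseteq> interval a b" "cell (fst b - 1, snd a) \<subseteq> interval a b"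
    using p by (auto simp: cell_def interval_def)
  have "cell (fst a, snd b - 1) \<in> P" "cell (fst b - 1, snd a) \<in> P"
    by (rule c[OF _ s(1)], simp add: cells_def, rule c[OF _ s(2)], simp add: cells_def)
  moreover have "(fst a, snd b) \<in> cell (fst a, snd b - 1)" "(fst b, snd a) \<in> cell (fst b - 1, snd a)"
    using p by (simp_all add: cell_def interval_def)
  ultimately show "(fst a, snd b) \<in> vertices P" "(fst b, snd a) \<in> vertices P"
    unfolding vertices_def by (meson UnionI)+
qed

lemma inner_binomials_eq:
  "(inner_binomials P :: 'k::field mpoly set) =
    {mon (ev a + ev b) - mon (ev (fst a, snd b) + ev (fst b, snd a)) | a b. inner_interval P a b}"
  unfolding inner_binomials_def Var_mult ..

lemma inner_binomials_carrier: "(inner_binomials P :: 'k::field mpoly set) \<subseteq> carrier (poly_ring (vertices P))"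
proof
  fix g :: "'k mpoly" assume "g \<in> inner_binomials P"
  then obtain a b where ab: "inner_interval P a b"
    "g = mon (ev a + ev b) - mon (ev (fst a, snd b) + ev (fst b, snd a))"
    unfolding inner_binomials_eq by blast
  show "g \<in> carrier (poly_ring (vertices P))" unfolding ab(2) using inner_interval_corners[OF ab(1)]
    by (intro poly_ring_closed(3) mon_carrier) (simp_all add: keys_add_nat)
qed

context
  fixes P :: "point set set" and Id :: "'k::field mpoly set"
  defines "Id \<equiv> polyomino_ideal P"
begin

lemma Id_ideal: "ideal Id (poly_ring (vertices P))"
  unfolding Id_def polyomino_ideal_def
  by (rule ring.genideal_ideal[OF cring.axioms(1)[OF poly_ring_cring] inner_binomials_carrier])

lemma Id_gen: "inner_binomials P \<subseteq> Id"
  unfolding Id_def polyomino_ideal_def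
  by (rule ring.genideal_self[OF cring.axioms(1)[OF poly_ring_cring] inner_binomials_carrier])

lemma Id_minimal: "ideal J (poly_ring (vertices P)) \<Longrightarrow> inner_binomials P \<subseteq> J \<Longrightarrow> Id \<subseteq> J"
  unfolding Id_def polyomino_ideal_def
  by (rule ring.genideal_minimal[OF cring.axioms(1)[OF poly_ring_cring]])

lemma Id_carrier: "p \<in> Id \<Longrightarrow> p \<in> carrier (poly_ring (vertices P))"
  using ideal.Icarr[OF Id_ideal] .

lemma Id_add: "p \<in> Id \<Longrightarrow> q \<in> Id \<Longrightarrow> p + q \<in> Id"
  using additive_subgroup.a_closed[OF ideal.axioms(1)[OF Id_ideal], of p q] by simp

lemma Id_zero: "0 \<in> Id"
  using additive_subgroup.zero_closed[OF ideal.axioms(1)[OF Id_ideal]] by simp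

lemma Id_mult: "p \<in> Id \<Longrightarrow> q \<in> carrier (poly_ring (vertices P)) \<Longrightarrow> q * p \<in> Id"
  using ideal.I_l_closed[OF Id_ideal, of p q] by simp

lemma Id_uminus:
  assumes "p \<in> Id" shows "- p \<in> Id"
proof -
  have "(- 1) * p \<in> Id" by (rule Id_mult[OF assms]) (auto simp: poly_ring_carrier)
  then show ?thesis by simp
qed

text \<open>Applying an inner binomial inside a larger monomial means multiplying the generator by
  the remaining factor \<open>mon t\<close>.\<close>

lemma Id_move:
  assumes "inner_interval P a b" "Poly_Mapping.keys t \<subseteq> vertices P"
  shows "mon (t + (ev a + ev b)) - mon (t + (ev (fst a, snd b) + ev (fst b, snd a))) \<in> Id"
proof -
  have "mon (ev a + ev b) - mon (ev (fst a, snd b) + ev (fst b, snd a)) \<in> Id"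
    using Id_gen assms(1) unfolding inner_binomials_eq by blast
  from Id_mult[OF this mon_carrier[OF assms(2)]] show ?thesis
    by (simp add: right_diff_distrib mon_mult)
qed

text \<open>These are the polynomials none of whose monomials divides z. They serve to show that a
  polynomial with the term z is not in the polyomino ideal: it suffices that no term of an inner
  binomial divides z.\<close>

definition avoiding :: "(point \<Rightarrow>\<^sub>0 nat) \<Rightarrow> 'k mpoly set" where
  "avoiding z = {p \<in> carrier (poly_ring (vertices P)). \<forall>t\<in>Poly_Mapping.keys p. \<forall>s. z \<noteq> t + s}"

text \<open>A multiple of a monomial that does not divide z does not divide z either.\<close>

lemma avoiding_ideal: "ideal (avoiding z) (poly_ring (vertices P))"
proof -
  let ?R = "poly_ring (vertices P) :: 'k mpoly ring"
  interpret R: cring ?R by (rule poly_ring_cring)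
  have um: "- p \<in> avoiding z" if "p \<in> avoiding z" for p
    using that unfolding avoiding_def by (auto simp: poly_ring_carrier)
  have ainv: "\<ominus>\<^bsub>?R\<^esub> p = - p" if "p \<in> carrier ?R" for p
    by (rule R.minus_equality) (use that in \<open>auto simp: poly_ring_uminus\<close>)
  have mult: "q * p \<in> avoiding z" if "p \<in> avoiding z" "q \<in> carrier ?R" for p q
    unfolding avoiding_def
  proof (intro CollectI conjI ballI allI notI)
    show "q * p \<in> carrier ?R" using that by (auto simp: avoiding_def poly_ring_closed)
    fix t s assume "t \<in> Poly_Mapping.keys (q * p)" "z = t + s"
    then obtain a b where ab: "t = a + b" "b \<in> Poly_Mapping.keys p" by (meson mpoly_keys_mult)
    then have "z = b + (a + s)" using \<open>z = t + s\<close> by (simp add: add_ac)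
    then show False using that(1) ab(2) unfolding avoiding_def by blast
  qed
  show ?thesis
  proof (rule idealI)
    show "subgroup (avoiding z) (add_monoid ?R)"
    proof (rule R.add.subgroupI)
      show "avoiding z \<subseteq> carrier ?R" unfolding avoiding_def by auto
      have "0 \<in> avoiding z" unfolding avoiding_def by (auto simp: poly_ring_carrier)
      then show "avoiding z \<noteq> {}" by blast
      fix p q assume p: "p \<in> avoiding z"
      then show "\<ominus>\<^bsub>?R\<^esub> p \<in> avoiding z" using um[OF p] ainv[of p] unfolding avoiding_def by auto
      assume q: "q \<in> avoiding z"
      show "p \<oplus>\<^bsub>?R\<^esub> q \<in> avoiding z"
        using p q keys_add[of p q] unfolding avoiding_def by (auto simp: poly_ring_closed)
    qed
  next
    show "ring ?R" by (rule R.ring_axioms)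
    fix a x assume a: "a \<in> avoiding z" "x \<in> carrier ?R"
    show "x \<otimes>\<^bsub>?R\<^esub> a \<in> avoiding z" using mult[OF a] by simp
    show "a \<otimes>\<^bsub>?R\<^esub> x \<in> avoiding z" using mult[OF a] by (simp add: mult.commute)
  qed
qed

lemma Id_avoiding:
  assumes "\<And>a b s. inner_interval P a b \<Longrightarrow> z \<noteq> ev a + ev b + s \<and> z \<noteq> ev (fst a, snd b) + ev (fst b, snd a) + s"
  shows "Id \<subseteq> avoiding z"
proof (rule Id_minimal[OF avoiding_ideal])
  show "inner_binomials P \<subseteq> avoiding z"
  proof
    fix g :: "'k mpoly" assume g: "g \<in> inner_binomials P"
    then obtain a b where ab: "inner_interval P a b"
      "g = mon (ev a + ev b) - mon (ev (fst a, snd b) + ev (fst b, snd a))"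
      unfolding inner_binomials_eq by blast
    have "Poly_Mapping.keys g \<subseteq> {ev a + ev b, ev (fst a, snd b) + ev (fst b, snd a)}"
      unfolding ab(2) using keys_diff by fastforce
    then show "g \<in> avoiding z" using assms[OF ab(1)] g inner_binomials_carrier unfolding avoiding_def by blast
  qed
qed

text \<open>The monomial \<open>x\<^bsub>v 1\<^esub> \<Prod>z\<^sub>i\<close> is rewritten, one interval after the other, into
  \<open>x\<^bsub>v 1\<^esub> \<Prod>u\<^sub>i\<close>, while no inner binomial applies to \<open>\<Prod>z\<^sub>i\<close>.\<close>

theorem zigzag_not_prime:
  assumes zz: "zigzag_walk P r I"
  shows "\<not> primeideal Id (poly_ring (vertices P))"
proof
  assume "primeideal Id (poly_ring (vertices P))"
  then have prime: "p \<in> Id \<or> q \<in> Id"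
    if "p \<in> carrier (poly_ring (vertices P))" "q \<in> carrier (poly_ring (vertices P))" "p * q \<in> Id" for p q
    using primeideal.I_prime[of Id "poly_ring (vertices P)" p q] that by simp
  have r: "r \<ge> 1" using zz unfolding zigzag_walk_def by (elim conjE)
  from zz[unfolded zigzag_walk_def, THEN conjunct2, THEN conjunct2]
  obtain v z u where zw: "(\<forall>i\<in>{1..r}. \<exists>a b. inner_interval P a b \<and> I i = interval a b \<and>
           ({v i, z i} = diag_corners a b \<and> {u i, v (i + 1)} = antidiag_corners a b \<or>
            {v i, z i} = antidiag_corners a b \<and> {u i, v (i + 1)} = diag_corners a b)) \<and>
        I 1 \<inter> I r = {v 1} \<and> v 1 = v (r + 1) \<and>
        (\<forall>i\<in>{1..<r}. I i \<inter> I (i + 1) = {v (i + 1)}) \<and>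
        (\<forall>i\<in>{1..r}. \<exists>a b. edge_interval P a b \<and> v i \<in> interval a b \<and> v (i + 1) \<in> interval a b) \<and>
        (\<forall>i\<in>{1..r}. \<forall>j\<in>{1..r}. i \<noteq> j \<longrightarrow>
           \<not> (\<exists>a b. inner_interval P a b \<and> z i \<in> interval a b \<and> z j \<in> interval a b))"
    by (elim exE)
  have I: "\<exists>a b. inner_interval P a b \<and> I i = interval a b \<and>
           ({v i, z i} = diag_corners a b \<and> {u i, v (i + 1)} = antidiag_corners a b \<or>
            {v i, z i} = antidiag_corners a b \<and> {u i, v (i + 1)} = diag_corners a b)" if "i \<in> {1..r}" for i
    using conjunct1[OF zw] that by (rule bspec)
  have closed: "v 1 = v (r + 1)" using zw by (elim conjE)
  have "\<forall>i\<in>{1..r}. \<forall>j\<in>{1..r}. i \<noteq> j \<longrightarrow>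
           \<not> (\<exists>a b. inner_interval P a b \<and> z i \<in> interval a b \<and> z j \<in> interval a b)"
    using zw by (elim conjE)
  then have sep: False if "i \<in> {1..r}" "j \<in> {1..r}" "i \<noteq> j" "inner_interval P a b"
       "z i \<in> interval a b" "z j \<in> interval a b" for i j a b
    using that by blast
  have ne: "a \<noteq> b" "(fst a, snd b) \<noteq> (fst b, snd a)" "a \<in> interval a b" "b \<in> interval a b"
     "(fst a, snd b) \<in> interval a b" "(fst b, snd a) \<in> interval a b" if "inner_interval P a b" for a b
  proof -
    have "fst a < fst b" "snd a < snd b" using that unfolding inner_interval_def proper_def by simp_all
    then show "a \<noteq> b" "(fst a, snd b) \<noteq> (fst b, snd a)" "a \<in> interval a b" "b \<in> interval a b"
      "(fst a, snd b) \<in> interval a b" "(fst b, snd a) \<in> interval a b"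
      by (auto simp: interval_def mem_Times_iff)
  qed
  have V: "v i \<in> vertices P" "z i \<in> vertices P" "u i \<in> vertices P" "v (i + 1) \<in> vertices P"
     and zu: "\<exists>a b. inner_interval P a b \<and> z i \<in> interval a b \<and> u i \<in> interval a b"
     and zune: "z i \<noteq> u i"
    if i: "i \<in> {1..r}" for i
  proof -
    obtain a b where ab: "inner_interval P a b" and
      c: "{v i, z i} = diag_corners a b \<and> {u i, v (i + 1)} = antidiag_corners a b \<or>
            {v i, z i} = antidiag_corners a b \<and> {u i, v (i + 1)} = diag_corners a b" using I[OF i] by blast
    \<comment> \<open>As a set, the four points are the corners of the interval in either
      orientation, so both cases are treated at once.\<close>
    have "{v i, z i, u i, v (i + 1)} = {v i, z i} \<union> {u i, v (i + 1)}" by auto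
    then have cs: "{v i, z i, u i, v (i + 1)} = {a, b, (fst a, snd b), (fst b, snd a)}"
      using c unfolding diag_corners_def antidiag_corners_def by (elim disjE conjE) auto
    have vi: "{a, b, (fst a, snd b), (fst b, snd a)} \<subseteq> vertices P" using inner_interval_corners[OF ab] by simp
    have ii: "{a, b, (fst a, snd b), (fst b, snd a)} \<subseteq> interval a b" using ne(3-6)[OF ab] by simp
    have *: "{v i, z i, u i, v (i + 1)} \<subseteq> vertices P" using vi unfolding cs .
    have "{v i, z i, u i, v (i + 1)} \<subseteq> interval a b" using ii unfolding cs .
    then have *: "{v i, z i, u i, v (i + 1)} \<subseteq> vertices P" "{z i, u i} \<subseteq> interval a b"
      using * by simp_all
    show "v i \<in> vertices P" "z i \<in> vertices P" "u i \<in> vertices P" "v (i + 1) \<in> vertices P" using *(1) by simp_all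
    have "z i \<in> interval a b" "u i \<in> interval a b" using *(2) by simp_all
    then show "\<exists>a b. inner_interval P a b \<and> z i \<in> interval a b \<and> u i \<in> interval a b" using ab by blast
    have "a \<noteq> (fst a, snd b)" "a \<noteq> (fst b, snd a)" "b \<noteq> (fst a, snd b)" "b \<noteq> (fst b, snd a)"
      using ab unfolding inner_interval_def proper_def by (auto simp: prod_eq_iff)
    then have "{a, b} \<inter> {(fst a, snd b), (fst b, snd a)} = {}" by auto
    moreover have "{v i, z i} \<inter> {u i, v (i + 1)} = {a, b} \<inter> {(fst a, snd b), (fst b, snd a)}"
      using c unfolding diag_corners_def antidiag_corners_def by (elim disjE conjE) auto
    ultimately show "z i \<noteq> u i" by auto
  qed
  have vzuv: "mon (t + (ev (v i) + ev (z i))) - mon (t + (ev (u i) + ev (v (i + 1)))) \<in> Id"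
    if i: "i \<in> {1..r}" and t: "Poly_Mapping.keys t \<subseteq> vertices P" for i t
  proof -
    obtain a b where ab: "inner_interval P a b" and
      c: "{v i, z i} = diag_corners a b \<and> {u i, v (i + 1)} = antidiag_corners a b \<or>
            {v i, z i} = antidiag_corners a b \<and> {u i, v (i + 1)} = diag_corners a b" using I[OF i] by blast
    have s: "ev x + ev y = ev x' + ev y'" if "{x, y} = {x', y'}" for x y x' y' :: point
      using that by (auto simp: doubleton_eq_iff add.commute)
    have m: "mon (t + (ev a + ev b)) - mon (t + (ev (fst a, snd b) + ev (fst b, snd a))) \<in> Id"
      by (rule Id_move[OF ab t])
    have m': "mon (t + (ev (fst a, snd b) + ev (fst b, snd a))) - mon (t + (ev a + ev b)) \<in> Id"
      using Id_uminus[OF m] by simp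
    from c show ?thesis
    proof (elim disjE conjE)
      assume "{v i, z i} = diag_corners a b" "{u i, v (i + 1)} = antidiag_corners a b"
      then show ?thesis using m unfolding diag_corners_def antidiag_corners_def
        by (simp only: s[of "v i" "z i" a b] s[of "u i" "v (i + 1)" "(fst a, snd b)" "(fst b, snd a)"])
    next
      assume "{v i, z i} = antidiag_corners a b" "{u i, v (i + 1)} = diag_corners a b"
      then show ?thesis using m' unfolding diag_corners_def antidiag_corners_def
        by (simp only: s[of "v i" "z i" "(fst a, snd b)" "(fst b, snd a)"] s[of "u i" "v (i + 1)" a b])
    qed
  qed
  define zs where "zs = (\<Sum>i\<in>{1..r}. ev (z i))"
  define us where "us = (\<Sum>i\<in>{1..r}. ev (u i))"
  have keys_sum: "Poly_Mapping.keys (\<Sum>i\<in>A. ev (w i)) = w ` A" if "finite A" for w :: "nat \<Rightarrow> point" and A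
    using that by (induction A rule: finite_induct) (auto simp: keys_add_nat)
  have keys: "Poly_Mapping.keys zs = z ` {1..r}" "Poly_Mapping.keys us = u ` {1..r}"
    unfolding zs_def us_def by (rule keys_sum; simp)+
  \<comment> \<open>Interpolates between v_1 z_1 ... z_r and u_1 ... u_r v_{r+1}: after k rewritings
    the loose factor has arrived at v_{k+1}, the starting corner of the next interval.\<close>
  define m where "m k = (\<Sum>i\<in>{1..k}. ev (u i)) + (\<Sum>i\<in>{k+1..r}. ev (z i)) + ev (v (k + 1))" for k
  have step: "mon (m k) - mon (m (k + 1)) \<in> Id" if "k < r" for k
  proof -
    define t where "t = (\<Sum>i\<in>{1..k}. ev (u i)) + (\<Sum>i\<in>{k+2..r}. ev (z i))"
    have "{k+1..r} = insert (k+1) {k+2..r}" "{1..k+1} = insert (k+1) {1..k}" using that by auto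
    then have "m k = t + (ev (v (k + 1)) + ev (z (k + 1)))" "m (k + 1) = t + (ev (u (k + 1)) + ev (v (k + 1 + 1)))"
      unfolding m_def t_def by (simp_all add: algebra_simps)
    moreover have "Poly_Mapping.keys t \<subseteq> vertices P"
      unfolding t_def keys_add_nat using keys_sum[of "{1..k}" u] keys_sum[of "{k+2..r}" z] V(2,3) that by auto
    ultimately show ?thesis using vzuv[of "k + 1" t] that by simp
  qed
  have "k \<le> r \<Longrightarrow> mon (m 0) - mon (m k) \<in> Id" for k
  proof (induction k)
    case 0 then show ?case using Id_zero by simp
  next
    case (Suc k)
    then show ?case using Id_add[of "mon (m 0) - mon (m k)" "mon (m k) - mon (m (k + 1))"] step[of k] by simp
  qed
  from this[of r] have "mon (m 0) - mon (m r) \<in> Id" by simp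
  moreover have "m 0 = ev (v 1) + zs" "m r = ev (v 1) + us"
    unfolding m_def zs_def us_def using closed by (simp_all add: add.commute)
  ultimately have prod: "mon (ev (v 1)) * (mon zs - mon us) \<in> Id" by (simp add: right_diff_distrib mon_mult)
  have v1: "v 1 \<in> vertices P" using V(1)[of 1] r by simp
  have "mon (ev (v 1)) \<in> carrier (poly_ring (vertices P))" using v1 by (intro mon_carrier) simp
  moreover have "mon zs - mon us \<in> carrier (poly_ring (vertices P))"
    using V by (intro poly_ring_closed mon_carrier) (auto simp: keys)
  ultimately have "mon (ev (v 1)) \<in> Id \<or> mon zs - mon us \<in> Id" using prime prod by blast
  then show False
  proof
    assume a: "mon (ev (v 1)) \<in> Id"
    \<comment> \<open>Only one variable occurs, so no product of two different variables divides
      it.\<close>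
    have no: "ev (v 1) \<noteq> ev x + ev y + s" if "x \<noteq> y" for x y s
    proof
      assume e: "ev (v 1) = ev x + ev y + s"
      have "Poly_Mapping.keys (ev x + ev y + s) = {v 1}" unfolding e[symmetric] by simp
      then show False using that by (auto simp: keys_add_nat)
    qed
    have "Id \<subseteq> avoiding (ev (v 1))"
    proof (rule Id_avoiding)
      fix a b s assume ab: "inner_interval P a b"
      show "ev (v 1) \<noteq> ev a + ev b + s \<and> ev (v 1) \<noteq> ev (fst a, snd b) + ev (fst b, snd a) + s"
        using no[OF ne(1)[OF ab]] no[OF ne(2)[OF ab]] by blast
    qed
    then have "(mon (ev (v 1)) :: 'k mpoly) \<in> avoiding (ev (v 1))" using a by blast
    then have "\<forall>s. ev (v 1) \<noteq> ev (v 1) + s" unfolding avoiding_def by simp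
    then show False by (metis add.right_neutral)
  next
    assume a: "mon zs - mon us \<in> Id"
    \<comment> \<open>Two different corners of one inner interval dividing the product would be some
      z_i and z_j with i and j different, which the last condition on a zig-zag walk
      forbids.\<close>
    have no: "zs \<noteq> ev x + ev y + s" if "inner_interval P a b" "x \<noteq> y" "x \<in> interval a b" "y \<in> interval a b" for a b x y s
    proof
      assume e: "zs = ev x + ev y + s"
      have "{x, y} \<subseteq> Poly_Mapping.keys zs" unfolding e by (auto simp: keys_add_nat)
      then obtain i j where "i \<in> {1..r}" "j \<in> {1..r}" "z i = x" "z j = y" unfolding keys by auto
      then show False using sep[of i j a b] that by auto
    qed
    have "Id \<subseteq> avoiding zs"
    proof (rule Id_avoiding)
      fix a b s assume ab: "inner_interval P a b"
      show "zs \<noteq> ev a + ev b + s \<and> zs \<noteq> ev (fst a, snd b) + ev (fst b, snd a) + s"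
        using no[OF ab ne(1)[OF ab] ne(3,4)[OF ab]] no[OF ab ne(2)[OF ab] ne(5,6)[OF ab]] by blast
    qed
    then have nd: "mon zs - mon us \<in> avoiding zs" using a by blast
    \<comment> \<open>Needed for \<open>zs\<close> to be a term of the difference. The corner u_1
      shares its interval with z_1, so it equals no other z_j, and it is not z_1 either.\<close>
    have "zs \<noteq> us"
    proof
      assume "zs = us"
      then have "u 1 \<in> z ` {1..r}" using keys r by auto
      then obtain j where j: "j \<in> {1..r}" "u 1 = z j" by auto
      have "j \<noteq> 1" using zune[of 1] j r by auto
      then show False using zu[of 1] sep[of 1 j] j r by auto
    qed
    then have "zs \<in> Poly_Mapping.keys (mon zs - mon us :: 'k mpoly)"
      by (simp add: in_keys_iff lookup_minus lookup_single)
    then have "\<forall>s. zs \<noteq> zs + s" using nd unfolding avoiding_def by blast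
    then show False by (metis add.right_neutral)
  qed
qed

end

section \<open>Primality from connected fibres\<close>

text \<open>The linear extension of a map between monomials. The target variables are indexed by
  naturals; their order induces one on the exponents, which makes the target a domain.\<close>

definition map_monomials :: "((point \<Rightarrow>\<^sub>0 nat) \<Rightarrow> (nat \<Rightarrow>\<^sub>0 nat)) \<Rightarrow> 'k::field mpoly \<Rightarrow> ((nat \<Rightarrow>\<^sub>0 nat) \<Rightarrow>\<^sub>0 'k)" where
  "map_monomials f p = (\<Sum>t\<in>Poly_Mapping.keys p. Poly_Mapping.single (f t) (Poly_Mapping.lookup p t))"

lemma map_monomials_superset:
  assumes "finite F" "Poly_Mapping.keys p \<subseteq> F"
  shows "map_monomials f p = (\<Sum>t\<in>F. Poly_Mapping.single (f t) (Poly_Mapping.lookup p t))"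
  unfolding map_monomials_def using assms
  by (intro sum.mono_neutral_left) (auto simp: in_keys_iff)

lemma map_monomials_add: "map_monomials f (p + q) = map_monomials f p + map_monomials f q"
proof -
  let ?F = "Poly_Mapping.keys p \<union> Poly_Mapping.keys q"
  have "map_monomials f (p + q) = (\<Sum>t\<in>?F. Poly_Mapping.single (f t) (Poly_Mapping.lookup (p + q) t))"
    using keys_add[of p q] by (intro map_monomials_superset) auto
  also have "\<dots> = (\<Sum>t\<in>?F. Poly_Mapping.single (f t) (Poly_Mapping.lookup p t)) + (\<Sum>t\<in>?F. Poly_Mapping.single (f t) (Poly_Mapping.lookup q t))"
    by (simp add: lookup_add single_add sum.distrib)
  also have "\<dots> = map_monomials f p + map_monomials f q" by (simp add: map_monomials_superset[of ?F p] map_monomials_superset[of ?F q])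
  finally show ?thesis .
qed

lemma map_monomials_0 [simp]: "map_monomials f 0 = 0"
  by (simp add: map_monomials_def)

lemma map_monomials_single: "map_monomials f (Poly_Mapping.single t a) = Poly_Mapping.single (f t) a"
  by (cases "a = 0") (simp_all add: map_monomials_def)

lemma map_monomials_uminus: "map_monomials f (- p) = - map_monomials f p"
  using map_monomials_add[of f p "- p"] by (simp add: eq_neg_iff_add_eq_0 add.commute)

lemma map_monomials_diff: "map_monomials f (p - q) = map_monomials f p - map_monomials f q"
  using map_monomials_add[of f p "- q"] map_monomials_uminus[of f q] by simp

lemma map_monomials_sum: "map_monomials f (sum g A) = (\<Sum>x\<in>A. map_monomials f (g x))"
  by (induction A rule: infinite_finite_induct) (auto simp: map_monomials_add)

lemma sum_single_lookup: "(p :: 'a \<Rightarrow>\<^sub>0 'b::comm_monoid_add) = (\<Sum>t\<in>Poly_Mapping.keys p. Poly_Mapping.single t (Poly_Mapping.lookup p t))"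
proof (rule poly_mapping_eqI)
  fix k
  have "Poly_Mapping.lookup (\<Sum>t\<in>Poly_Mapping.keys p. Poly_Mapping.single t (Poly_Mapping.lookup p t)) k =
     (\<Sum>t\<in>Poly_Mapping.keys p. if t = k then Poly_Mapping.lookup p t else 0)"
    by (simp add: lookup_sum lookup_single when_def)
  also have "\<dots> = Poly_Mapping.lookup p k" by (simp add: in_keys_iff)
  finally show "Poly_Mapping.lookup p k = Poly_Mapping.lookup (\<Sum>t\<in>Poly_Mapping.keys p. Poly_Mapping.single t (Poly_Mapping.lookup p t)) k" ..
qed

lemma map_monomials_mult:
  assumes "\<And>s t. f (s + t) = f s + f t"
  shows "map_monomials f (p * q) = map_monomials f p * map_monomials f q"
proof -
  have "p * q = (\<Sum>s\<in>Poly_Mapping.keys p. Poly_Mapping.single s (Poly_Mapping.lookup p s)) *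
      (\<Sum>t\<in>Poly_Mapping.keys q. Poly_Mapping.single t (Poly_Mapping.lookup q t))"
    using sum_single_lookup[of p] sum_single_lookup[of q] by simp
  also have "\<dots> = (\<Sum>s\<in>Poly_Mapping.keys p. \<Sum>t\<in>Poly_Mapping.keys q.
      Poly_Mapping.single (s + t) (Poly_Mapping.lookup p s * Poly_Mapping.lookup q t))"
    by (simp add: sum_product mult_single)
  finally have "map_monomials f (p * q) = (\<Sum>s\<in>Poly_Mapping.keys p. \<Sum>t\<in>Poly_Mapping.keys q.
      Poly_Mapping.single (f s + f t) (Poly_Mapping.lookup p s * Poly_Mapping.lookup q t))"
    by (simp add: map_monomials_sum map_monomials_single assms)
  also have "\<dots> = map_monomials f p * map_monomials f q"
    unfolding map_monomials_def by (simp add: sum_product mult_single)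
  finally show ?thesis .
qed

text \<open>The ideal is shown to be the kernel of \<open>map_monomials f\<close>, a homomorphism
  into a domain. Assumption \<open>inner\<close> puts the generators into the kernel, and
  \<open>conn\<close> puts into the ideal the binomials that span the kernel.\<close>

theorem prime_if_connected:
  fixes P :: "point set set" and f :: "(point \<Rightarrow>\<^sub>0 nat) \<Rightarrow> (nat \<Rightarrow>\<^sub>0 nat)"
    and Id :: "'k::field mpoly set"
  defines "Id \<equiv> polyomino_ideal P"
  assumes add: "\<And>s t. f (s + t) = f s + f t"
    and inner: "\<And>a b. inner_interval P a b \<Longrightarrow>
       f (ev a + ev b) = f (ev (fst a, snd b) + ev (fst b, snd a))"
    and conn: "\<And>s t. Poly_Mapping.keys s \<subseteq> vertices P \<Longrightarrow> Poly_Mapping.keys t \<subseteq> vertices P \<Longrightarrow>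
       f s = f t \<Longrightarrow> (mon s :: 'k mpoly) - mon t \<in> Id"
  shows "primeideal Id (poly_ring (vertices P))"
proof -
  let ?R = "poly_ring (vertices P) :: 'k mpoly ring"
  interpret R: cring ?R by (rule poly_ring_cring)
  have f0: "f 0 = 0" using add[of 0 0] by simp
  have id: "Id = polyomino_ideal P" by (simp add: Id_def)
  have ker: "p \<in> carrier ?R \<Longrightarrow> map_monomials f p = 0 \<Longrightarrow> p \<in> Id" for p
  proof (induction "card (Poly_Mapping.keys p)" arbitrary: p rule: less_induct)
    case (less p)
    show ?case
    proof (cases "p = 0")
      case True then show ?thesis using Id_zero unfolding id by simp
    next
      case False
      then obtain t where t: "t \<in> Poly_Mapping.keys p" by (metis keys_eq_empty ex_in_conv)
      \<comment> \<open>The coefficients of all terms with the same image as t must cancel, so t is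
        not alone in its fibre.\<close>
      have "\<exists>s\<in>Poly_Mapping.keys p. s \<noteq> t \<and> f s = f t"
      proof (rule ccontr)
        assume n: "\<not> ?thesis"
        have "Poly_Mapping.lookup (map_monomials f p) (f t) = (\<Sum>s\<in>Poly_Mapping.keys p. if f s = f t then Poly_Mapping.lookup p s else 0)"
          by (simp add: map_monomials_def lookup_sum lookup_single when_def)
        also have "\<dots> = (\<Sum>s\<in>Poly_Mapping.keys p. if s = t then Poly_Mapping.lookup p s else 0)"
          using n by (intro sum.cong) auto
        also have "\<dots> = Poly_Mapping.lookup p t" using t by simp
        finally show False using less(3) t by (simp add: in_keys_iff)
      qed
      then obtain s where s: "s \<in> Poly_Mapping.keys p" "s \<noteq> t" "f s = f t" by blast
      define a where "a = Poly_Mapping.lookup p t"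
      \<comment> \<open>Subtracting this multiple of a binomial of the ideal removes t and creates
        no new term, because s already occurs in p.\<close>
      define g where "g = Poly_Mapping.single 0 a * (mon t - mon s)"
      have g: "g = Poly_Mapping.single t a - Poly_Mapping.single s a"
        unfolding g_def by (simp add: right_diff_distrib mult_single)
      have keys: "Poly_Mapping.keys s \<subseteq> vertices P" "Poly_Mapping.keys t \<subseteq> vertices P"
        using less(2) s(1) t unfolding poly_ring_carrier by auto
      have "mon t - mon s \<in> Id" using conn keys s(3) by simp
      then have gI: "g \<in> Id" unfolding g_def id by (intro Id_mult) (auto simp: poly_ring_carrier)
      then have gc: "g \<in> carrier ?R" unfolding id by (rule Id_carrier)
      have k: "Poly_Mapping.keys (p - g) \<subseteq> Poly_Mapping.keys p - {t}"
      proof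
        fix x assume "x \<in> Poly_Mapping.keys (p - g)"
        then have "Poly_Mapping.lookup p x - Poly_Mapping.lookup g x \<noteq> 0" by (simp add: in_keys_iff lookup_minus)
        then show "x \<in> Poly_Mapping.keys p - {t}"
          using s unfolding g a_def by (auto simp: lookup_minus lookup_single in_keys_iff when_def split: if_splits)
      qed
      have "card (Poly_Mapping.keys (p - g)) < card (Poly_Mapping.keys p)"
        using k t by (intro psubset_card_mono) auto
      moreover have "p - g \<in> carrier ?R" using less(2) gc by (rule poly_ring_closed)
      moreover have "map_monomials f (p - g) = 0" using less(3) s(3) unfolding map_monomials_diff g map_monomials_single by simp
      ultimately have "p - g \<in> Id" using less(1) by blast
      then have "(p - g) + g \<in> Id" using gI unfolding id by (intro Id_add)
      then show ?thesis by simp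
    qed
  qed
  have idl: "ideal {p \<in> carrier ?R. map_monomials f p = 0} ?R"
  proof (rule idealI)
    show "ring ?R" by (rule R.ring_axioms)
    show "subgroup {p \<in> carrier ?R. map_monomials f p = 0} (add_monoid ?R)"
    proof (rule R.add.subgroupI)
      have "0 \<in> {p \<in> carrier ?R. map_monomials f p = 0}" by (simp add: poly_ring_carrier)
      then show "{p \<in> carrier ?R. map_monomials f p = 0} \<noteq> {}" by blast
      fix p q assume p: "p \<in> {p \<in> carrier ?R. map_monomials f p = 0}"
      have "\<ominus>\<^bsub>?R\<^esub> p = - p" by (rule R.minus_equality) (use p in \<open>auto simp: poly_ring_uminus\<close>)
      then show "\<ominus>\<^bsub>?R\<^esub> p \<in> {p \<in> carrier ?R. map_monomials f p = 0}" using p by (simp add: poly_ring_uminus map_monomials_uminus)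
      assume "q \<in> {p \<in> carrier ?R. map_monomials f p = 0}"
      then show "p \<oplus>\<^bsub>?R\<^esub> q \<in> {p \<in> carrier ?R. map_monomials f p = 0}" using p by (simp add: poly_ring_closed map_monomials_add)
    qed auto
    fix a x assume "a \<in> {p \<in> carrier ?R. map_monomials f p = 0}" "x \<in> carrier ?R"
    then show "x \<otimes>\<^bsub>?R\<^esub> a \<in> {p \<in> carrier ?R. map_monomials f p = 0}" "a \<otimes>\<^bsub>?R\<^esub> x \<in> {p \<in> carrier ?R. map_monomials f p = 0}"
      by (simp_all add: poly_ring_closed map_monomials_mult[OF add])
  qed
  have ker': "Id \<subseteq> {p \<in> carrier ?R. map_monomials f p = 0}" unfolding id
  proof (rule Id_minimal[OF idl])
    show "inner_binomials P \<subseteq> {p \<in> carrier ?R. map_monomials f p = 0}"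
    proof
      fix g :: "'k mpoly" assume g: "g \<in> inner_binomials P"
      then obtain a b where ab: "inner_interval P a b"
        "g = mon (ev a + ev b) - mon (ev (fst a, snd b) + ev (fst b, snd a))"
        unfolding inner_binomials_eq by blast
      have "map_monomials f g = 0" unfolding ab(2) map_monomials_diff map_monomials_single using inner[OF ab(1)] by simp
      then show "g \<in> {p \<in> carrier ?R. map_monomials f p = 0}" using g inner_binomials_carrier by blast
    qed
  qed
  show ?thesis
  proof (rule primeidealI)
    show "ideal Id ?R" unfolding id by (rule Id_ideal)
    show "cring ?R" by (rule R.cring_axioms)
    have "map_monomials f (1 :: 'k mpoly) = 1" using map_monomials_single[of f 0 "1 :: 'k"] f0 by simp
    then have "1 \<notin> Id" using ker' by auto
    moreover have "1 \<in> carrier ?R" by (simp add: poly_ring_carrier)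
    ultimately show "carrier ?R \<noteq> Id" by blast
    fix a b assume ab: "a \<in> carrier ?R" "b \<in> carrier ?R" "a \<otimes>\<^bsub>?R\<^esub> b \<in> Id"
    then have "map_monomials f (a * b) = 0" using ker' by auto
    then have "map_monomials f a * map_monomials f b = 0" by (simp only: map_monomials_mult[OF add])
    then have "map_monomials f a = 0 \<or> map_monomials f b = 0" by simp
    then show "a \<in> Id \<or> b \<in> Id" using ker ab by blast
  qed
qed

section \<open>Height functions\<close>

text \<open>A pair \<open>(x, y)\<close> stands for the cell with lower left corner \<open>(x, y)\<close>, and a multiset of
  points for a monomial; \<open>corner_swap\<close> applies one inner binomial to it.\<close>

definition dilated :: "int \<Rightarrow> int \<Rightarrow> (int \<times> int) set \<Rightarrow> (int \<times> int) set" where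
  "dilated m n P = {(x, y). (x div m, y div n) \<in> P}"

text \<open>With the coordinates allowed in either order, a swap covers both directions of an inner
  binomial. A degenerate rectangle is full as well and leads to a trivial swap.\<close>

definition full_rect :: "(int \<times> int) set \<Rightarrow> int \<Rightarrow> int \<Rightarrow> int \<Rightarrow> int \<Rightarrow> bool" where
  "full_rect Q x1 x2 y1 y2 \<longleftrightarrow>
     (\<forall>x y. min x1 x2 \<le> x \<and> x < max x1 x2 \<and> min y1 y2 \<le> y \<and> y < max y1 y2 \<longrightarrow> (x, y) \<in> Q)"

definition corner_swap :: "(int \<times> int) set \<Rightarrow> (int \<times> int) multiset \<Rightarrow> (int \<times> int) multiset \<Rightarrow> bool" where
  "corner_swap Q u w \<longleftrightarrow> (\<exists>x1 x2 y1 y2 r. full_rect Q x1 x2 y1 y2 \<and>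
     u = add_mset (x1, y1) (add_mset (x2, y2) r) \<and> w = add_mset (x1, y2) (add_mset (x2, y1) r))"

abbreviation swap_connected :: "(int \<times> int) set \<Rightarrow> (int \<times> int) multiset \<Rightarrow> (int \<times> int) multiset \<Rightarrow> bool" where
  "swap_connected Q \<equiv> (corner_swap Q)\<^sup>*\<^sup>*"

text \<open>\<open>c (x, y)\<close> is the excess of \<open>u\<close> over \<open>w\<close> in the quadrant of the points \<open>\<le> (x, y)\<close>.\<close>

definition is_height :: "(int \<times> int) set \<Rightarrow> (int \<times> int) multiset \<Rightarrow> (int \<times> int) multiset \<Rightarrow>
    (int \<times> int \<Rightarrow> int) \<Rightarrow> bool" where
  "is_height Q u w c \<longleftrightarrow> (\<forall>z. z \<notin> Q \<longrightarrow> c z = 0) \<and>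
     (\<forall>x y. int (count u (x, y)) - int (count w (x, y)) =
        c (x, y) - c (x - 1, y) - c (x, y - 1) + c (x - 1, y - 1))"

text \<open>The obstruction to connected fibres: two monomials with equal invariants that no swaps
  can bring to share a variable. If only the empty pair is of this kind, cancelling common variables
  connects every fibre.\<close>

definition disjoint_pair :: "(int \<times> int) set \<Rightarrow> (int \<times> int) multiset \<Rightarrow> (int \<times> int) multiset \<Rightarrow>
    (int \<times> int \<Rightarrow> int) \<Rightarrow> bool" where
  "disjoint_pair Q u w c \<longleftrightarrow> is_height Q u w c \<and>
     (\<forall>u' w'. swap_connected Q u u' \<longrightarrow> swap_connected Q w w' \<longrightarrow> set_mset u' \<inter> set_mset w' = {})"

lemma corner_swap_sym: "corner_swap Q u w \<Longrightarrow> corner_swap Q w u"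
  unfolding corner_swap_def full_rect_def
  apply (elim exE)
  subgoal for x1 x2 y1 y2 r
    by (rule exI[of _ x1], rule exI[of _ x2], rule exI[of _ y2], rule exI[of _ y1])
       (auto simp: min.commute max.commute)
  done

lemma swap_connected_sym: "swap_connected Q u w \<Longrightarrow> swap_connected Q w u"
  by (induction rule: rtranclp_induct) (auto intro: corner_swap_sym converse_rtranclp_into_rtranclp)

lemma corner_swap_add: "corner_swap Q u w \<Longrightarrow> corner_swap Q (add_mset z u) (add_mset z w)"
  unfolding corner_swap_def
  apply (elim exE)
  subgoal for x1 x2 y1 y2 r
    by (intro exI[of _ x1] exI[of _ x2] exI[of _ y1] exI[of _ y2] exI[of _ "add_mset z r"])
       (auto simp: add_mset_commute)
  done

lemma swap_connected_add: "swap_connected Q u w \<Longrightarrow> swap_connected Q (add_mset z u) (add_mset z w)"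
  by (induction rule: rtranclp_induct) (auto intro: corner_swap_add rtranclp.rtrancl_into_rtrancl)

lemma swap_connected_size: "swap_connected Q u w \<Longrightarrow> size u = size w"
  by (induction rule: rtranclp_induct) (auto simp: corner_swap_def)

text \<open>The height of a single swap is, up to sign, the indicator of its rectangle, a product of
  two functions of one coordinate each.\<close>

lemma corner_swap_is_height:
  assumes "corner_swap Q u u'"
  shows "\<exists>c. is_height Q u u' c"
proof -
  from assms obtain x1 x2 y1 y2 r where full_rect: "full_rect Q x1 x2 y1 y2"
    and u: "u = add_mset (x1, y1) (add_mset (x2, y2) r)"
    and u': "u' = add_mset (x1, y2) (add_mset (x2, y1) r)" unfolding corner_swap_def by blast
  define f where "f = (\<lambda>x. of_bool (x1 \<le> x) - of_bool (x2 \<le> x) :: int)"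
  define g where "g = (\<lambda>y. of_bool (y1 \<le> y) - of_bool (y2 \<le> y) :: int)"
  have df: "f x - f (x - 1) = of_bool (x = x1) - of_bool (x = x2)" for x unfolding f_def by auto
  have dg: "g y - g (y - 1) = of_bool (y = y1) - of_bool (y = y2)" for y unfolding g_def by auto
  have "is_height Q u u' (\<lambda>(x, y). f x * g y)" unfolding is_height_def
  proof (intro conjI allI impI)
    fix z assume z: "z \<notin> Q"
    obtain x y where xy: "z = (x, y)" by force
    have "\<not> (min x1 x2 \<le> x \<and> x < max x1 x2) \<or> \<not> (min y1 y2 \<le> y \<and> y < max y1 y2)"
      using z full_rect unfolding xy full_rect_def by blast
    then have "f x = 0 \<or> g y = 0" unfolding f_def g_def by auto
    then show "(case z of (x, y) \<Rightarrow> f x * g y) = 0" unfolding xy by auto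
  next
    fix x y
    have "int (count u (x, y)) - int (count u' (x, y)) = (f x - f (x - 1)) * (g y - g (y - 1))"
      unfolding u u' df dg by (simp add: of_bool_def)
    then show "int (count u (x, y)) - int (count u' (x, y)) =
        (case (x, y) of (x, y) \<Rightarrow> f x * g y) - (case (x - 1, y) of (x, y) \<Rightarrow> f x * g y) -
        (case (x, y - 1) of (x, y) \<Rightarrow> f x * g y) + (case (x - 1, y - 1) of (x, y) \<Rightarrow> f x * g y)"
      by (simp add: algebra_simps)
  qed
  then show ?thesis by blast
qed

lemma is_height_diff: "is_height Q u w c \<Longrightarrow> int (count u (x, y)) - int (count w (x, y)) =
        c (x, y) - c (x - 1, y) - c (x, y - 1) + c (x - 1, y - 1)"
  unfolding is_height_def by blast

lemma is_height_zero: "is_height Q u w c \<Longrightarrow> z \<notin> Q \<Longrightarrow> c z = 0"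
  unfolding is_height_def by blast

lemma is_heightI: "(\<And>z. z \<notin> Q \<Longrightarrow> c z = 0) \<Longrightarrow>
   (\<And>x y. int (count u (x, y)) - int (count w (x, y)) =
        c (x, y) - c (x - 1, y) - c (x, y - 1) + c (x - 1, y - 1)) \<Longrightarrow> is_height Q u w c"
  unfolding is_height_def by blast

lemma is_height_trans:
  assumes "is_height Q u v c" "is_height Q v w d"
  shows "is_height Q u w (\<lambda>z. c z + d z)"
proof (rule is_heightI)
  fix x y
  show "int (count u (x, y)) - int (count w (x, y)) = c (x, y) + d (x, y) - (c (x - 1, y) + d (x - 1, y)) -
       (c (x, y - 1) + d (x, y - 1)) + (c (x - 1, y - 1) + d (x - 1, y - 1))"
    using is_height_diff[OF assms(1), of x y] is_height_diff[OF assms(2), of x y] by linarith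
qed (simp add: is_height_zero[OF assms(1)] is_height_zero[OF assms(2)])

lemma is_height_swap:
  assumes "is_height Q u w c" shows "is_height Q w u (\<lambda>z. - c z)"
proof (rule is_heightI)
  fix x y
  show "int (count w (x, y)) - int (count u (x, y)) = - c (x, y) - - c (x - 1, y) -
       - c (x, y - 1) + - c (x - 1, y - 1)"
    using is_height_diff[OF assms(1), of x y] by linarith
qed (simp add: is_height_zero[OF assms])

lemma swap_connected_is_height: "swap_connected Q u w \<Longrightarrow> \<exists>c. is_height Q u w c"
proof (induction rule: rtranclp_induct)
  case base then show ?case by (auto simp: is_height_def intro!: exI[of _ "\<lambda>_. 0"])
next
  case (step y z) then show ?case by (meson is_height_trans corner_swap_is_height)
qed

lemma disjoint_pair_is_height: "disjoint_pair Q u w c \<Longrightarrow> is_height Q u w c"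
  unfolding disjoint_pair_def by (erule conjunct1)

lemma disjoint_pair_disj:
  assumes "disjoint_pair Q u w c" "swap_connected Q u u'" "swap_connected Q w w'" "z \<in># u'" "z \<in># w'"
  shows False
proof -
  have "set_mset u' \<inter> set_mset w' = {}"
    using assms(1) assms(2,3) unfolding disjoint_pair_def by simp
  then show False using assms(4,5) by (metis IntI empty_iff)
qed

lemma disjoint_pairI:
  assumes "is_height Q u w c" "\<And>u' w' z. swap_connected Q u u' \<Longrightarrow> swap_connected Q w w' \<Longrightarrow> z \<in># u' \<Longrightarrow> z \<in># w' \<Longrightarrow> False"
  shows "disjoint_pair Q u w c"
  unfolding disjoint_pair_def
proof (intro conjI allI impI)
  show "is_height Q u w c" by fact
  fix u' w' assume "swap_connected Q u u'" "swap_connected Q w w'"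
  then show "set_mset u' \<inter> set_mset w' = {}" using assms(2)[of u' w'] by (metis IntE equals0I)
qed

lemma disjoint_pair_swap: assumes "disjoint_pair Q u w c" shows "disjoint_pair Q w u (\<lambda>z. - c z)"
  by (rule disjoint_pairI[OF is_height_swap[OF disjoint_pair_is_height[OF assms]]]) (rule disjoint_pair_disj[OF assms])

lemma disjoint_pair_swap_connected:
  assumes "disjoint_pair Q u w c" "swap_connected Q u u'"
  shows "\<exists>c'. disjoint_pair Q u' w c'"
proof -
  obtain d where "is_height Q u' u d" using swap_connected_is_height[OF swap_connected_sym[OF assms(2)]] by (rule exE)
  then have "is_height Q u' w (\<lambda>z. d z + c z)" using disjoint_pair_is_height[OF assms(1)] by (rule is_height_trans)
  then have "disjoint_pair Q u' w (\<lambda>z. d z + c z)"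
    by (rule disjoint_pairI) (rule disjoint_pair_disj[OF assms(1) rtranclp_trans[OF assms(2)]])
  then show ?thesis by auto
qed

lemma is_height_0: assumes "is_height Q u w c" "\<And>z. c z = 0" shows "u = w"
proof (rule multiset_eqI)
  fix z show "count u z = count w z" using is_height_diff[OF assms(1), of "fst z" "snd z"] assms(2) by simp
qed

text \<open>Without height the two monomials coincide, and disjointness leaves only the empty
  one.\<close>

lemma disjoint_pair_0: assumes "disjoint_pair Q u w c" "\<And>z. c z = 0" shows "u = {#}"
proof -
  have "u = w" using is_height_0[OF disjoint_pair_is_height[OF assms(1)]] assms(2) by blast
  then show ?thesis using disjoint_pair_disj[OF assms(1) rtranclp.rtrancl_refl rtranclp.rtrancl_refl] by fastforce
qed

section \<open>Excess counts in rectangles and the collisions they force\<close>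

definition count_in :: "(int \<times> int) multiset \<Rightarrow> (int \<times> int) set \<Rightarrow> int" where
  "count_in u A = int (size (filter_mset (\<lambda>z. z \<in> A) u))"

lemma count_in_Un: "A \<inter> B = {} \<Longrightarrow> count_in u (A \<union> B) = count_in u A + count_in u B"
  unfolding count_in_def by (induction u) auto

lemma count_in_single: "count_in u {z} = int (count u z)"
  unfolding count_in_def by (induction u) auto

lemma count_in_empty [simp]: "count_in u {} = 0"
  unfolding count_in_def by simp

lemma count_in_pos_iff: "count_in u A > 0 \<longleftrightarrow> (\<exists>z\<in>A. z \<in># u)"
proof -
  have "count_in u A > 0 \<longleftrightarrow> filter_mset (\<lambda>z. z \<in> A) u \<noteq> {#}"
    unfolding count_in_def by (metis nonempty_has_size of_nat_0_less_iff)
  also have "\<dots> \<longleftrightarrow> set_mset (filter_mset (\<lambda>z. z \<in> A) u) \<noteq> {}" by (simp only: set_mset_eq_empty_iff)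
  also have "\<dots> \<longleftrightarrow> (\<exists>z\<in>A. z \<in># u)" by auto
  finally show ?thesis .
qed

lemma count_in_nonneg: "count_in u A \<ge> 0" unfolding count_in_def by simp

lemma count_in_row:
  assumes h: "is_height Q u w c" and "x1 - 1 \<le> x2"
  shows "count_in u ({x1..x2} \<times> {y}) - count_in w ({x1..x2} \<times> {y}) =
    c (x2, y) - c (x1 - 1, y) - c (x2, y - 1) + c (x1 - 1, y - 1)"
  using assms(2)
proof (induction x2 rule: int_ge_induct)
  case base then show ?case by simp
next
  case (step i)
  have e: "{x1..i+1} \<times> {y} = ({x1..i} \<times> {y}) \<union> {(i+1,y)}" using step by auto
  have d: "({x1..i} \<times> {y}) \<inter> {(i+1,y)} = {}" by auto
  show ?case unfolding e count_in_Un[OF d] count_in_single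
    using step.IH is_height_diff[OF h, of "i+1" y] by simp
qed

text \<open>The mixed difference in \<open>is_height\<close> telescopes over a rectangle. Cells are
  named by their lower left corner, so x1 - 1 and y1 - 1 refer to the cells just outside the left
  and lower edges; the bounds also admit empty rectangles.\<close>

lemma count_in_rect:
  assumes h: "is_height Q u w c" and "x1 - 1 \<le> x2" "y1 - 1 \<le> y2"
  shows "count_in u ({x1..x2} \<times> {y1..y2}) - count_in w ({x1..x2} \<times> {y1..y2}) =
    c (x2, y2) - c (x1 - 1, y2) - c (x2, y1 - 1) + c (x1 - 1, y1 - 1)"
  using assms(3)
proof (induction y2 rule: int_ge_induct)
  case base then show ?case by simp
next
  case (step i)
  have e: "{x1..x2} \<times> {y1..i+1} = ({x1..x2} \<times> {y1..i}) \<union> ({x1..x2} \<times> {i+1})" using step by auto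
  have d: "({x1..x2} \<times> {y1..i}) \<inter> ({x1..x2} \<times> {i+1}) = {}" by auto
  show ?case unfolding e count_in_Un[OF d] using step count_in_row[OF h assms(2), of "i+1"] by simp
qed

text \<open>A zero alternating sum means equal counts. This lemma and \<open>occ_gt\<close> are the
  means by which a point of one monomial yields a point of the other in all that follows.\<close>

lemma occ_eq:
  assumes "disjoint_pair Q u w c"
    and "c (x2, y2) - c (x1 - 1, y2) - c (x2, y1 - 1) + c (x1 - 1, y1 - 1) = 0"
    and "(x, y) \<in># u" "x1 \<le> x" "x \<le> x2" "y1 \<le> y" "y \<le> y2"
  shows "\<exists>x' y'. (x', y') \<in># w \<and> x1 \<le> x' \<and> x' \<le> x2 \<and> y1 \<le> y' \<and> y' \<le> y2"
proof -
  have "count_in u ({x1..x2} \<times> {y1..y2}) = count_in w ({x1..x2} \<times> {y1..y2})"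
    using count_in_rect[OF disjoint_pair_is_height[OF assms(1)], of x1 x2 y1 y2] assms(2-) by auto
  moreover have "count_in u ({x1..x2} \<times> {y1..y2}) > 0"
    unfolding count_in_pos_iff using assms(3-) by (intro bexI[of _ "(x,y)"]) auto
  ultimately show ?thesis using count_in_pos_iff[of w "{x1..x2} \<times> {y1..y2}"] by fastforce
qed

lemma occ_gt:
  assumes "disjoint_pair Q u w c" "x1 - 1 \<le> x2" "y1 - 1 \<le> y2"
    and "c (x2, y2) - c (x1 - 1, y2) - c (x2, y1 - 1) + c (x1 - 1, y1 - 1) > 0"
  shows "\<exists>x' y'. (x', y') \<in># u \<and> x1 \<le> x' \<and> x' \<le> x2 \<and> y1 \<le> y' \<and> y' \<le> y2"
proof -
  have "count_in u ({x1..x2} \<times> {y1..y2}) > count_in w ({x1..x2} \<times> {y1..y2})"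
    using count_in_rect[OF disjoint_pair_is_height[OF assms(1)], of x1 x2 y1 y2] assms(2-) by auto
  then have "count_in u ({x1..x2} \<times> {y1..y2}) > 0" using count_in_nonneg[of w] by (smt (verit))
  then show ?thesis using count_in_pos_iff[of u "{x1..x2} \<times> {y1..y2}"] by fastforce
qed

lemma full_rect_sub:
  assumes "full_rect Q X1 X2 Y1 Y2" "X1 \<le> X2" "Y1 \<le> Y2"
    "X1 \<le> x1" "x1 \<le> X2" "X1 \<le> x2" "x2 \<le> X2" "Y1 \<le> y1" "y1 \<le> Y2" "Y1 \<le> y2" "y2 \<le> Y2"
  shows "full_rect Q x1 x2 y1 y2"
  using assms unfolding full_rect_def by (auto simp: min_def max_def split: if_splits)

text \<open>The surviving points are recorded because the result is often swapped a second time. If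
  the two given points coincide, they already are the desired corner.\<close>

lemma swap_to_corner:
  assumes "(x, a) \<in># u" "(b, y) \<in># u" "full_rect Q x b a y"
  shows "\<exists>u'. swap_connected Q u u' \<and> (x, y) \<in># u' \<and> (\<forall>z. z \<in># u \<longrightarrow> z \<noteq> (x, a) \<longrightarrow> z \<noteq> (b, y) \<longrightarrow> z \<in># u')"
proof (cases "(x, a) = (b, y)")
  case True then show ?thesis using assms by auto
next
  case False
  then have "(b, y) \<in># u - {#(x, a)#}" using assms(2) by (metis insert_noteq_member insert_DiffM assms(1))
  then obtain r where u: "u = add_mset (x, a) (add_mset (b, y) r)"
    using assms by (metis insert_DiffM)
  then have "corner_swap Q u (add_mset (x, y) (add_mset (b, a) r))" unfolding corner_swap_def using assms by blast
  then show ?thesis using u by (intro exI[of _ "add_mset (x, y) (add_mset (b, a) r)"]) auto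
qed

text \<open>Both monomials meet column x and row y inside a full rectangle, so at most one swap on
  either side produces the common point (x, y).\<close>

lemma disjoint_pair_no_match:
  assumes "disjoint_pair Q u w c" "full_rect Q X1 X2 Y1 Y2" "X1 \<le> X2" "Y1 \<le> Y2"
    and "swap_connected Q u u'" "swap_connected Q w w'"
    and "(x, a) \<in># u'" "(b, y) \<in># u'" "(x, a') \<in># w'" "(b', y) \<in># w'"
    and "X1 \<le> x" "x \<le> X2" "X1 \<le> b" "b \<le> X2" "X1 \<le> b'" "b' \<le> X2"
    and "Y1 \<le> y" "y \<le> Y2" "Y1 \<le> a" "a \<le> Y2" "Y1 \<le> a'" "a' \<le> Y2"
  shows False
proof -
  have "full_rect Q x b a y" "full_rect Q x b' a' y" using assms by (auto intro: full_rect_sub)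
  from swap_to_corner[OF assms(7,8) this(1)] swap_to_corner[OF assms(9,10) this(2)]
  obtain u2 w2 where "swap_connected Q u' u2" "(x, y) \<in># u2" "swap_connected Q w' w2" "(x, y) \<in># w2"
    by (elim exE conjE)
  then show False using disjoint_pair_disj[OF assms(1) rtranclp_trans[OF assms(5)] rtranclp_trans[OF assms(6)]] by auto
qed

lemmas disjoint_pair_diff = is_height_diff[OF disjoint_pair_is_height]

section \<open>Symmetries\<close>

definition transposed :: "(int \<times> int) set \<Rightarrow> (int \<times> int) set" where
  "transposed P = {(x, y). (y, x) \<in> P}"

text \<open>The reflection that sends a vertex x to -x sends the tile with lower left abscissa x to
  the one at -1 - x.\<close>

definition reflected :: "(int \<times> int) set \<Rightarrow> (int \<times> int) set" where
  "reflected P = {(x, y). (-1 - x, y) \<in> P}"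

definition shifted :: "int \<Rightarrow> int \<Rightarrow> (int \<times> int) set \<Rightarrow> (int \<times> int) set" where
  "shifted a b P = {(x, y). (x + a, y + b) \<in> P}"

lemma transposed_iff [simp]: "(x, y) \<in> transposed P \<longleftrightarrow> (y, x) \<in> P" by (simp add: transposed_def)
lemma reflected_iff [simp]: "(x, y) \<in> reflected P \<longleftrightarrow> (-1 - x, y) \<in> P" by (simp add: reflected_def)
lemma shifted_iff [simp]: "(x, y) \<in> shifted a b P \<longleftrightarrow> (x + a, y + b) \<in> P" by (simp add: shifted_def)

lemma neg_div: "m > 0 \<Longrightarrow> (-1 - x) div m = -1 - x div (m::int)"
proof -
  assume m: "m > 0"
  have "-1 - x = (-1 - x div m) * m + (m - 1 - x mod m)"
    using div_mult_mod_eq[of x m] by (simp add: algebra_simps)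
  moreover have "0 \<le> m - 1 - x mod m" "m - 1 - x mod m < m"
    using pos_mod_bound[OF m, of x] pos_mod_sign[OF m, of x] by linarith+
  ultimately show ?thesis using int_div_pos_eq[of "-1 - x" m "-1 - x div m" "m - 1 - x mod m"]
    by (simp add: mult.commute)
qed

lemma dilated_transposed: "dilated n m (transposed P) = transposed (dilated m n P)" by (auto simp: dilated_def)
lemma dilated_reflected: "m > 0 \<Longrightarrow> dilated m n (reflected P) = reflected (dilated m n P)" by (auto simp: dilated_def neg_div)
lemma dilated_shifted: "m > 0 \<Longrightarrow> n > 0 \<Longrightarrow> dilated m n (shifted a b P) = shifted (a * m) (b * n) (dilated m n P)"
  by (auto simp: dilated_def add.commute)

lemma swap_connected_image:
  assumes "\<And>u w. corner_swap Q u w \<Longrightarrow> corner_swap Q' (image_mset f u) (image_mset f w)"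
  shows "swap_connected Q u w \<Longrightarrow> swap_connected Q' (image_mset f u) (image_mset f w)"
  by (induction rule: rtranclp_induct) (auto dest: assms)

lemma corner_swap_image:
  assumes "corner_swap Q u w" and "\<And>x y. f (x, y) = (g x, h y)"
    and "\<And>x1 x2 y1 y2. full_rect Q x1 x2 y1 y2 \<Longrightarrow> full_rect Q' (g x1) (g x2) (h y1) (h y2)"
  shows "corner_swap Q' (image_mset f u) (image_mset f w)"
proof -
  obtain x1 x2 y1 y2 r where "full_rect Q x1 x2 y1 y2" "u = add_mset (x1, y1) (add_mset (x2, y2) r)"
    "w = add_mset (x1, y2) (add_mset (x2, y1) r)" using assms(1) unfolding corner_swap_def by blast
  then show ?thesis unfolding corner_swap_def
    by (intro exI[of _ "g x1"] exI[of _ "g x2"] exI[of _ "h y1"] exI[of _ "h y2"]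
        exI[of _ "image_mset f r"]) (simp add: assms(2,3))
qed

lemma full_rect_transposed: "full_rect Q x1 x2 y1 y2 \<Longrightarrow> full_rect (transposed Q) y1 y2 x1 x2"
  unfolding full_rect_def transposed_iff by blast

lemma full_rect_reflected:
  assumes "full_rect Q x1 x2 y1 y2" shows "full_rect (reflected Q) (- x1) (- x2) y1 y2"
  unfolding full_rect_def reflected_iff
proof (intro allI impI)
  fix x y assume a: "min (- x1) (- x2) \<le> x \<and> x < max (- x1) (- x2) \<and> min y1 y2 \<le> y \<and> y < max y1 y2"
  then have "min x1 x2 \<le> -1 - x" "-1 - x < max x1 x2" by linarith+
  then show "(-1 - x, y) \<in> Q" using a assms unfolding full_rect_def by blast
qed

lemma full_rect_shifted:
  assumes "full_rect Q x1 x2 y1 y2" shows "full_rect (shifted a b Q) (x1 - a) (x2 - a) (y1 - b) (y2 - b)"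
  unfolding full_rect_def shifted_iff
proof (intro allI impI)
  fix x y assume "min (x1 - a) (x2 - a) \<le> x \<and> x < max (x1 - a) (x2 - a) \<and>
     min (y1 - b) (y2 - b) \<le> y \<and> y < max (y1 - b) (y2 - b)"
  then have "min x1 x2 \<le> x + a \<and> x + a < max x1 x2 \<and> min y1 y2 \<le> y + b \<and> y + b < max y1 y2"
    by linarith
  then show "(x + a, y + b) \<in> Q" using assms unfolding full_rect_def by blast
qed

lemma corner_swap_transposed: "corner_swap Q u w \<Longrightarrow> corner_swap (transposed Q) (image_mset prod.swap u) (image_mset prod.swap w)"
  unfolding corner_swap_def
  apply (elim exE)
  subgoal for x1 x2 y1 y2 r
    by (intro exI[of _ y1] exI[of _ y2] exI[of _ x1] exI[of _ x2] exI[of _ "image_mset prod.swap r"])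
       (simp add: full_rect_transposed add_mset_commute)
  done

lemma corner_swap_reflected: "corner_swap Q u w \<Longrightarrow> corner_swap (reflected Q) (image_mset (\<lambda>(x, y). (- x, y)) u) (image_mset (\<lambda>(x, y). (- x, y)) w)"
  by (erule corner_swap_image[where g = uminus and h = "\<lambda>y. y"]) (simp_all add: full_rect_reflected)

lemma corner_swap_shifted: "corner_swap Q u w \<Longrightarrow> corner_swap (shifted a b Q) (image_mset (\<lambda>(x, y). (x - a, y - b)) u) (image_mset (\<lambda>(x, y). (x - a, y - b)) w)"
  by (erule corner_swap_image[where g = "\<lambda>x. x - a" and h = "\<lambda>y. y - b"]) (simp_all add: full_rect_shifted)

text \<open>Swaps in the image are pulled back along the inverse g, so a common point there would
  give one here.\<close>

lemma disjoint_pair_image: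
  assumes "disjoint_pair Q u w c" and "is_height Q' (image_mset f u) (image_mset f w) c'"
    and "\<And>u w. corner_swap Q' u w \<Longrightarrow> corner_swap Q (image_mset g u) (image_mset g w)" and "\<And>z. g (f z) = z"
  shows "disjoint_pair Q' (image_mset f u) (image_mset f w) c'"
proof (rule disjoint_pairI[OF assms(2)])
  fix u' w' z assume e: "swap_connected Q' (image_mset f u) u'" "swap_connected Q' (image_mset f w) w'" "z \<in># u'" "z \<in># w'"
  have "swap_connected Q u (image_mset g u')" "swap_connected Q w (image_mset g w')"
    using swap_connected_image[of Q' Q g, OF assms(3)] e(1,2) by (force simp: multiset.map_comp comp_def assms(4))+
  moreover have "g z \<in># image_mset g u'" "g z \<in># image_mset g w'" using e(3,4) by auto
  ultimately show False by (rule disjoint_pair_disj[OF assms(1)])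
qed

lemma count_image_inv:
  assumes "\<And>z. g (f z) = z" "\<And>z. f (g z) = z"
  shows "count (image_mset f u) z = count u (g z)"
proof (induction u)
  case (add x u)
  have "f x = z \<longleftrightarrow> x = g z" using assms by metis
  then show ?case using add by auto
qed simp

lemma disjoint_pair_transposed:
  assumes "disjoint_pair Q u w c"
  shows "disjoint_pair (transposed Q) (image_mset prod.swap u) (image_mset prod.swap w) (c \<circ> prod.swap)"
proof (rule disjoint_pair_image[OF assms, where g = prod.swap])
  show "is_height (transposed Q) (image_mset prod.swap u) (image_mset prod.swap w) (c \<circ> prod.swap)"
    using disjoint_pair_is_height[OF assms] unfolding is_height_def
    by (auto simp: count_image_inv[of prod.swap prod.swap])
  fix u w assume "corner_swap (transposed Q) u w"
  moreover have "transposed (transposed Q) = Q" by auto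
  ultimately show "corner_swap Q (image_mset prod.swap u) (image_mset prod.swap w)" using corner_swap_transposed by metis
qed (auto simp: prod_eq_iff)

text \<open>A difference in the x direction changes sign under the reflection; this accounts for the
  minus in front of c.\<close>

lemma disjoint_pair_reflected:
  assumes "disjoint_pair Q u w c"
  shows "disjoint_pair (reflected Q) (image_mset (\<lambda>(x, y). (- x, y)) u) (image_mset (\<lambda>(x, y). (- x, y)) w)
     (\<lambda>(x, y). - c (-1 - x, y))"
proof (rule disjoint_pair_image[OF assms, where g = "\<lambda>(x, y). (- x, y)"])
  show "is_height (reflected Q) (image_mset (\<lambda>(x, y). (- x, y)) u) (image_mset (\<lambda>(x, y). (- x, y)) w)
     (\<lambda>(x, y). - c (-1 - x, y))"
    using disjoint_pair_is_height[OF assms] unfolding is_height_def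
    apply auto
    subgoal premises p for x y using p(2)[rule_format, of "-x" y]
      count_image_inv[of "\<lambda>(x, y). (- x, y)" "\<lambda>(x, y). (- x, y)" _ "(x, y)"]
      by (simp add: algebra_simps split_beta minus_diff_commute)
    done
  fix u w assume "corner_swap (reflected Q) u w"
  moreover have "reflected (reflected Q) = Q" by auto
  ultimately show "corner_swap Q (image_mset (\<lambda>(x, y). (- x, y)) u) (image_mset (\<lambda>(x, y). (- x, y)) w)" using corner_swap_reflected by metis
qed (auto simp: prod_eq_iff)

lemma disjoint_pair_shifted:
  assumes "disjoint_pair Q u w c"
  shows "disjoint_pair (shifted a b Q) (image_mset (\<lambda>(x, y). (x - a, y - b)) u) (image_mset (\<lambda>(x, y). (x - a, y - b)) w)
     (\<lambda>(x, y). c (x + a, y + b))"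
proof (rule disjoint_pair_image[OF assms, where g = "\<lambda>(x, y). (x + a, y + b)"])
  show "is_height (shifted a b Q) (image_mset (\<lambda>(x, y). (x - a, y - b)) u) (image_mset (\<lambda>(x, y). (x - a, y - b)) w)
     (\<lambda>(x, y). c (x + a, y + b))"
    using disjoint_pair_is_height[OF assms] unfolding is_height_def
    apply auto
    subgoal premises p for x y using p(2)[rule_format, of "x+a" "y+b"]
      count_image_inv[of "\<lambda>(x, y). (x + a, y + b)" "\<lambda>(x, y). (x - a, y - b)" _ "(x, y)"]
      by (simp add: algebra_simps split_beta)
    done
  fix u w assume "corner_swap (shifted a b Q) u w"
  moreover have "shifted (-a) (-b) (shifted a b Q) = Q" by auto
  ultimately show "corner_swap Q (image_mset (\<lambda>(x, y). (x + a, y + b)) u) (image_mset (\<lambda>(x, y). (x + a, y + b)) w)"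
    using corner_swap_shifted[of "shifted a b Q" u w "-a" "-b"] by simp
qed (auto simp: prod_eq_iff)

section \<open>Corners of the path\<close>

definition adjacent :: "int \<times> int \<Rightarrow> int \<times> int \<Rightarrow> bool" where
  "adjacent z z' \<longleftrightarrow> \<bar>fst z - fst z'\<bar> + \<bar>snd z - snd z'\<bar> = 1"

definition near :: "int \<times> int \<Rightarrow> int \<times> int \<Rightarrow> bool" where
  "near z z' \<longleftrightarrow> \<bar>fst z - fst z'\<bar> \<le> 1 \<and> \<bar>snd z - snd z'\<bar> \<le> 1"

lemma adjacent_cases:
  assumes "adjacent (x, y) z"
  shows "z = (x + 1, y) \<or> z = (x - 1, y) \<or> z = (x, y + 1) \<or> z = (x, y - 1)"
proof -
  obtain a b where z: "z = (a, b)" by force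
  have "\<bar>x - a\<bar> + \<bar>y - b\<bar> = 1" using assms unfolding adjacent_def z by simp
  then have "a = x + 1 \<and> b = y \<or> a = x - 1 \<and> b = y \<or> a = x \<and> b = y + 1 \<or> a = x \<and> b = y - 1"
    by (cases "x = a"; cases "y = b") (auto simp: abs_if split: if_splits)
  then show ?thesis unfolding z by auto
qed

text \<open>The local traces of a closed path that the height arguments use: a tile has at most two
  neighbours, and tiles touch diagonally only around a turn. The order of the path is forgotten, so
  reversal and all symmetries preserve the notion.\<close>

definition path_like :: "(int \<times> int) set \<Rightarrow> bool" where
  "path_like P \<longleftrightarrow> finite P \<and>
    (\<forall>z\<in>P. \<forall>z1\<in>P. \<forall>z2\<in>P. \<forall>z3\<in>P. adjacent z z1 \<and> adjacent z z2 \<and> adjacent z z3 \<longrightarrow> z1 = z2 \<or> z1 = z3 \<or> z2 = z3) \<and>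
    (\<forall>z\<in>P. \<forall>z'\<in>P. near z z' \<and> z \<noteq> z' \<and> \<not> adjacent z z' \<longrightarrow> (\<exists>w\<in>P. adjacent z w \<and> adjacent w z'))"

lemma path_like_common:
  "path_like P \<Longrightarrow> z \<in> P \<Longrightarrow> z' \<in> P \<Longrightarrow> near z z' \<and> z \<noteq> z' \<and> \<not> adjacent z z' \<Longrightarrow> \<exists>w\<in>P. adjacent z w \<and> adjacent w z'"
  unfolding path_like_def by simp

lemma path_like_three:
  "path_like P \<Longrightarrow> z \<in> P \<Longrightarrow> z1 \<in> P \<Longrightarrow> z2 \<in> P \<Longrightarrow> z3 \<in> P \<Longrightarrow> adjacent z z1 \<and> adjacent z z2 \<and> adjacent z z3 \<Longrightarrow>
    z1 = z2 \<or> z1 = z3 \<or> z2 = z3"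
  unfolding path_like_def by simp

lemma path_like_nbrs:
  assumes "path_like P" "(a, b) \<in> P"
  shows "(a - 1, b) \<in> P \<Longrightarrow> (a + 1, b) \<in> P \<Longrightarrow> (a, b + 1) \<notin> P"
    and "(a - 1, b) \<in> P \<Longrightarrow> (a + 1, b) \<in> P \<Longrightarrow> (a, b - 1) \<notin> P"
    and "(a - 1, b) \<in> P \<Longrightarrow> (a, b - 1) \<in> P \<Longrightarrow> (a, b + 1) \<notin> P"
    and "(a - 1, b) \<in> P \<Longrightarrow> (a, b - 1) \<in> P \<Longrightarrow> (a + 1, b) \<notin> P"
    and "(a + 1, b) \<in> P \<Longrightarrow> (a, b - 1) \<in> P \<Longrightarrow> (a, b + 1) \<notin> P"
    and "(a + 1, b) \<in> P \<Longrightarrow> (a, b - 1) \<in> P \<Longrightarrow> (a - 1, b) \<notin> P"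
    and "(a - 1, b) \<in> P \<Longrightarrow> (a, b + 1) \<in> P \<Longrightarrow> (a + 1, b) \<notin> P"
    and "(a - 1, b) \<in> P \<Longrightarrow> (a, b + 1) \<in> P \<Longrightarrow> (a, b - 1) \<notin> P"
    and "(a + 1, b) \<in> P \<Longrightarrow> (a, b + 1) \<in> P \<Longrightarrow> (a - 1, b) \<notin> P"
    and "(a + 1, b) \<in> P \<Longrightarrow> (a, b + 1) \<in> P \<Longrightarrow> (a, b - 1) \<notin> P"
    and "(a, b - 1) \<in> P \<Longrightarrow> (a, b + 1) \<in> P \<Longrightarrow> (a - 1, b) \<notin> P"
    and "(a, b - 1) \<in> P \<Longrightarrow> (a, b + 1) \<in> P \<Longrightarrow> (a + 1, b) \<notin> P"
proof -
  have three: "z1 \<in> P \<Longrightarrow> z2 \<in> P \<Longrightarrow> z3 \<in> P \<Longrightarrow> adjacent (a, b) z1 \<Longrightarrow> adjacent (a, b) z2 \<Longrightarrow> adjacent (a, b) z3 \<Longrightarrow>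
    z1 \<noteq> z2 \<Longrightarrow> z1 \<noteq> z3 \<Longrightarrow> z2 \<noteq> z3 \<Longrightarrow> False" for z1 z2 z3
    using path_like_three[OF assms, of z1 z2 z3] by simp
  have "\<not> ((a - 1, b) \<in> P \<and> (a + 1, b) \<in> P \<and> (a, b + 1) \<in> P)"
       "\<not> ((a - 1, b) \<in> P \<and> (a + 1, b) \<in> P \<and> (a, b - 1) \<in> P)"
       "\<not> ((a - 1, b) \<in> P \<and> (a, b - 1) \<in> P \<and> (a, b + 1) \<in> P)"
       "\<not> ((a + 1, b) \<in> P \<and> (a, b - 1) \<in> P \<and> (a, b + 1) \<in> P)"
    by (intro notI, elim conjE, rule three, assumption+; simp add: adjacent_def)+
  then show "(a - 1, b) \<in> P \<Longrightarrow> (a + 1, b) \<in> P \<Longrightarrow> (a, b + 1) \<notin> P"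
    and "(a - 1, b) \<in> P \<Longrightarrow> (a + 1, b) \<in> P \<Longrightarrow> (a, b - 1) \<notin> P"
    and "(a - 1, b) \<in> P \<Longrightarrow> (a, b - 1) \<in> P \<Longrightarrow> (a, b + 1) \<notin> P"
    and "(a - 1, b) \<in> P \<Longrightarrow> (a, b - 1) \<in> P \<Longrightarrow> (a + 1, b) \<notin> P"
    and "(a + 1, b) \<in> P \<Longrightarrow> (a, b - 1) \<in> P \<Longrightarrow> (a, b + 1) \<notin> P"
    and "(a + 1, b) \<in> P \<Longrightarrow> (a, b - 1) \<in> P \<Longrightarrow> (a - 1, b) \<notin> P"
    and "(a - 1, b) \<in> P \<Longrightarrow> (a, b + 1) \<in> P \<Longrightarrow> (a + 1, b) \<notin> P"
    and "(a - 1, b) \<in> P \<Longrightarrow> (a, b + 1) \<in> P \<Longrightarrow> (a, b - 1) \<notin> P"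
    and "(a + 1, b) \<in> P \<Longrightarrow> (a, b + 1) \<in> P \<Longrightarrow> (a - 1, b) \<notin> P"
    and "(a + 1, b) \<in> P \<Longrightarrow> (a, b + 1) \<in> P \<Longrightarrow> (a, b - 1) \<notin> P"
    and "(a, b - 1) \<in> P \<Longrightarrow> (a, b + 1) \<in> P \<Longrightarrow> (a - 1, b) \<notin> P"
    and "(a, b - 1) \<in> P \<Longrightarrow> (a, b + 1) \<in> P \<Longrightarrow> (a + 1, b) \<notin> P"
    by blast+
qed

text \<open>Two tiles that meet in a single vertex have a common neighbour on the path, and there
  are only two candidates for it.\<close>

lemma path_like_diag:
  assumes "path_like P" "(a, b) \<in> P"
  shows "(a + 1, b) \<notin> P \<Longrightarrow> (a, b + 1) \<notin> P \<Longrightarrow> (a + 1, b + 1) \<notin> P"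
    and "(a - 1, b) \<notin> P \<Longrightarrow> (a, b - 1) \<notin> P \<Longrightarrow> (a - 1, b - 1) \<notin> P"
    and "(a + 1, b) \<notin> P \<Longrightarrow> (a, b - 1) \<notin> P \<Longrightarrow> (a + 1, b - 1) \<notin> P"
    and "(a - 1, b) \<notin> P \<Longrightarrow> (a, b + 1) \<notin> P \<Longrightarrow> (a - 1, b + 1) \<notin> P"
proof -
  have diag: "(a + s, b) \<in> P \<or> (a, b + t) \<in> P"
    if st: "s = 1 \<or> s = -1" "t = 1 \<or> t = -1" and z: "(a + s, b + t) \<in> P" for s t
  proof -
    have "near (a, b) (a + s, b + t) \<and> (a, b) \<noteq> (a + s, b + t) \<and> \<not> adjacent (a, b) (a + s, b + t)"
      using st unfolding near_def adjacent_def by auto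
    then have "\<exists>w\<in>P. adjacent (a, b) w \<and> adjacent w (a + s, b + t)" by (rule path_like_common[OF assms z])
    then obtain w where w: "w \<in> P" "adjacent (a, b) w" "adjacent w (a + s, b + t)" by blast
    then have "w = (a + s, b) \<or> w = (a, b + t)"
      using adjacent_cases[OF w(2)] st unfolding adjacent_def by auto
    then show ?thesis using w(1) by auto
  qed
  show "(a + 1, b) \<notin> P \<Longrightarrow> (a, b + 1) \<notin> P \<Longrightarrow> (a + 1, b + 1) \<notin> P"
    "(a - 1, b) \<notin> P \<Longrightarrow> (a, b - 1) \<notin> P \<Longrightarrow> (a - 1, b - 1) \<notin> P"
    "(a + 1, b) \<notin> P \<Longrightarrow> (a, b - 1) \<notin> P \<Longrightarrow> (a + 1, b - 1) \<notin> P"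
    "(a - 1, b) \<notin> P \<Longrightarrow> (a, b + 1) \<notin> P \<Longrightarrow> (a - 1, b + 1) \<notin> P"
    using diag[of 1 1] diag[of "-1" "-1"] diag[of 1 "-1"] diag[of "-1" 1] by auto
qed

lemma path_like_image:
  assumes g: "path_like P" and f: "\<And>z z'. adjacent (f z) (f z') \<longleftrightarrow> adjacent z z'" "\<And>z z'. near (f z) (f z') \<longleftrightarrow> near z z'"
  shows "path_like (f ` P)"
  unfolding path_like_def
proof (intro conjI ballI impI)
  show "finite (f ` P)" using g unfolding path_like_def by simp
  show "z1 = z2 \<or> z1 = z3 \<or> z2 = z3" if z: "z \<in> f ` P" "z1 \<in> f ` P" "z2 \<in> f ` P" "z3 \<in> f ` P"
    "adjacent z z1 \<and> adjacent z z2 \<and> adjacent z z3" for z z1 z2 z3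
  proof -
    obtain y y1 y2 y3 where y: "z = f y" "z1 = f y1" "z2 = f y2" "z3 = f y3" "y \<in> P" "y1 \<in> P" "y2 \<in> P" "y3 \<in> P"
      using z(1-4) by blast
    have "y1 = y2 \<or> y1 = y3 \<or> y2 = y3"
      by (rule path_like_three[OF g y(5-8)]) (use z(5) in \<open>simp add: y(1-4) f\<close>)
    then show ?thesis using y by blast
  qed
  show "\<exists>w\<in>f ` P. adjacent z w \<and> adjacent w z'" if z: "z \<in> f ` P" "z' \<in> f ` P" "near z z' \<and> z \<noteq> z' \<and> \<not> adjacent z z'" for z z'
  proof -
    obtain y y' where y: "z = f y" "z' = f y'" "y \<in> P" "y' \<in> P" using z(1,2) by blast
    have "\<exists>w\<in>P. adjacent y w \<and> adjacent w y'"
      by (rule path_like_common[OF g y(3,4)]) (use z(3) in \<open>auto simp: y(1,2) f\<close>)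
    then show ?thesis unfolding y(1,2) using f(1) by auto
  qed
qed

lemma transposed_image: "transposed P = prod.swap ` P" by (force simp: transposed_def image_iff)
lemma reflected_image: "reflected P = (\<lambda>(x, y). (-1 - x, y)) ` P" by (force simp: reflected_def image_iff)
lemma shifted_image: "shifted a b P = (\<lambda>(x, y). (x - a, y - b)) ` P" by (force simp: shifted_def image_iff)

lemma path_like_transposed: "path_like P \<Longrightarrow> path_like (transposed P)"
  unfolding transposed_image by (rule path_like_image) (auto simp: adjacent_def near_def)

lemma path_like_reflected: "path_like P \<Longrightarrow> path_like (reflected P)"
  unfolding reflected_image by (rule path_like_image) (auto simp: adjacent_def near_def)

lemma path_like_shifted: "path_like P \<Longrightarrow> path_like (shifted s t P)"
  unfolding shifted_image by (rule path_like_image) (auto simp: adjacent_def near_def)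

section \<open>Straight blocks and the heights beside their ends\<close>

lemma end_right:
  assumes g: "path_like P" and "(a, b) \<in> P" "(a + 1, b) \<in> P"
  shows "\<exists>e\<ge>a + 1. (\<forall>i. a \<le> i \<longrightarrow> i \<le> e \<longrightarrow> (i, b) \<in> P) \<and> (e + 1, b) \<notin> P \<and>
     ((e + 1, b + 1) \<notin> P \<or> (e + 1, b - 1) \<notin> P)"
proof -
  define S where "S = {e. a + 1 \<le> e \<and> (\<forall>i. a \<le> i \<longrightarrow> i \<le> e \<longrightarrow> (i, b) \<in> P)}"
  have "S \<subseteq> fst ` P"
  proof
    fix e assume "e \<in> S"
    then have "(e, b) \<in> P" unfolding S_def by auto
    then show "e \<in> fst ` P" by (force intro: image_eqI)
  qed
  then have fin: "finite S" by (rule finite_subset) (use g in \<open>simp add: path_like_def\<close>)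
  have "i = a \<or> i = a + 1" if "a \<le> i" "i \<le> a + 1" for i using that by linarith
  then have "a + 1 \<in> S" unfolding S_def using assms(2,3) by auto
  then have M: "Max S \<in> S" using fin Max_in by blast
  define e where "e = Max S"
  have "e \<in> S" using M e_def by simp
  then have e: "a + 1 \<le> e" "\<And>i. a \<le> i \<Longrightarrow> i \<le> e \<Longrightarrow> (i, b) \<in> P" unfolding S_def by simp_all
  have ne: "(e + 1, b) \<notin> P"
  proof
    assume "(e + 1, b) \<in> P"
    have "(i, b) \<in> P" if "a \<le> i" "i \<le> e + 1" for i
      using e(2)[of i] that \<open>(e + 1, b) \<in> P\<close> by (cases "i = e + 1") auto
    then have "e + 1 \<in> S" unfolding S_def using e(1) by simp
    then show False using Max_ge[OF fin, of "e + 1"] unfolding e_def by linarith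
  qed
  have "(e, b) \<in> P" "(e - 1, b) \<in> P" using e by auto
  \<comment> \<open>The tile e has its left neighbour on the path, so the path leaves it on at most
    one side, and a diagonal tile beyond e requires the neighbour of e on that side.\<close>
  then have "(e + 1, b + 1) \<notin> P \<or> (e + 1, b - 1) \<notin> P"
    using path_like_nbrs[OF g, of e b] path_like_diag[OF g, of e b] ne by blast
  then show ?thesis using e ne by blast
qed

lemma div_ge: "0 < m \<Longrightarrow> f * m \<le> x \<Longrightarrow> f \<le> x div (m::int)"
  by (metis less_le nonzero_mult_div_cancel_right zdiv_mono1)

lemma div_le:
  assumes "0 < m" "x < e * m + m" shows "x div (m::int) \<le> e"
proof -
  have "0 \<le> x mod m" using assms(1) by simp
  then have "x div m * m \<le> x" using div_mult_mod_eq[of x m] by linarith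
  then have "x div m * m < (e + 1) * m" using assms(2) by (simp add: distrib_right)
  then show ?thesis using assms(1) by (simp add: mult_less_cancel_right)
qed

lemma full_rect_row:
  assumes "\<And>i. f \<le> i \<Longrightarrow> i \<le> e \<Longrightarrow> (i, j) \<in> P" "m > 0" "n > 0" "f \<le> e"
  shows "full_rect (dilated m n P) (f * m) (e * m + m) (j * n) (j * n + n)"
proof -
  have fe: "f * m \<le> e * m" using assms by simp
  show ?thesis unfolding full_rect_def dilated_def
  proof (intro allI impI)
    fix x y assume "min (f * m) (e * m + m) \<le> x \<and> x < max (f * m) (e * m + m) \<and>
      min (j * n) (j * n + n) \<le> y \<and> y < max (j * n) (j * n + n)"
    then have x: "f * m \<le> x" "x < e * m + m" and y: "j * n \<le> y" "y < j * n + n"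
      using fe assms(2,3) by linarith+
    have "f \<le> x div m" "x div m \<le> e" "j \<le> y div n" "y div n \<le> j"
      using x y assms(2,3) by (simp_all add: div_ge div_le)
    then have "(x div m, y div n) \<in> P" using assms(1)[of "x div m"] by (metis order_antisym)
    then show "(x, y) \<in> {(x, y). (x div m, y div n) \<in> P}" by simp
  qed
qed

lemma disjoint_pair_zero:
  assumes "disjoint_pair (dilated m n P) u w c" "(i, j) \<notin> P" "i * m \<le> X" "X < i * m + m" "j * n \<le> Y" "Y < j * n + n"
  shows "c (X, Y) = 0"
proof -
  have m: "m > 0" "n > 0" using assms(3-) by linarith+
  have "i \<le> X div m" "X div m \<le> i" "j \<le> Y div n" "Y div n \<le> j"
    using assms(3-) m by (simp_all add: div_ge div_le)
  then have "X div m = i" "Y div n = j" by auto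
  then have "(X, Y) \<notin> dilated m n P" using assms(2) by (simp add: dilated_def)
  then show ?thesis using is_height_zero[OF disjoint_pair_is_height[OF assms(1)]] by blast
qed

text \<open>B is the last column of vertices of the block and the first column of cells beyond it.
  There c vanishes along the side of the block and also one step further on a side where the
  diagonal tile is missing. Only the boundary row of vertices on the other side can fail, so y0 is j
  * n or j * n + n.\<close>

lemma right_end_column:
  assumes g: "path_like P" and "m > 0" "n > 0" and b: "disjoint_pair (dilated m n P) u w c"
    and "(i, j) \<in> P" "(i + 1, j) \<in> P"
  shows "\<exists>B y0. i * m + 2 * m \<le> B \<and> full_rect (dilated m n P) (i * m) B (j * n) (j * n + n) \<and>
     (\<forall>y. j * n \<le> y \<longrightarrow> y \<le> j * n + n \<longrightarrow> y \<noteq> y0 \<longrightarrow> c (B, y) = c (B, y - 1))"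
proof -
  obtain e where e: "e \<ge> i + 1" "\<And>k. i \<le> k \<Longrightarrow> k \<le> e \<Longrightarrow> (k, j) \<in> P" "(e + 1, j) \<notin> P"
    "(e + 1, j + 1) \<notin> P \<or> (e + 1, j - 1) \<notin> P" using end_right[OF g assms(5,6)] by blast
  let ?B = "e * m + m"
  have f: "full_rect (dilated m n P) (i * m) ?B (j * n) (j * n + n)" by (rule full_rect_row) (use e assms in auto)
  have le: "i * m + 2 * m \<le> ?B"
  proof -
    have "(i + 1) * m \<le> e * m" using e(1) assms(2) by simp
    then show ?thesis by (simp add: algebra_simps)
  qed
  have z: "c (?B, y) = 0" if "j * n \<le> y" "y < j * n + n" for y
    by (rule disjoint_pair_zero[OF b e(3)]) (use that assms(2) in \<open>auto simp: algebra_simps\<close>)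
  from e(4) show ?thesis
  proof
    assume "(e + 1, j + 1) \<notin> P"
    then have "c (?B, j * n + n) = 0"
      by (rule disjoint_pair_zero[OF b]) (use assms(2,3) in \<open>auto simp: algebra_simps\<close>)
    then have "c (?B, y) = c (?B, y - 1)" if "j * n \<le> y" "y \<le> j * n + n" "y \<noteq> j * n" for y
      using z[of y] z[of "y - 1"] that by (cases "y = j * n + n") auto
    then show ?thesis using f le by blast
  next
    assume "(e + 1, j - 1) \<notin> P"
    then have "c (?B, j * n - 1) = 0"
      by (rule disjoint_pair_zero[OF b]) (use assms(2,3) in \<open>auto simp: algebra_simps\<close>)
    then have "c (?B, y) = c (?B, y - 1)" if "j * n \<le> y" "y \<le> j * n + n" "y \<noteq> j * n + n" for y
      using z[of y] z[of "y - 1"] that by (cases "y = j * n") auto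
    then show ?thesis using f le by blast
  qed
qed

lemma left_end_column:
  assumes g: "path_like P" and m: "m > 0" "n > 0" and b: "disjoint_pair (dilated m n P) u w c"
    and "(0, 0) \<in> P" "(-1, 0) \<in> P"
  shows "\<exists>B y0. B \<le> - m \<and> full_rect (dilated m n P) B m 0 n \<and>
     (\<forall>y. 0 \<le> y \<longrightarrow> y \<le> n \<longrightarrow> y \<noteq> y0 \<longrightarrow> c (B - 1, y) = c (B - 1, y - 1))"
proof -
  have b': "disjoint_pair (dilated m n (reflected P)) (image_mset (\<lambda>(x, y). (- x, y)) u) (image_mset (\<lambda>(x, y). (- x, y)) w)
     (\<lambda>(x, y). - c (-1 - x, y))" using disjoint_pair_reflected[OF b] dilated_reflected[OF m(1)] by simp
  obtain B y0 where B: "- m + 2 * m \<le> B" "full_rect (dilated m n (reflected P)) (-m) B 0 n"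
     "\<And>y. 0 \<le> y \<Longrightarrow> y \<le> n \<Longrightarrow> y \<noteq> y0 \<Longrightarrow> - c (-1 - B, y) = - c (-1 - B, y - 1)"
    using right_end_column[OF path_like_reflected[OF g] m b', of "-1" 0] assms(5,6) by auto
  have "full_rect (reflected (dilated m n (reflected P))) m (- B) 0 n" using full_rect_reflected[OF B(2)] by simp
  moreover have "reflected (dilated m n (reflected P)) = dilated m n P" unfolding dilated_reflected[OF m(1)] by auto
  ultimately have "full_rect (dilated m n P) (- B) m 0 n" by (simp add: full_rect_def min.commute max.commute)
  then show ?thesis using B by (intro exI[of _ "-B"] exI[of _ y0]) (auto simp: minus_diff_commute)
qed

lemma upper_end_row:
  assumes g: "path_like P" and m: "m > 0" "n > 0" and b: "disjoint_pair (dilated m n P) u w c"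
    and "(0, 0) \<in> P" "(0, 1) \<in> P"
  shows "\<exists>B x0. 2 * n \<le> B \<and> full_rect (dilated m n P) 0 m 0 B \<and>
     (\<forall>x. 0 \<le> x \<longrightarrow> x \<le> m \<longrightarrow> x \<noteq> x0 \<longrightarrow> c (x, B) = c (x - 1, B))"
proof -
  have b': "disjoint_pair (dilated n m (transposed P)) (image_mset prod.swap u) (image_mset prod.swap w) (c \<circ> prod.swap)"
    using disjoint_pair_transposed[OF b] dilated_transposed by simp
  obtain B x0 where B: "2 * n \<le> B" "full_rect (dilated n m (transposed P)) 0 B 0 m"
     "\<And>x. 0 \<le> x \<Longrightarrow> x \<le> m \<Longrightarrow> x \<noteq> x0 \<Longrightarrow> c (x, B) = c (x - 1, B)"
    using right_end_column[OF path_like_transposed[OF g] m(2,1) b', of 0 0] assms(5,6) by auto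
  have "full_rect (transposed (dilated n m (transposed P))) 0 m 0 B" using full_rect_transposed[OF B(2)] by simp
  moreover have "transposed (dilated n m (transposed P)) = dilated m n P" unfolding dilated_transposed by auto
  ultimately show ?thesis using B by metis
qed

text \<open>Once column x - 1 vanishes, column x is balanced, so a point (x, y) of one monomial has
  a partner (x, y') of the other with y and y' different. At most one of the two rows is
  exceptional; the other is balanced up to the end of the block, so both monomials meet it, and a
  swap in the full row of tiles makes a common point. Hence column x carries no points and c is
  constant along it.\<close>

lemma sweep_right:
  assumes g: "path_like P" and m: "m > 0" "n > 0" and b: "disjoint_pair (dilated m n P) u w c"
    and P: "(0, 0) \<in> P" "(1, 0) \<in> P"
    and touch: "\<And>X Y. -1 \<le> X \<Longrightarrow> X < m \<Longrightarrow> -1 \<le> Y \<Longrightarrow> Y \<le> n \<Longrightarrow>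
       \<not> (0 \<le> X \<and> 0 \<le> Y \<and> Y < n) \<Longrightarrow> c (X, Y) = 0"
    and X: "-1 \<le> X" "X < m"
  shows "\<forall>Y. -1 \<le> Y \<longrightarrow> Y \<le> n \<longrightarrow> c (X, Y) = 0"
  using X
proof (induction X rule: int_ge_induct)
  case base then show ?case using touch m by auto
next
  case (step x')
  define x where "x = x' + 1"
  have x: "0 \<le> x" "x < m" using step x_def by auto
  have prev: "c (x - 1, y) = 0" if "-1 \<le> y" "y \<le> n" for y using step that x_def by auto
  obtain B y0 where B: "2 * m \<le> B" and full_rect: "full_rect (dilated m n P) 0 B 0 n" and
     y0: "\<And>y. 0 \<le> y \<Longrightarrow> y \<le> n \<Longrightarrow> y \<noteq> y0 \<Longrightarrow> c (B, y) = c (B, y - 1)"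
    using right_end_column[OF g m b, of 0 0] P by auto
  have bot: "c (x, -1) = 0" "c (x, n) = 0" using touch x m by auto
  \<comment> \<open>Formulated for arbitrary u, w, c, so that the exchanged pair with the negated
    height can be inserted to treat the points of w.\<close>
  have no: False if bd: "disjoint_pair (dilated m n P) u w c" and
      bot: "c (x, -1) = 0" "c (x, n) = 0" and prev: "\<And>y. -1 \<le> y \<Longrightarrow> y \<le> n \<Longrightarrow> c (x - 1, y) = 0"
      and y0: "\<And>y. 0 \<le> y \<Longrightarrow> y \<le> n \<Longrightarrow> y \<noteq> y0 \<Longrightarrow> c (B, y) = c (B, y - 1)"
      and xy: "(x, y) \<in># u" "0 \<le> y" "y \<le> n" for y u w c
  proof -
    have "\<exists>x1 y'. (x1, y') \<in># w \<and> x \<le> x1 \<and> x1 \<le> x \<and> 0 \<le> y' \<and> y' \<le> n"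
      by (rule occ_eq[OF bd _ xy(1)]) (use bot prev[of n] prev[of "-1"] xy m in auto)
    then obtain y' where y': "(x, y') \<in># w" "0 \<le> y'" "y' \<le> n" by (metis order_antisym)
    have ne: "y \<noteq> y'" using disjoint_pair_disj[OF bd _ _ xy(1), of w] y' by auto
    show False
    proof (cases "y = y0")
      case False
      have "\<exists>x2 y2. (x2, y2) \<in># w \<and> x \<le> x2 \<and> x2 \<le> B \<and> y \<le> y2 \<and> y2 \<le> y"
        by (rule occ_eq[OF bd _ xy(1)]) (use prev[of y] prev[of "y-1"] y0[of y] False xy m x B in auto)
      then obtain x2 where "(x2, y) \<in># w" "x \<le> x2" "x2 \<le> B" by (metis order_antisym)
      then show False using disjoint_pair_no_match[OF bd full_rect, of u w x y x y y' x2] xy y' x m B by auto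
    next
      case True
      have "\<exists>x2 y2. (x2, y2) \<in># u \<and> x \<le> x2 \<and> x2 \<le> B \<and> y' \<le> y2 \<and> y2 \<le> y'"
        by (rule occ_eq[OF disjoint_pair_swap[OF bd] _ y'(1)])
          (use prev[of y'] prev[of "y'-1"] y0[of y'] True ne y' m x B in auto)
      then obtain x2 where "(x2, y') \<in># u" "x \<le> x2" "x2 \<le> B" by (metis order_antisym)
      then show False using disjoint_pair_no_match[OF bd full_rect, of u w x y x2 y' y' x] xy y' x m B by auto
    qed
  qed
  have nu: "(x, y) \<notin># u" if "0 \<le> y" "y \<le> n" for y
    using no[OF b bot prev y0 _ that] by blast
  have nw: "(x, y) \<notin># w" if "0 \<le> y" "y \<le> n" for y
    using no[OF disjoint_pair_swap[OF b] _ _ _ _ _ that] bot prev y0 by auto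
  have st: "c (x, y) = c (x, y - 1)" if "0 \<le> y" "y \<le> n" for y
    using disjoint_pair_diff[OF b, of x y] nu[OF that] nw[OF that] prev[of y] prev[of "y - 1"] that
    by (simp add: not_in_iff)
  have "c (x, Y) = 0" if "-1 \<le> Y" "Y \<le> n" for Y using that
  proof (induction Y rule: int_ge_induct)
    case base then show ?case using bot by simp
  next
    case (step i) then show ?case using st[of "i + 1"] by auto
  qed
  then show ?case unfolding x_def by auto
qed

text \<open>A nonzero alternating sum would force a point of u or of w, depending on its
  sign.\<close>

lemma occ_none:
  assumes b: "disjoint_pair Q u w c" and "x1 - 1 \<le> x2" "y1 - 1 \<le> y2"
    and "\<And>x y. x1 \<le> x \<Longrightarrow> x \<le> x2 \<Longrightarrow> y1 \<le> y \<Longrightarrow> y \<le> y2 \<Longrightarrow> (x, y) \<notin># u \<and> (x, y) \<notin># w"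
  shows "c (x2, y2) - c (x1 - 1, y2) - c (x2, y1 - 1) + c (x1 - 1, y1 - 1) = 0"
proof (rule ccontr)
  assume "\<not> ?thesis"
  then have "c (x2, y2) - c (x1 - 1, y2) - c (x2, y1 - 1) + c (x1 - 1, y1 - 1) > 0 \<or>
    - c (x2, y2) - - c (x1 - 1, y2) - - c (x2, y1 - 1) + - c (x1 - 1, y1 - 1) > 0" by linarith
  then show False
    using occ_gt[OF b assms(2,3)] occ_gt[OF disjoint_pair_swap[OF b] assms(2,3)] assms(4) by metis
qed

section \<open>Vanishing at a turn\<close>

lemma occ_row:
  assumes "disjoint_pair Q u w c" "c (x2, y) - c (x1 - 1, y) - c (x2, y - 1) + c (x1 - 1, y - 1) = 0"
    "(x, y) \<in># u" "x1 \<le> x" "x \<le> x2"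
  shows "\<exists>x'. (x', y) \<in># w \<and> x1 \<le> x' \<and> x' \<le> x2"
  using occ_eq[OF assms(1,2,3,4,5), of] by (metis order_antisym order_refl)

lemma occ_col:
  assumes "disjoint_pair Q u w c" "c (x, y2) - c (x - 1, y2) - c (x, y1 - 1) + c (x - 1, y1 - 1) = 0"
    "(x, y) \<in># u" "y1 \<le> y" "y \<le> y2"
  shows "\<exists>y'. (x, y') \<in># w \<and> y1 \<le> y' \<and> y' \<le> y2"
  using occ_eq[OF assms(1,2,3) _ _ assms(4,5)] by (metis order_antisym order_refl)

text \<open>The corner square is balanced, so w has a point (x', y') in it too. One of the rows y,
  y' is met by both monomials along the incoming block, and one of the columns x, x' along the
  outgoing block. In each of the four combinations a swap in the outgoing block, followed by one in
  the incoming block, yields a common point.\<close>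

lemma turn_empty:
  assumes b: "disjoint_pair Q u w c" and m: "m > 0" "n > 0"
    and B: "B \<le> 0" and fullB: "full_rect Q B m 0 n"
    and y0: "\<And>y. 0 \<le> y \<Longrightarrow> y \<le> n \<Longrightarrow> y \<noteq> y0 \<Longrightarrow> c (B - 1, y) = c (B - 1, y - 1)"
    and T: "n \<le> T" and fullT: "full_rect Q 0 m 0 T"
    and x0: "\<And>x. 0 \<le> x \<Longrightarrow> x \<le> m \<Longrightarrow> x \<noteq> x0 \<Longrightarrow> c (x, T) = c (x - 1, T)"
    and zero_right: "\<And>y. -1 \<le> y \<Longrightarrow> y \<le> n \<Longrightarrow> c (m, y) = 0"
    and zero_below: "\<And>x. -1 \<le> x \<Longrightarrow> x \<le> m \<Longrightarrow> c (x, -1) = 0"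
    and zero_left: "c (-1, n) = 0"
    and u: "(x, y) \<in># u" "0 \<le> x" "x \<le> m" "0 \<le> y" "y \<le> n"
  shows False
proof -
  note dis = disjoint_pair_disj[OF b]
  have "\<exists>x' y'. (x', y') \<in># w \<and> 0 \<le> x' \<and> x' \<le> m \<and> 0 \<le> y' \<and> y' \<le> n"
    by (rule occ_eq[OF b _ u]) (use zero_right[of n] zero_right[of "-1"] zero_below[of "-1"] zero_left m in simp)
  then obtain x' y' where w: "(x', y') \<in># w" "0 \<le> x'" "x' \<le> m" "0 \<le> y'" "y' \<le> n" by auto
  have row: "(\<exists>x2. (x2, y) \<in># w \<and> B \<le> x2 \<and> x2 \<le> m) \<or> (\<exists>x2. (x2, y') \<in># u \<and> B \<le> x2 \<and> x2 \<le> m)"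
  proof (cases "y = y0")
    case False
    have "\<exists>x2. (x2, y) \<in># w \<and> B \<le> x2 \<and> x2 \<le> m"
      by (rule occ_row[OF b _ u(1)]) (use zero_right[of y] zero_right[of "y-1"] y0[of y] False u B in auto)
    then show ?thesis by simp
  next
    case True
    show ?thesis
    proof (cases "y' = y")
      case True then show ?thesis using w B by (metis order_trans)
    next
      case False
      have "\<exists>x2. (x2, y') \<in># u \<and> B \<le> x2 \<and> x2 \<le> m"
        by (rule occ_row[OF disjoint_pair_swap[OF b] _ w(1)])
          (use zero_right[of y'] zero_right[of "y'-1"] y0[of y'] False True w B in auto)
      then show ?thesis by simp
    qed
  qed
  have col: "(\<exists>y2. (x, y2) \<in># w \<and> 0 \<le> y2 \<and> y2 \<le> T) \<or> (\<exists>y2. (x', y2) \<in># u \<and> 0 \<le> y2 \<and> y2 \<le> T)"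
  proof (cases "x = x0")
    case False
    have "\<exists>y2. (x, y2) \<in># w \<and> 0 \<le> y2 \<and> y2 \<le> T"
      by (rule occ_col[OF b _ u(1)]) (use zero_below[of x] zero_below[of "x-1"] x0[of x] False u T in auto)
    then show ?thesis by simp
  next
    case True
    show ?thesis
    proof (cases "x' = x")
      case True then show ?thesis using w T by (metis order_trans)
    next
      case False
      have "\<exists>y2. (x', y2) \<in># u \<and> 0 \<le> y2 \<and> y2 \<le> T"
        by (rule occ_col[OF disjoint_pair_swap[OF b] _ w(1)])
          (use zero_below[of x'] zero_below[of "x'-1"] x0[of x'] False True w T in auto)
      then show ?thesis by simp
    qed
  qed
  have nT: "0 \<le> m" "0 \<le> T" "B \<le> m" "0 \<le> n" using m T B by linarith+
  note match = disjoint_pair_no_match[OF b fullB nT(3,4)]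
  have wcol: "\<exists>w'. swap_connected Q w w' \<and> (x, y') \<in># w' \<and> (\<forall>z. z \<in># w \<longrightarrow> z \<noteq> (x, y2) \<longrightarrow> z \<noteq> (x', y') \<longrightarrow> z \<in># w')"
    if "(x, y2) \<in># w" "0 \<le> y2" "y2 \<le> T" for y2
    by (rule swap_to_corner[OF that(1) w(1) full_rect_sub[OF fullT]]) (use that u w T nT in auto)
  have ucol: "\<exists>u'. swap_connected Q u u' \<and> (x', y) \<in># u' \<and> (\<forall>z. z \<in># u \<longrightarrow> z \<noteq> (x', y2) \<longrightarrow> z \<noteq> (x, y) \<longrightarrow> z \<in># u')"
    if "(x', y2) \<in># u" "0 \<le> y2" "y2 \<le> T" for y2
    by (rule swap_to_corner[OF that(1) u(1) full_rect_sub[OF fullT]]) (use that u w T nT in auto)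
  from row show False
  proof (elim disjE exE conjE)
    fix x2 assume x2: "(x2, y) \<in># w" "B \<le> x2" "x2 \<le> m"
    from col show False
    proof (elim disjE exE conjE)
      fix y2 assume y2: "(x, y2) \<in># w" "0 \<le> y2" "y2 \<le> T"
      obtain w' where w': "swap_connected Q w w'" "(x, y') \<in># w'"
        "\<And>z. z \<in># w \<Longrightarrow> z \<noteq> (x, y2) \<Longrightarrow> z \<noteq> (x', y') \<Longrightarrow> z \<in># w'" using wcol[OF y2] by (elim exE conjE) metis
      show False
      \<comment> \<open>If the row point is one of the two points consumed by the column swap, then
        (x, y) already occurs, in w or in w'.\<close>
      proof (cases "(x2, y) = (x, y2) \<or> (x2, y) = (x', y')")
        case True
        then have "(x, y) \<in># w \<or> (x, y) \<in># w'" using y2 w' by auto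
        then show False using dis[OF rtranclp.rtrancl_refl _ u(1)] w' by auto
      next
        case False
        then have "(x2, y) \<in># w'" using w'(3)[OF x2(1)] by simp
        then show False
          using match[OF rtranclp.rtrancl_refl w'(1), of x y x y y' x2] w' u w x2 B by simp
      qed
    next
      fix y2 assume y2: "(x', y2) \<in># u" "0 \<le> y2" "y2 \<le> T"
      obtain u' where u': "swap_connected Q u u'" "(x', y) \<in># u'" using ucol[OF y2] by (elim exE conjE) simp
      show False
        using match[OF u'(1) rtranclp.rtrancl_refl, of x' y x' y y' x2] u' u w x2 B by simp
    qed
  next
    fix x2 assume x2: "(x2, y') \<in># u" "B \<le> x2" "x2 \<le> m"
    from col show False
    proof (elim disjE exE conjE)
      fix y2 assume y2: "(x, y2) \<in># w" "0 \<le> y2" "y2 \<le> T"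
      obtain w' where w': "swap_connected Q w w'" "(x, y') \<in># w'" using wcol[OF y2] by (elim exE conjE) simp
      show False
        using match[OF rtranclp.rtrancl_refl w'(1), of x y x2 y' y' x] w' u w x2 B by simp
    next
      fix y2 assume y2: "(x', y2) \<in># u" "0 \<le> y2" "y2 \<le> T"
      obtain u' where u': "swap_connected Q u u'" "(x', y) \<in># u'"
        "\<And>z. z \<in># u \<Longrightarrow> z \<noteq> (x', y2) \<Longrightarrow> z \<noteq> (x, y) \<Longrightarrow> z \<in># u'" using ucol[OF y2] by (elim exE conjE) metis
      show False
      proof (cases "(x2, y') = (x', y2) \<or> (x2, y') = (x, y)")
        case True
        then have "(x', y') \<in># u \<or> (x', y') \<in># u'" using y2 u' by auto
        then show False using dis[OF _ rtranclp.rtrancl_refl _ w(1)] u' by auto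
      next
        case False
        then have "(x2, y') \<in># u'" using u'(3)[OF x2(1)] by simp
        then show False
          using match[OF u'(1) rtranclp.rtrancl_refl, of x' y x2 y' y' x'] u' u w x2 B by simp
      qed
    qed
  qed
qed

text \<open>The corner square carries no points, so the part of it right of X and up to Y is
  balanced, and its other corner values are zero. The column X = -1 belongs to the tile before the
  turn; it is included because that tile touches the tile after the turn.\<close>

lemma turn_zero:
  assumes g: "path_like P" and m: "m > 0" "n > 0" and b: "disjoint_pair (dilated m n P) u w c"
    and P: "(-2, 0) \<in> P" "(-1, 0) \<in> P" "(0, 0) \<in> P" "(0, 1) \<in> P" and c0: "c (m, n) = 0"
    and X: "-1 \<le> X" "X < m" "0 \<le> Y" "Y < n"
  shows "c (X, Y) = 0"
proof -
  have n: "(1, 0) \<notin> P" "(0, -1) \<notin> P" "(-1, 1) \<notin> P" "(-1, -1) \<notin> P"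
    using path_like_nbrs[OF g, of 0 0] path_like_nbrs[OF g, of "-1" 0] P by auto
  then have n': "(1, -1) \<notin> P" using path_like_diag[OF g, of 0 0] P by auto
  have zero_right: "c (m, y) = 0" if y: "-1 \<le> y" "y \<le> n" for y
  proof -
    consider "y = n" | "y = -1" | "0 \<le> y" "y < n" using y by linarith
    then show ?thesis
    proof cases
      case 2 then show ?thesis using disjoint_pair_zero[OF b n', of m y] m by simp
    next
      case 3 then show ?thesis using disjoint_pair_zero[OF b n(1), of m y] m by simp
    qed (simp add: c0)
  qed
  have zero_below: "c (x, -1) = 0" if "-1 \<le> x" "x \<le> m" for x
    using disjoint_pair_zero[OF b n(2), of x "-1"] disjoint_pair_zero[OF b n', of x "-1"] disjoint_pair_zero[OF b n(4), of x "-1"] that m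
    by (cases "x = m"; cases "x = -1") auto
  have zero_left: "c (-1, n) = 0" using disjoint_pair_zero[OF b n(3), of "-1" n] m by auto
  obtain B y0 where B: "B \<le> - m" "full_rect (dilated m n P) B m 0 n"
     "\<And>y. 0 \<le> y \<Longrightarrow> y \<le> n \<Longrightarrow> y \<noteq> y0 \<Longrightarrow> c (B - 1, y) = c (B - 1, y - 1)"
    using left_end_column[OF g m b P(3,2)] by auto
  obtain T x0 where T: "2 * n \<le> T" "full_rect (dilated m n P) 0 m 0 T"
     "\<And>x. 0 \<le> x \<Longrightarrow> x \<le> m \<Longrightarrow> x \<noteq> x0 \<Longrightarrow> c (x, T) = c (x - 1, T)"
    using upper_end_row[OF g m b P(3,4)] by auto
  have BT: "B \<le> 0" "n \<le> T" using B(1) T(1) m by auto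
  have nu: "(x, y) \<notin># u" if "0 \<le> x" "x \<le> m" "0 \<le> y" "y \<le> n" for x y
    using turn_empty[OF b m BT(1) B(2,3) BT(2) T(2,3) zero_right zero_below zero_left _ that] by blast
  have nw: "(x, y) \<notin># w" if "0 \<le> x" "x \<le> m" "0 \<le> y" "y \<le> n" for x y
  proof
    assume "(x, y) \<in># w"
    show False
      by (rule turn_empty[OF disjoint_pair_swap[OF b] m BT(1) B(2) _ BT(2) T(2) _ _ _ _ \<open>(x, y) \<in># w\<close> that])
        (use B(3) T(3) zero_right zero_below zero_left in auto)
  qed
  have "c (m, Y) - c (X + 1 - 1, Y) - c (m, 0 - 1) + c (X + 1 - 1, 0 - 1) = 0"
    by (rule occ_none[OF b]) (use X nu nw in auto)
  then show ?thesis using zero_right[of Y] zero_right[of "-1"] zero_below[of X] X by simp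
qed

text \<open>In a long Z-shaped block, \<open>u\<close> and \<open>w\<close> share no column: otherwise they share no row, so they
  live on the two boundary rows, and the height function over the middle of the block separates them.\<close>

lemma zblock_aux:
  assumes g: "path_like P" and m: "m > 0" "n > 0" and b: "disjoint_pair (dilated m n P) u w c"
    and fe: "f + 2 \<le> e" and P: "\<And>i. f \<le> i \<Longrightarrow> i \<le> e \<Longrightarrow> (i, 0) \<in> P" "(f, -1) \<in> P" "(e, 1) \<in> P"
    and u: "(x, y) \<in># u" "f * m \<le> x" "x \<le> e * m + m" "0 \<le> y" "y \<le> n"
    and w: "(x, y') \<in># w" "0 \<le> y'" "y' \<le> n" and yy: "y < y'"
  shows False
proof -
  have e: "(e, 0) \<in> P" "(e - 1, 0) \<in> P" "(e - 2, 0) \<in> P" "(f, 0) \<in> P" "(f + 1, 0) \<in> P"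
    using P(1) fe by auto
  have n1: "(e + 1, 0) \<notin> P" "(e, -1) \<notin> P" "(f - 1, 0) \<notin> P" "(f, 1) \<notin> P"
    using path_like_nbrs[OF g, of e 0] path_like_nbrs[OF g, of f 0] e P(2,3) by auto
  have n2: "(e + 1, -1) \<notin> P" "(f - 1, 1) \<notin> P"
    using path_like_diag[OF g, of e 0] path_like_diag[OF g, of f 0] n1 e by auto
  have mid: "(e - 1, 1) \<notin> P" "(e - 1, -1) \<notin> P" using path_like_nbrs[OF g, of "e - 1" 0] e by auto
  define B where "B = e * m + m"
  define A where "A = f * m"
  \<comment> \<open>The last column of cells of the tile e - 1. Since f + 2 \<le> e, that tile has
    both row neighbours on the path, so the tiles above and below it are missing and c vanishes just
    above and just below this column.\<close>
  define X where "X = e * m - 1"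
  have "(f + 2) * m \<le> e * m" using fe m by simp
  then have AX: "A + 2 * m \<le> X + 1" "X < B" unfolding A_def B_def X_def using m by (auto simp: distrib_right)
  have full_rect: "full_rect (dilated m n P) A B 0 n" unfolding A_def B_def using full_rect_row[of f e 0 P m n] P(1) m fe by simp
  have AB: "A \<le> B" "0 \<le> n" using AX m by auto
  note match = disjoint_pair_no_match[OF b full_rect AB rtranclp.rtrancl_refl rtranclp.rtrancl_refl]
  \<comment> \<open>The shared column x and a shared row would meet in a common point.\<close>
  have rows: False if "(x1, r) \<in># u" "(x2, r) \<in># w" "A \<le> x1" "x1 \<le> B" "A \<le> x2" "x2 \<le> B" "0 \<le> r" "r \<le> n" for x1 x2 r
    using match[of x y x1 r y' x2] that u w A_def B_def by simp
  have zr: "c (B, y) = 0" if "-1 \<le> y" "y < n" for y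
    using disjoint_pair_zero[OF b n1(1), of B y] disjoint_pair_zero[OF b n2(1), of B y] that m unfolding B_def
    by (cases "y = -1") (auto simp: distrib_right)
  have zl: "c (A - 1, y) = 0" if "0 \<le> y" "y \<le> n" for y
    using disjoint_pair_zero[OF b n1(3), of "A - 1" y] disjoint_pair_zero[OF b n2(2), of "A - 1" y] that m unfolding A_def
    by (cases "y = n") (auto simp: left_diff_distrib)
  have midu: "(x1, r) \<notin># u" if "A \<le> x1" "x1 \<le> B" "0 < r" "r < n" for x1 r
  proof
    assume u1: "(x1, r) \<in># u"
    have "\<exists>x2. (x2, r) \<in># w \<and> A \<le> x2 \<and> x2 \<le> B"
      by (rule occ_row[OF b _ u1]) (use that zr[of r] zr[of "r - 1"] zl[of r] zl[of "r - 1"] in auto)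
    then show False using rows[OF u1] that by auto
  qed
  have midw: "(x1, r) \<notin># w" if "A \<le> x1" "x1 \<le> B" "0 < r" "r < n" for x1 r
  proof
    assume w1: "(x1, r) \<in># w"
    have "\<exists>x2. (x2, r) \<in># u \<and> A \<le> x2 \<and> x2 \<le> B"
      by (rule occ_row[OF disjoint_pair_swap[OF b] _ w1]) (use that zr[of r] zr[of "r - 1"] zl[of r] zl[of "r - 1"] in auto)
    then show False using rows[OF _ w1] that by auto
  qed
  have y: "y = 0" "y' = n"
    using midu[of x y] midw[of x y'] u w yy A_def B_def by (auto simp: not_less) (force+)?
  have now: "(x1, 0) \<notin># w" if "A \<le> x1" "x1 \<le> B" for x1
    using rows[of x 0 x1] u y that AB unfolding A_def B_def by auto
  have nou: "(x1, n) \<notin># u" if "A \<le> x1" "x1 \<le> B" for x1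
    using rows[of x1 n x] w u y that AB unfolding A_def B_def by auto
  have zX: "c (X, -1) = 0" "c (X, n) = 0"
    using disjoint_pair_zero[OF b mid(1), of X n] disjoint_pair_zero[OF b mid(2), of X "-1"] m unfolding X_def
    by (auto simp: left_diff_distrib)
  have "c (X, n - 1) - c (A - 1, n - 1) - c (X, 1 - 1) + c (A - 1, 1 - 1) = 0"
    by (rule occ_none[OF b]) (use AX m midu midw in auto)
  then have eq: "c (X, n - 1) = c (X, 0)" using zl[of "n - 1"] zl[of 0] m by simp
  \<comment> \<open>The part of row 0 right of X and the part of row n left of X have the same
    excess, - c (X, 0). Row 0 contains no point of w and row n none of u, so this number is both
    nonnegative and nonpositive.\<close>
  have "c (X, 0) \<le> 0"
  proof (rule ccontr)
    assume "\<not> ?thesis"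
    then have "- c (B, 0) - - c (X + 1 - 1, 0) - - c (B, 0 - 1) + - c (X + 1 - 1, 0 - 1) > 0"
      using zr[of 0] zr[of "-1"] zX m by simp
    then have "\<exists>x' y'. (x', y') \<in># w \<and> X + 1 \<le> x' \<and> x' \<le> B \<and> 0 \<le> y' \<and> y' \<le> 0"
      by (intro occ_gt[OF disjoint_pair_swap[OF b]]) (use AX in auto)
    then obtain x' where "(x', 0) \<in># w" "X + 1 \<le> x'" "x' \<le> B" by (metis order_antisym)
    then show False using now[of x'] AX m by simp
  qed
  moreover have "c (X, 0) \<ge> 0"
  proof (rule ccontr)
    assume "\<not> ?thesis"
    then have "c (X, n) - c (A - 1, n) - c (X, n - 1) + c (A - 1, n - 1) > 0"
      using zl[of n] zl[of "n - 1"] zX eq m by simp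
    then have "\<exists>x' y'. (x', y') \<in># u \<and> A \<le> x' \<and> x' \<le> X \<and> n \<le> y' \<and> y' \<le> n"
      by (intro occ_gt[OF b]) (use AX m in auto)
    then show False using nou AX m by force
  qed
  ultimately have 0: "c (X, 0) = 0" by simp
  \<comment> \<open>Both parts being balanced, the point of u in row 0 must lie left of the cut and
    the point of w in row n right of it, but they share the column x.\<close>
  have "x \<le> X"
  proof (rule ccontr)
    assume "\<not> ?thesis"
    then have "\<exists>x2. (x2, 0) \<in># w \<and> X + 1 \<le> x2 \<and> x2 \<le> B"
      by (intro occ_row[OF b _ u(1)[unfolded y]]) (use 0 zr[of 0] zr[of "-1"] zX m u B_def in auto)
    then show False using now AX m by force
  qed
  moreover have "X < x"
  proof (rule ccontr)
    assume "\<not> ?thesis"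
    then have "\<exists>x2. (x2, n) \<in># u \<and> A \<le> x2 \<and> x2 \<le> X"
      by (intro occ_row[OF disjoint_pair_swap[OF b] _ w(1)[unfolded y]])
        (use 0 eq zl[of n] zl[of "n - 1"] zX m u A_def in auto)
    then show False using nou AX m by force
  qed
  ultimately show False by simp
qed

lemma zblock:
  assumes g: "path_like P" and m: "m > 0" "n > 0" and b: "disjoint_pair (dilated m n P) u w c"
    and fe: "f + 2 \<le> e" and P: "\<And>i. f \<le> i \<Longrightarrow> i \<le> e \<Longrightarrow> (i, 0) \<in> P" "(f, -1) \<in> P" "(e, 1) \<in> P"
    and u: "(x, y) \<in># u" "f * m \<le> x" "x \<le> e * m + m" "0 \<le> y" "y \<le> n"
    and w: "(x, y') \<in># w" "0 \<le> y'" "y' \<le> n"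
  shows False
proof -
  consider "y < y'" | "y' < y" | "y = y'" by linarith
  then show False
  proof cases
    case 1 then show False using zblock_aux[OF g m b fe P u w] by simp
  next
    case 2 then show False
      using zblock_aux[OF g m disjoint_pair_swap[OF b] fe P w(1) u(2,3) w(2,3) u(1,4,5)] by simp
  next
    case 3 then show False using disjoint_pair_disj[OF b rtranclp.rtrancl_refl rtranclp.rtrancl_refl u(1)] w by simp
  qed
qed

lemma zblock_row:
  assumes g: "path_like P" and m: "m > 0" "n > 0" and b: "disjoint_pair (dilated m n P) u w c"
    and fe: "f + 2 \<le> e" and P: "\<And>i. f \<le> i \<Longrightarrow> i \<le> e \<Longrightarrow> (i, j) \<in> P" "(f, j - 1) \<in> P" "(e, j + 1) \<in> P"
    and u: "(x, y) \<in># u" "f * m \<le> x" "x \<le> e * m + m" "j * n \<le> y" "y \<le> j * n + n"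
    and w: "(x, y') \<in># w" "j * n \<le> y'" "y' \<le> j * n + n"
  shows False
proof -
  have g': "path_like (shifted 0 j P)" using g by (rule path_like_shifted)
  have b': "disjoint_pair (dilated m n (shifted 0 j P)) (image_mset (\<lambda>(x, y). (x - 0, y - j * n)) u)
    (image_mset (\<lambda>(x, y). (x - 0, y - j * n)) w) (\<lambda>(x, y). c (x + 0, y + j * n))"
    using disjoint_pair_shifted[OF b, of 0 "j * n"] dilated_shifted[OF m, of 0 j P] by simp
  have u': "(x, y - j * n) \<in># image_mset (\<lambda>(x, y). (x - 0, y - j * n)) u" using u(1) by force
  have w': "(x, y' - j * n) \<in># image_mset (\<lambda>(x, y). (x - 0, y - j * n)) w" using w(1) by force
  show False by (rule zblock[OF g' m b' fe _ _ _ u' _ _ _ _ w']) (use P u w in \<open>auto simp: add.commute\<close>)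
qed

lemma zblock_col:
  assumes g: "path_like P" and m: "m > 0" "n > 0" and b: "disjoint_pair (dilated m n P) u w c"
    and fe: "f + 2 \<le> e" and P: "\<And>i. f \<le> i \<Longrightarrow> i \<le> e \<Longrightarrow> (j, i) \<in> P" "(j - 1, f) \<in> P" "(j + 1, e) \<in> P"
    and u: "(x, y) \<in># u" "f * n \<le> y" "y \<le> e * n + n" "j * m \<le> x" "x \<le> j * m + m"
    and w: "(x', y) \<in># w" "j * m \<le> x'" "x' \<le> j * m + m"
  shows False
proof -
  have b': "disjoint_pair (dilated n m (transposed P)) (image_mset prod.swap u) (image_mset prod.swap w) (c \<circ> prod.swap)"
    using disjoint_pair_transposed[OF b] dilated_transposed by simp
  have u': "(y, x) \<in># image_mset prod.swap u" using u(1) by force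
  have w': "(y, x') \<in># image_mset prod.swap w" using w(1) by force
  show False by (rule zblock_row[OF path_like_transposed[OF g] m(2,1) b' fe _ _ _ u' _ _ _ _ w']) (use P u w in auto)
qed

section \<open>A turn followed by a turn back after a column of two tiles\<close>

lemma end_left:
  assumes g: "path_like P" and "(a, b) \<in> P" "(a - 1, b) \<in> P"
  shows "\<exists>f\<le>a - 1. (\<forall>i. f \<le> i \<longrightarrow> i \<le> a \<longrightarrow> (i, b) \<in> P) \<and> (f - 1, b) \<notin> P \<and>
     ((f - 1, b + 1) \<notin> P \<or> (f - 1, b - 1) \<notin> P)"
proof -
  obtain e where e: "-1 - a + 1 \<le> e" "\<And>i. -1 - a \<le> i \<Longrightarrow> i \<le> e \<Longrightarrow> (i, b) \<in> reflected P" "(e + 1, b) \<notin> reflected P"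
    "(e + 1, b + 1) \<notin> reflected P \<or> (e + 1, b - 1) \<notin> reflected P"
    using end_right[OF path_like_reflected[OF g], of "-1 - a" b] assms(2,3) by auto
  have "(i, b) \<in> P" if "-1 - e \<le> i" "i \<le> a" for i using e(2)[of "-1 - i"] that by simp
  moreover have "-1 - (e + 1) = -1 - e - 1" by simp
  ultimately show ?thesis using e(1,3,4) by (intro exI[of _ "-1 - e"]) (auto simp: algebra_simps)
qed

lemma end_up:
  assumes g: "path_like P" and "(a, b) \<in> P" "(a, b + 1) \<in> P"
  shows "\<exists>h\<ge>b + 1. (\<forall>i. b \<le> i \<longrightarrow> i \<le> h \<longrightarrow> (a, i) \<in> P) \<and> (a, h + 1) \<notin> P \<and>
     ((a + 1, h + 1) \<notin> P \<or> (a - 1, h + 1) \<notin> P)"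
  using end_right[OF path_like_transposed[OF g], of b a] assms(2,3) by auto

lemma full_rect_col:
  assumes "\<And>i. f \<le> i \<Longrightarrow> i \<le> e \<Longrightarrow> (j, i) \<in> P" "m > 0" "n > 0" "f \<le> e"
  shows "full_rect (dilated m n P) (j * m) (j * m + m) (f * n) (e * n + n)"
proof -
  have "full_rect (dilated n m (transposed P)) (f * n) (e * n + n) (j * m) (j * m + m)"
    using full_rect_row[of f e j "transposed P" n m] assms by auto
  from full_rect_transposed[OF this] show ?thesis unfolding dilated_transposed by (simp add: transposed_def)
qed

text \<open>The situation to be refuted: two turns in succession and a positive value on the lower
  left cell of the tile (1, 1). A negative value becomes positive when u and w are
  exchanged.\<close>

locale corner =
  fixes P m n u w c
  assumes g: "path_like P" and m: "m > 0" "n > 0" and b: "disjoint_pair (dilated m n P) u w c"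
    and P: "(-2, 0) \<in> P" "(-1, 0) \<in> P" "(0, 0) \<in> P" "(0, 1) \<in> P" "(1, 1) \<in> P"
    and pos: "c (m, n) > 0"
begin

lemma outside_adjacent: "(1, 0) \<notin> P" "(0, -1) \<notin> P" "(-1, 1) \<notin> P" "(-1, -1) \<notin> P" "(0, 2) \<notin> P"
  using path_like_nbrs[OF g, of 0 0] path_like_nbrs[OF g, of "-1" 0] path_like_nbrs[OF g, of 0 1] P by auto

lemma outside_diagonal: "(1, -1) \<notin> P" "(-1, 2) \<notin> P"
  using path_like_diag[OF g, of 0 0] path_like_diag[OF g, of 0 1] outside_adjacent P by auto

lemma zero_right: "-1 \<le> y \<Longrightarrow> y < n \<Longrightarrow> c (m, y) = 0"
  using disjoint_pair_zero[OF b outside_adjacent(1), of m y] disjoint_pair_zero[OF b outside_diagonal(1), of m y] m by (cases "y = -1") auto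

lemma zero_below: "-1 \<le> x \<Longrightarrow> x \<le> m \<Longrightarrow> c (x, -1) = 0"
  using disjoint_pair_zero[OF b outside_adjacent(2), of x "-1"] disjoint_pair_zero[OF b outside_diagonal(1), of x "-1"] disjoint_pair_zero[OF b outside_adjacent(4), of x "-1"] m
    by (cases "x = m"; cases "x = -1") auto

lemma zero_left: "n \<le> y \<Longrightarrow> y \<le> 2 * n \<Longrightarrow> c (-1, y) = 0"
  using disjoint_pair_zero[OF b outside_adjacent(3), of "-1" y] disjoint_pair_zero[OF b outside_diagonal(2), of "-1" y] m by (cases "y = 2 * n") auto

lemma zero_above: "-1 \<le> x \<Longrightarrow> x < m \<Longrightarrow> c (x, 2 * n) = 0"
  using disjoint_pair_zero[OF b outside_adjacent(5), of x "2 * n"] disjoint_pair_zero[OF b outside_diagonal(2), of x "2 * n"] m by (cases "x = -1") auto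

text \<open>The excess in the corner square is c (m, n), since its other three corner values
  vanish.\<close>

lemma point_u: "\<exists>x y. (x, y) \<in># u \<and> 0 \<le> x \<and> x \<le> m \<and> 0 \<le> y \<and> y \<le> n"
  by (rule occ_gt[OF b]) (use pos m zero_right[of "-1"] zero_below[of "-1"] zero_left[of n] in auto)

text \<open>When the path goes up from (1, 1), the tiles (2, 1) and (2, 0) are missing, so the part
  of row n strictly right of the vertex (m, n) has excess - c (m, n).\<close>

lemma point_w:
  assumes "(1, 2) \<in> P"
  shows "\<exists>x. (x, n) \<in># w \<and> m < x \<and> x \<le> 2 * m"
proof -
  have n3: "(2, 1) \<notin> P" using path_like_nbrs[OF g, of 1 1] P assms by auto
  have n4: "(2, 0) \<notin> P" using path_like_diag[OF g, of 1 1] P outside_adjacent n3 by auto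
  have "\<exists>x y. (x, y) \<in># w \<and> m + 1 \<le> x \<and> x \<le> 2 * m \<and> n \<le> y \<and> y \<le> n"
    by (rule occ_gt[OF disjoint_pair_swap[OF b]])
      (use m pos zero_right[of "n - 1"] disjoint_pair_zero[OF b n3, of "2 * m" n] disjoint_pair_zero[OF b n4, of "2 * m" "n - 1"] in auto)
  then show ?thesis by (metis order_antisym add1_zle_eq)
qed

lemma full_second_row: "full_rect (dilated m n P) 0 (2 * m) n (2 * n)"
proof -
  have "i = 0 \<or> i = 1" if "0 \<le> i" "i \<le> 1" for i :: int using that by auto
  then have "(i, 1) \<in> P" if "0 \<le> i" "i \<le> 1" for i using that P by blast
  then show ?thesis using full_rect_row[of 0 1 1 P m n] m by simp
qed

text \<open>A point of w is brought into the column of the point of u from \<open>point_u\<close>,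
  no higher than row n, if necessary by a swap with the point from \<open>point_w\<close>. Now the
  incoming block decides: either it is Z-shaped and \<open>zblock\<close> applies, or all its rows
  below n are balanced and one of them completes the common column to a collision.\<close>

lemma no_staircase:
  assumes Q: "(1, 2) \<in> P" "(2, 2) \<in> P"
  shows False
proof -
  have n3: "(1, 3) \<notin> P" using path_like_nbrs[OF g, of 1 2] P Q by auto
  have n4: "(0, 3) \<notin> P" using path_like_diag[OF g, of 1 2] Q outside_adjacent n3 by auto
  obtain x y where u: "(x, y) \<in># u" "0 \<le> x" "x \<le> m" "0 \<le> y" "y \<le> n" using point_u by auto
  obtain xb where xb: "(xb, n) \<in># w" "m < xb" "xb \<le> 2 * m" using point_w[OF Q(1)] by auto
  \<comment> \<open>Points of w below row n survive, so those rows can still be compared afterwards.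
    The final clause says that the new point lies in row n unless nothing was moved at all.\<close>
  have "\<exists>w' yy. swap_connected (dilated m n P) w w' \<and> (x, yy) \<in># w' \<and> 0 \<le> yy \<and> yy \<le> n \<and>
     (\<forall>x2 r. (x2, r) \<in># w \<longrightarrow> r < n \<longrightarrow> (x2, r) \<in># w') \<and> (yy = n \<or> w' = w)"
  proof (cases "\<exists>y'. (x, y') \<in># w \<and> 0 \<le> y' \<and> y' \<le> 2 * n")
    case True
    then obtain y' where y': "(x, y') \<in># w" "0 \<le> y'" "y' \<le> 2 * n" by auto
    show ?thesis
    proof (cases "y' \<le> n")
      case True then show ?thesis using y' by (intro exI[of _ w] exI[of _ y']) simp
    next
      case False
      have "full_rect (dilated m n P) x xb y' n" by (rule full_rect_sub[OF full_second_row]) (use False y' xb u m in auto)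
      from swap_to_corner[OF y'(1) xb(1) this] obtain w' where w': "swap_connected (dilated m n P) w w'" "(x, n) \<in># w'"
         "\<And>z. z \<in># w \<Longrightarrow> z \<noteq> (x, y') \<Longrightarrow> z \<noteq> (xb, n) \<Longrightarrow> z \<in># w'" by (elim exE conjE) metis
      show ?thesis by (intro exI[of _ w'] exI[of _ n]) (use w' False m in auto)
    qed
  next
    case F: False
    have xm: "x = m"
    proof (rule ccontr)
      assume "x \<noteq> m"
      have "\<exists>y'. (x, y') \<in># w \<and> 0 \<le> y' \<and> y' \<le> 2 * n"
        by (rule occ_col[OF b _ u(1)]) (use zero_above[of x] zero_above[of "x-1"] zero_below[of x] zero_below[of "x-1"] \<open>x \<noteq> m\<close> u m in auto)
      then show False using F by simp
    qed
    \<comment> \<open>The line of abscissa m also borders the tiles (1, 1) and (1, 2), so it is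
      balanced only up to 3 * n, where (0, 3) and (1, 3) are missing.\<close>
    have "\<exists>y'. (x, y') \<in># w \<and> 0 \<le> y' \<and> y' \<le> 3 * n"
      by (rule occ_col[OF b _ u(1)])
       (use zero_below[of x] zero_below[of "x-1"] disjoint_pair_zero[OF b n3, of m "3 * n"] disjoint_pair_zero[OF b n4, of "m - 1" "3 * n"] xm u m in auto)
    then obtain y' where y': "(m, y') \<in># w" "0 \<le> y'" "y' \<le> 3 * n" using xm by auto
    then have y2: "2 * n < y'" using F xm by (meson not_le)
    have "i = 1 \<or> i = 2" if "1 \<le> i" "i \<le> 2" for i :: int using that by auto
    then have "(1, i) \<in> P" if "1 \<le> i" "i \<le> 2" for i using that P Q by blast
    then have "full_rect (dilated m n P) m (2 * m) n (3 * n)" using full_rect_col[of 1 2 1 P m n] m by simp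
    then have "full_rect (dilated m n P) m xb y' n" by (rule full_rect_sub) (use y' y2 xb u m in auto)
    from swap_to_corner[OF y'(1) xb(1) this] obtain w' where w': "swap_connected (dilated m n P) w w'" "(m, n) \<in># w'"
         "\<And>z. z \<in># w \<Longrightarrow> z \<noteq> (m, y') \<Longrightarrow> z \<noteq> (xb, n) \<Longrightarrow> z \<in># w'" by (elim exE conjE) metis
    show ?thesis by (intro exI[of _ w'] exI[of _ n]) (use w' xm y2 m in auto)
  qed
  then obtain w' yy where w': "swap_connected (dilated m n P) w w'" and yy: "(x, yy) \<in># w'" "0 \<le> yy" "yy \<le> n"
     and ret: "\<And>x2 r. (x2, r) \<in># w \<Longrightarrow> r < n \<Longrightarrow> (x2, r) \<in># w'" and or: "yy = n \<or> w' = w"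
    by (elim exE conjE) metis
  obtain f where f: "f \<le> 0 - 1" "\<And>i. f \<le> i \<Longrightarrow> i \<le> 0 \<Longrightarrow> (i, 0) \<in> P" "(f - 1, 0) \<notin> P"
    using end_left[OF g P(3)] P(2) by auto
  have f2: "f + 2 \<le> 0" using f P(1) by (cases "f = -1") auto
  define A where "A = f * m"
  have A: "A \<le> 0" unfolding A_def using f2 m by (simp add: mult_le_0_iff)
  have full_rect: "full_rect (dilated m n P) A m 0 n" using full_rect_row[of f 0 0 P m n] f m unfolding A_def by simp
  show False
  proof (cases "(f - 1, -1) \<in> P")
    case True
    have fP: "(f, -1) \<in> P" using path_like_diag(2)[OF g f(2)[of f]] f(3) True f2 by auto
    obtain c' where b': "disjoint_pair (dilated m n P) w' u c'" using disjoint_pair_swap_connected[OF disjoint_pair_swap[OF b] w'] by auto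
    show False
      by (rule zblock[OF g m disjoint_pair_swap[OF b'] f2 f(2) _ P(4)[folded one_add_one] u(1) _ _ _ _ yy(1)])
        (use fP u yy A A_def P in auto)
  next
    case False
    have zA: "c (A - 1, r) = 0" if "-1 \<le> r" "r < n" for r
      using disjoint_pair_zero[OF b f(3), of "A - 1" r] disjoint_pair_zero[OF b False, of "A - 1" r] that m A_def
      by (cases "r = -1") (auto simp: left_diff_distrib)
    note match = disjoint_pair_no_match[OF b full_rect _ _ rtranclp.rtrancl_refl w']
    show False
    proof (cases "y < n")
      case True
      have "\<exists>x2. (x2, y) \<in># w \<and> A \<le> x2 \<and> x2 \<le> m"
        by (rule occ_row[OF b _ u(1)]) (use zero_right[of y] zero_right[of "y-1"] zA[of y] zA[of "y-1"] True u A in auto)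
      then obtain x2 where "(x2, y) \<in># w" "A \<le> x2" "x2 \<le> m" by auto
      then show False using match[of x y x y yy x2] ret[of x2 y] True u yy A m by simp
    next
      case False
      then have yn: "y = n" using u by simp
      show False
      proof (cases "yy = n")
        case True then show False using disjoint_pair_disj[OF b rtranclp.rtrancl_refl w' u(1)] yy yn by simp
      next
        case False
        then have "w' = w" using or by simp
        have "\<exists>x2. (x2, yy) \<in># u \<and> A \<le> x2 \<and> x2 \<le> m"
          by (rule occ_row[OF disjoint_pair_swap[OF b] _ yy(1)[unfolded \<open>w' = w\<close>]])
             (use zero_right[of yy] zero_right[of "yy-1"] zA[of yy] zA[of "yy-1"] False yy u A in auto)
        then obtain x2 where "(x2, yy) \<in># u" "A \<le> x2" "x2 \<le> m" by auto
        then show False using match[of x n x2 yy yy x] u yn yy A m by simp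
      qed
    qed
  qed
qed

text \<open>From here on the incoming block is Z-shaped: the path enters it from below at f and
  leaves it upwards at 0.\<close>

context
  fixes f
  assumes f2: "f + 2 \<le> 0" and fP: "\<And>i. f \<le> i \<Longrightarrow> i \<le> 0 \<Longrightarrow> (i, 0) \<in> P" and fd: "(f, -1) \<in> P"
begin

lemma left_end: "f * m \<le> 0" "full_rect (dilated m n P) (f * m) m 0 n" "0 \<le> y \<Longrightarrow> y \<le> n \<Longrightarrow> c (f * m - 1, y) = 0"
proof -
  show "f * m \<le> 0" using f2 m by (simp add: mult_le_0_iff)
  show "full_rect (dilated m n P) (f * m) m 0 n" using full_rect_row[of f 0 0 P m n] fP f2 m by simp
  have "(f, 0) \<in> P" "(f + 1, 0) \<in> P" using fP f2 by auto
  then have n1: "(f - 1, 0) \<notin> P" "(f, 1) \<notin> P" using path_like_nbrs(5,6)[OF g, of f 0] fd by auto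
  then have n2: "(f - 1, 1) \<notin> P" using path_like_diag(4)[OF g, of f 0] \<open>(f, 0) \<in> P\<close> by auto
  show "0 \<le> y \<Longrightarrow> y \<le> n \<Longrightarrow> c (f * m - 1, y) = 0"
    using disjoint_pair_zero[OF b n1(1), of "f * m - 1" y] disjoint_pair_zero[OF b n2, of "f * m - 1" y] m
    by (cases "y = n") (auto simp: left_diff_distrib)
qed

lemma zblock_disjoint:
  assumes "disjoint_pair (dilated m n P) u' w' c'"
    "(x, y) \<in># u'" "0 \<le> x" "x \<le> m" "0 \<le> y" "y \<le> n" "(x, y') \<in># w'" "0 \<le> y'" "y' \<le> n"
  shows False
  by (rule zblock[OF g m assms(1) f2 fP _ _ assms(2) _ _ _ _ assms(7)])
    (use assms left_end fd P in auto)

text \<open>The top row n of the incoming block has excess c (m, n) > 0, so u has a point in it; a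
  swap with that point lifts the point of the corner square to row n.\<close>

lemma move_point_u:
  "\<exists>u' x y x1. swap_connected (dilated m n P) u u' \<and> (x, y) \<in># u \<and> 0 \<le> x \<and> x \<le> m \<and> 0 \<le> y \<and> y \<le> n \<and> (x, n) \<in># u' \<and>
    x1 \<le> m \<and> (\<forall>z. z \<in># u \<longrightarrow> z \<noteq> (x, y) \<longrightarrow> z \<noteq> (x1, n) \<longrightarrow> z \<in># u')"
proof -
  obtain x y where u: "(x, y) \<in># u" "0 \<le> x" "x \<le> m" "0 \<le> y" "y \<le> n" using point_u by auto
  have "\<exists>x1 y1. (x1, y1) \<in># u \<and> f * m \<le> x1 \<and> x1 \<le> m \<and> n \<le> y1 \<and> y1 \<le> n"
    by (rule occ_gt[OF b]) (use left_end(1) left_end(3)[of n] left_end(3)[of "n - 1"] zero_right[of "n - 1"] pos m in auto)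
  then obtain x1 where x1: "(x1, n) \<in># u" "f * m \<le> x1" "x1 \<le> m" by (metis order_antisym)
  have "full_rect (dilated m n P) x x1 y n" by (rule full_rect_sub[OF left_end(2)]) (use u x1 left_end(1) m in linarith)+
  from swap_to_corner[OF u(1) x1(1) this] show ?thesis using u x1 by auto
qed

text \<open>Column x is balanced up to 2 * n, so w meets it, and by \<open>zblock\<close> only above
  row n, at some y'. If row y' is balanced along the next block, u meets it as well, and the lifted
  point (x, n) helps to a collision. Otherwise that block leaves upwards too; it is then Z-shaped
  itself and cannot contain points of both monomials in column x.\<close>

lemma no_ladder_right:
  assumes Q: "(2, 1) \<in> P"
  shows False
proof -
  have n3: "(1, 2) \<notin> P" using path_like_nbrs[OF g, of 1 1] P Q by auto
  obtain u' x y x1 where e: "swap_connected (dilated m n P) u u'" and u: "(x, y) \<in># u" "0 \<le> x" "x \<le> m" "0 \<le> y" "y \<le> n"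
    and u': "(x, n) \<in># u'" and x1: "x1 \<le> m"
    and ret: "\<And>z. z \<in># u \<Longrightarrow> z \<noteq> (x, y) \<Longrightarrow> z \<noteq> (x1, n) \<Longrightarrow> z \<in># u'"
    using move_point_u by (elim exE conjE) metis
  obtain c' where b': "disjoint_pair (dilated m n P) u' w c'" using disjoint_pair_swap_connected[OF b e] by auto
  have zT': "c (x, 2 * n) = 0" if "-1 \<le> x" "x \<le> m" for x
    using zero_above[of x] disjoint_pair_zero[OF b n3, of x "2 * n"] that m by (cases "x = m") auto
  have "\<exists>y'. (x, y') \<in># w \<and> 0 \<le> y' \<and> y' \<le> 2 * n"
    by (rule occ_col[OF b _ u(1)]) (use zT'[of x] zT'[of "x-1"] zero_below[of x] zero_below[of "x-1"] u m in auto)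
  then obtain y' where y': "(x, y') \<in># w" "0 \<le> y'" "y' \<le> 2 * n" by auto
  have yn: "n < y'"
  proof (rule ccontr)
    assume "\<not> ?thesis" then show False using zblock_disjoint[OF b u y'(1,2)] by simp
  qed
  obtain h where h: "0 + 1 \<le> h" "\<And>i. 0 \<le> i \<Longrightarrow> i \<le> h \<Longrightarrow> (i, 1) \<in> P" "(h + 1, 1) \<notin> P"
    using end_right[OF g P(4)] P(5) by auto
  have h2: "2 \<le> h" using h Q by (cases "h = 1") auto
  define B where "B = h * m + m"
  have B: "2 * m \<le> B" using mult_right_mono[OF h2, of m] m unfolding B_def by linarith
  have full_rect: "full_rect (dilated m n P) 0 B n (2 * n)" using full_rect_row[of 0 h 1 P m n] h m unfolding B_def by simp
  have zh: "c (B, r) = 0" if "n \<le> r" "r < 2 * n" for r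
    using disjoint_pair_zero[OF b h(3), of B r] that m unfolding B_def by (auto simp: distrib_right)
  show False
  proof (cases "c (B, y') = 0")
    case True
    have "\<exists>x3. (x3, y') \<in># u \<and> 0 \<le> x3 \<and> x3 \<le> B"
      by (rule occ_row[OF disjoint_pair_swap[OF b] _ y'(1)])
         (use True zh[of "y' - 1"] zero_left[of y'] zero_left[of "y' - 1"] y' yn u B m in auto)
    then obtain x3 where x3: "(x3, y') \<in># u" "0 \<le> x3" "x3 \<le> B" by auto
    then have "(x3, y') \<in># u'" using ret[OF x3(1)] yn u by auto
    then show False
      using disjoint_pair_no_match[OF b full_rect _ _ e rtranclp.rtrancl_refl, of x n x3 y' y' x] x3 u' y' yn u B m by simp
  next
    case False
    then have "\<not> y' < 2 * n" using zh[of y'] yn by auto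
    then have y2: "y' = 2 * n" using y' by simp
    \<comment> \<open>A nonzero value beyond the end of the block at its top row can only come from
      the diagonal tile.\<close>
    have hd: "(h + 1, 2) \<in> P"
    proof (rule ccontr)
      assume "\<not> ?thesis"
      then show False using disjoint_pair_zero[OF b, of "h + 1" 2 B y'] False y2 m unfolding B_def by (auto simp: distrib_right)
    qed
    then have "(h, 2) \<in> P" using path_like_diag(1)[OF g h(2)[of h]] h by auto
    have xB: "x \<le> h * m + m" using u(3) B m unfolding B_def by linarith
    show False
      by (rule zblock_row[OF g m b', of 0 h 1 x n y']) (use h2 h(2) P \<open>(h, 2) \<in> P\<close> u' y' u(2) yn y2 xB m in auto)
  qed
qed

text \<open>Besides the lifted point (x, n) of u there is a point (xb, n) of w. A point of w in
  column x would collide, so column x must be unbalanced up to 2 * n, which forces x = m. Then both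
  points lie in the upward block: either column xb is balanced along it and u meets that column, or
  the block is Z-shaped and cannot contain two such points in one row.\<close>

lemma no_ladder_up:
  assumes Q: "(1, 2) \<in> P" "(1, 3) \<in> P"
  shows False
proof -
  have n3: "(2, 1) \<notin> P" using path_like_nbrs[OF g, of 1 1] P Q by auto
  have n4: "(2, 0) \<notin> P" using path_like_diag[OF g, of 1 1] P outside_adjacent n3 by auto
  obtain u' x y x1 where e: "swap_connected (dilated m n P) u u'" and u: "(x, y) \<in># u" "0 \<le> x" "x \<le> m" "0 \<le> y" "y \<le> n"
    and u': "(x, n) \<in># u'" and x1: "x1 \<le> m"
    and ret: "\<And>z. z \<in># u \<Longrightarrow> z \<noteq> (x, y) \<Longrightarrow> z \<noteq> (x1, n) \<Longrightarrow> z \<in># u'"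
    using move_point_u by (elim exE conjE) metis
  obtain c' where b': "disjoint_pair (dilated m n P) u' w c'" using disjoint_pair_swap_connected[OF b e] by auto
  obtain xb where xb: "(xb, n) \<in># w" "m < xb" "xb \<le> 2 * m" using point_w[OF Q(1)] by auto
  have nocol: False if y': "(x, y') \<in># w" "0 \<le> y'" "y' \<le> 2 * n" for y'
  proof (cases "y' \<le> n")
    case True then show False using zblock_disjoint[OF b u y'(1,2)] by simp
  next
    case False
    then show False
      using disjoint_pair_no_match[OF b full_second_row _ _ e rtranclp.rtrancl_refl, of x n x n y' xb] u' u y' xb m by simp
  qed
  have xm: "x = m"
  proof (rule ccontr)
    assume "x \<noteq> m"
    have "\<exists>y'. (x, y') \<in># w \<and> 0 \<le> y' \<and> y' \<le> 2 * n"
      by (rule occ_col[OF b _ u(1)]) (use zero_above[of x] zero_above[of "x-1"] zero_below[of x] zero_below[of "x-1"] \<open>x \<noteq> m\<close> u m in auto)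
    then show False using nocol by auto
  qed
  obtain h where h: "1 + 1 \<le> h" "\<And>i. 1 \<le> i \<Longrightarrow> i \<le> h \<Longrightarrow> (1, i) \<in> P" "(1, h + 1) \<notin> P"
    using end_up[OF g P(5)] Q by auto
  have h3: "3 \<le> h" using h Q by (cases "h = 2") auto
  define T where "T = h * n + n"
  have T: "2 * n \<le> T" using mult_right_mono[OF h3, of n] m unfolding T_def by linarith
  have full_rect: "full_rect (dilated m n P) m (2 * m) n T" using full_rect_col[of 1 h 1 P m n] h m unfolding T_def by simp
  have zb: "c (x, n - 1) = 0" if "m \<le> x" "x \<le> 2 * m" for x
    using disjoint_pair_zero[OF b outside_adjacent(1), of x "n - 1"] disjoint_pair_zero[OF b n4, of x "n - 1"] that m by (cases "x = 2 * m") auto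
  have zero_on: "c (x, T) = 0" if "m \<le> x" "x < 2 * m" for x
    using disjoint_pair_zero[OF b h(3), of x T] that m unfolding T_def by (auto simp: distrib_right)
  show False
  proof (cases "c (xb, T) = 0")
    case True
    have "\<exists>y3. (xb, y3) \<in># u \<and> n \<le> y3 \<and> y3 \<le> T"
      by (rule occ_col[OF disjoint_pair_swap[OF b] _ xb(1)])
         (use True zero_on[of "xb - 1"] zb[of xb] zb[of "xb - 1"] xb T m in auto)
    then obtain y3 where y3: "(xb, y3) \<in># u" "n \<le> y3" "y3 \<le> T" by auto
    then have "(xb, y3) \<in># u'" using ret[OF y3(1)] xb u x1 by auto
    then show False
      using disjoint_pair_no_match[OF b full_rect _ _ e rtranclp.rtrancl_refl, of xb y3 m n n xb] y3 u' xm xb T m by simp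
  next
    case False
    then have x2: "xb = 2 * m"
      using zero_on[of xb] xb by (metis order.not_eq_order_implies_strict less_imp_le)
    have hd: "(2, h + 1) \<in> P"
    proof (rule ccontr)
      assume "\<not> ?thesis"
      then show False using disjoint_pair_zero[OF b, of 2 "h + 1" xb T] False x2 m unfolding T_def by (auto simp: distrib_right)
    qed
    then have "(2, h) \<in> P" using path_like_diag(1)[OF g h(2)[of h]] h by auto
    show False
      by (rule zblock_col[OF g m b', of 1 h 1 m n xb])
        (use h3 h(2) P \<open>(2, h) \<in> P\<close> u' xm xb T T_def m in auto)
  qed
qed

end
end

text \<open>The path enters the corner \<open>(0, 0)\<close> along a row of length at least three and turns upwards:
  the first disjunct is an L-configuration; in the others the column has only two cells.\<close>

definition good_corner :: "(int \<times> int) set \<Rightarrow> bool" where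
  "good_corner P \<longleftrightarrow> (-2, 0) \<in> P \<and> (-1, 0) \<in> P \<and> (0, 0) \<in> P \<and> (0, 1) \<in> P \<and>
    ((0, 2) \<in> P \<or> (1, 1) \<in> P \<and> ((1, 2) \<in> P \<and> (2, 2) \<in> P \<or>
       (\<exists>f. f + 2 \<le> 0 \<and> (\<forall>i. f \<le> i \<longrightarrow> i \<le> 0 \<longrightarrow> (i, 0) \<in> P) \<and> (f, -1) \<in> P \<and>
          ((2, 1) \<in> P \<or> (1, 2) \<in> P \<and> (1, 3) \<in> P))))"

text \<open>If (1, 1) is missing, heights vanish there anyway. Otherwise (0, 2) is missing, each
  remaining alternative of \<open>good_corner\<close> refutes a positive value, and exchanging u and
  w refutes a negative one.\<close>

lemma good_corner_zero:
  assumes g: "path_like P" and m: "m > 0" "n > 0" and b: "disjoint_pair (dilated m n P) u w c" and gc: "good_corner P"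
  shows "c (m, n) = 0"
proof (cases "(1, 1) \<in> P")
  case False then show ?thesis using disjoint_pair_zero[OF b False, of m n] m by simp
next
  case True
  have no: "\<not> c (m, n) > 0" if b: "disjoint_pair (dilated m n P) u w c" for u w c
  proof
    assume pos: "c (m, n) > 0"
    interpret corner P m n u w c by unfold_locales (use g m b gc True pos in \<open>auto simp: good_corner_def\<close>)
    have "(0, 2) \<notin> P" using outside_adjacent by blast
    then consider "(1, 2) \<in> P" "(2, 2) \<in> P" | f where "f + 2 \<le> 0" "\<And>i. f \<le> i \<Longrightarrow> i \<le> 0 \<Longrightarrow> (i, 0) \<in> P"
      "(f, -1) \<in> P" "(2, 1) \<in> P \<or> (1, 2) \<in> P \<and> (1, 3) \<in> P"
      using gc unfolding good_corner_def by blast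
    then show False
    proof cases
      case 1 then show False by (rule no_staircase)
    next
      case (2 f)
      then show False using no_ladder_right[of f] no_ladder_up[of f] by blast
    qed
  qed
  show ?thesis using no[OF b] no[OF disjoint_pair_swap[OF b]] by simp
qed

lemma good_corner_turn_zero:
  assumes "path_like P" "m > 0" "n > 0" "disjoint_pair (dilated m n P) u w c" "good_corner P"
    "-1 \<le> X" "X < m" "0 \<le> Y" "Y < n"
  shows "c (X, Y) = 0"
  by (rule turn_zero[OF assms(1-4) _ _ _ _ good_corner_zero[OF assms(1-5)] assms(6-)])
    (use assms(5) in \<open>auto simp: good_corner_def\<close>)

section \<open>Closed paths as periodic sequences of tiles\<close>

definition tile_cycle :: "int \<Rightarrow> (int \<Rightarrow> int \<times> int) \<Rightarrow> bool" where
  "tile_cycle N p \<longleftrightarrow> N > 5 \<and> (\<forall>i. p (i + N) = p i) \<and> (\<forall>i. adjacent (p i) (p (i + 1))) \<and>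
     (\<forall>i j. p i = p j \<longrightarrow> N dvd (i - j)) \<and>
     (\<forall>i j. near (p i) (p j) \<longrightarrow> (\<exists>d\<in>{-2..2}. N dvd (i - j - d)))"

lemma tile_cycle_per:
  assumes "tile_cycle N p" "N dvd (i - j)" shows "p i = p j"
proof -
  have nat: "p (i + int k * N) = p i" for i k
  proof (induction k)
    case (Suc k)
    have "p (i + int (Suc k) * N) = p ((i + int k * N) + N)" by (simp add: algebra_simps)
    also have "\<dots> = p (i + int k * N)" using assms(1) unfolding tile_cycle_def by blast
    finally show ?case using Suc by simp
  qed simp
  obtain t where t: "i - j = N * t" using assms(2) by (elim dvdE)
  show ?thesis
  proof (cases "t \<ge> 0")
    case True
    then have "i = j + int (nat t) * N" using t by (simp add: algebra_simps)
    then show ?thesis using nat by metis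
  next
    case False
    then have "j = i + int (nat (- t)) * N" using t by (simp add: algebra_simps)
    then show ?thesis using nat by metis
  qed
qed

lemma tile_cycle_adjacent: "tile_cycle N p \<Longrightarrow> adjacent (p i) (p (i + 1))"
  unfolding tile_cycle_def by blast

lemma tile_cycle_inj: "tile_cycle N p \<Longrightarrow> p i = p j \<Longrightarrow> N dvd (i - j)"
  unfolding tile_cycle_def by blast

lemma tile_cycle_near:
  assumes "tile_cycle N p" "near (p i) (p j)"
  shows "\<exists>d. -2 \<le> d \<and> d \<le> 2 \<and> p i = p (j + d)"
proof -
  obtain d where d: "d \<in> {-2..2}" "N dvd (i - j - d)" using assms unfolding tile_cycle_def by blast
  then have "p i = p (j + d)" using tile_cycle_per[OF assms(1), of i "j + d"] by (simp add: algebra_simps)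
  then show ?thesis using d by auto
qed

lemma adjacent_parity: "adjacent z z' \<Longrightarrow> even (fst z + snd z) \<longleftrightarrow> odd (fst z' + snd z')"
proof -
  assume "adjacent z z'"
  then have "fst z + snd z - (fst z' + snd z') = 1 \<or> fst z + snd z - (fst z' + snd z') = -1"
    unfolding adjacent_def by linarith
  then show ?thesis by presburger
qed

text \<open>Adjacent tiles are near each other, so their indices differ by at most two modulo N; the
  checkerboard colouring rules out the even differences.\<close>

lemma tile_cycle_nbr:
  assumes c: "tile_cycle N p" and a: "adjacent (p i) (p j)"
  shows "p j = p (i + 1) \<or> p j = p (i - 1)"
proof -
  have "near (p j) (p i)" using a unfolding adjacent_def near_def by linarith
  then obtain d where d: "-2 \<le> d" "d \<le> 2" "p j = p (i + d)" using tile_cycle_near[OF c] by blast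
  have s: "even (fst (p i) + snd (p i)) \<longleftrightarrow> even (fst (p (i + 2)) + snd (p (i + 2)))" for i
  proof -
    have "adjacent (p (i + 1)) (p (i + 2))" using tile_cycle_adjacent[OF c, of "i + 1"] by (simp add: add.assoc)
    from adjacent_parity[OF tile_cycle_adjacent[OF c, of i]] adjacent_parity[OF this] show ?thesis by blast
  qed
  have "d \<noteq> 0" using a d unfolding adjacent_def by auto
  moreover have "d \<noteq> 2" using adjacent_parity[OF a] s[of i] d(3) by auto
  moreover have "d \<noteq> -2" using adjacent_parity[OF a] s[of "i - 2"] d(3) by auto
  ultimately have "d = 1 \<or> d = -1" using d by auto
  then show ?thesis using d(3) by auto
qed

lemma tile_cycle_range:
  assumes "tile_cycle N p" shows "range p = p ` {0..<N}"
proof -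
  have "p i \<in> p ` {0..<N}" for i
  proof -
    have "N > 0" using assms unfolding tile_cycle_def by simp
    then have "i mod N \<in> {0..<N}" by simp
    moreover have "p i = p (i mod N)" by (rule tile_cycle_per[OF assms]) (simp add: mod_eq_dvd_iff)
    ultimately show ?thesis by blast
  qed
  then show ?thesis by auto
qed

text \<open>Every neighbour of a tile is its predecessor or successor. A diagonal contact has index
  difference two, and the tile in between is the common neighbour.\<close>

lemma tile_cycle_path_like:
  assumes c: "tile_cycle N p" shows "path_like (range p)"
proof -
  have two: "z1 = z2 \<or> z1 = z3 \<or> z2 = z3" if "z \<in> range p" "z1 \<in> range p" "z2 \<in> range p" "z3 \<in> range p"
    "adjacent z z1" "adjacent z z2" "adjacent z z3" for z z1 z2 z3
  proof -
    from that(1) obtain i where "z = p i" by (rule rangeE)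
    then have "z1 = p (i + 1) \<or> z1 = p (i - 1)" "z2 = p (i + 1) \<or> z2 = p (i - 1)" "z3 = p (i + 1) \<or> z3 = p (i - 1)"
      using that tile_cycle_nbr[OF c] by auto
    then show ?thesis by metis
  qed
  have diag: "\<exists>z\<in>range p. adjacent (p i) z \<and> adjacent z (p j)" if "near (p i) (p j)" "p i \<noteq> p j" "\<not> adjacent (p i) (p j)" for i j
  proof -
    have "near (p j) (p i)" using that(1) unfolding near_def by (simp add: abs_minus_commute)
    then obtain d where d: "-2 \<le> d" "d \<le> 2" "p j = p (i + d)" using tile_cycle_near[OF c] by blast
    have sym: "adjacent z z' \<Longrightarrow> adjacent z' z" for z z' unfolding adjacent_def by (simp add: abs_minus_commute)
    have "d \<noteq> 0" "d \<noteq> 1" "d \<noteq> -1" using that d tile_cycle_adjacent[OF c, of i] sym[OF tile_cycle_adjacent[OF c, of "i - 1"]] by auto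
    then have "d = 2 \<or> d = -2" using d by linarith
    then show ?thesis
    proof
      assume "d = 2" then show ?thesis using tile_cycle_adjacent[OF c, of i] tile_cycle_adjacent[OF c, of "i + 1"] d
        by (intro bexI[of _ "p (i + 1)"]) (auto simp: add.assoc)
    next
      assume "d = -2" then show ?thesis
        using sym[OF tile_cycle_adjacent[OF c, of "i - 1"]] sym[OF tile_cycle_adjacent[OF c, of "i - 2"]] d
        by (intro bexI[of _ "p (i - 1)"]) (auto simp: add.assoc)
    qed
  qed
  show ?thesis unfolding path_like_def
  proof (intro conjI ballI impI)
    show "finite (range p)" unfolding tile_cycle_range[OF c] by simp
    show "z1 = z2 \<or> z1 = z3 \<or> z2 = z3" if "z \<in> range p" "z1 \<in> range p" "z2 \<in> range p" "z3 \<in> range p"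
      "adjacent z z1 \<and> adjacent z z2 \<and> adjacent z z3" for z z1 z2 z3 using two that by blast
    show "\<exists>w\<in>range p. adjacent z w \<and> adjacent w z'" if "z \<in> range p" "z' \<in> range p" "near z z' \<and> z \<noteq> z' \<and> \<not> adjacent z z'" for z z'
      using diag that by (elim rangeE) simp
  qed
qed

section \<open>Sweeping along the path\<close>

text \<open>The state of the sweep before step k: in the one-cell margin around the tile
  \<open>p k\<close>, only that tile and the two tiles ahead may still carry nonzero height.\<close>

definition sweepable :: "int \<Rightarrow> int \<Rightarrow> (int \<Rightarrow> int \<times> int) \<Rightarrow> (int \<times> int \<Rightarrow> int) \<Rightarrow> int \<Rightarrow> bool" where
  "sweepable m n p c k \<longleftrightarrow> (\<forall>X Y. fst (p k) * m - 1 \<le> X \<longrightarrow> X \<le> fst (p k) * m + m \<longrightarrow>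
     snd (p k) * n - 1 \<le> Y \<longrightarrow> Y \<le> snd (p k) * n + n \<longrightarrow>
     (X div m, Y div n) \<notin> {p k, p (k + 1), p (k + 2)} \<longrightarrow> c (X, Y) = 0)"

definition zero_on :: "int \<Rightarrow> int \<Rightarrow> (int \<times> int \<Rightarrow> int) \<Rightarrow> int \<times> int \<Rightarrow> bool" where
  "zero_on m n c z \<longleftrightarrow> (\<forall>X Y. (X div m, Y div n) = z \<longrightarrow> c (X, Y) = 0)"

lemma tile_cycle_map:
  assumes c: "tile_cycle N p" and "\<And>z z'. adjacent (f z) (f z') \<longleftrightarrow> adjacent z z'" "\<And>z z'. near (f z) (f z') \<longleftrightarrow> near z z'"
    "inj f"
  shows "tile_cycle N (f \<circ> p)"
  using assms unfolding tile_cycle_def by (auto simp: inj_eq)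

lemma div_bounds:
  assumes "m > 0" "X div m = a" shows "a * m \<le> X \<and> X < a * m + (m::int)"
proof -
  have "X = a * m + X mod m" using div_mult_mod_eq[of X m] assms(2) by simp
  then show ?thesis using pos_mod_sign[OF assms(1), of X] pos_mod_bound[OF assms(1), of X] by linarith
qed

text \<open>The argument of \<open>sweep_right\<close> looks at the cells left of, above and below
  the tile. The next tile lies to the right, and the one after it has first coordinate at least 1
  because it cannot be the tile itself, so neither interferes.\<close>

lemma sweep_right_origin:
  assumes c: "tile_cycle N p" and m: "m > 0" "n > 0" and b: "disjoint_pair (dilated m n (range p)) u w c"
    and k: "p k = (0, 0)" "p (k + 1) = (1, 0)" and s: "sweepable m n p c k"
  shows "zero_on m n c (p k)"
proof -
  have "\<not> N dvd ((k + 2) - k)" using c unfolding tile_cycle_def by (auto dest: zdvd_imp_le)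
  then have "p (k + 2) \<noteq> (0, 0)" using tile_cycle_inj[OF c, of "k + 2" k] k by auto
  then have k2: "fst (p (k + 2)) \<ge> 1" using tile_cycle_adjacent[OF c, of "k + 1"] k
    unfolding adjacent_def by (cases "p (k + 2)") (auto simp: add.assoc)
  have P: "(0, 0) \<in> range p" "(1, 0) \<in> range p" using k by (metis rangeI)+
  have touch: "c (X, Y) = 0" if "-1 \<le> X" "X < m" "-1 \<le> Y" "Y \<le> n" "\<not> (0 \<le> X \<and> 0 \<le> Y \<and> Y < n)" for X Y
  proof -
    have d: "X div m \<le> 0" using div_le[of m X 0] m that by simp
    have "(X div m, Y div n) \<noteq> (0, 0)"
    proof
      assume "(X div m, Y div n) = (0, 0)"
      then show False using div_bounds[OF m(1), of X 0] div_bounds[OF m(2), of Y 0] that by auto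
    qed
    moreover have "(X div m, Y div n) \<noteq> p (k + 2)" using k2 d
      by (metis fst_conv not_one_le_zero order_trans)
    ultimately have "(X div m, Y div n) \<notin> {p k, p (k + 1), p (k + 2)}" using k d by auto
    then show ?thesis using s that unfolding sweepable_def k by auto
  qed
  show ?thesis unfolding zero_on_def k
  proof (intro allI impI)
    fix X Y assume "(X div m, Y div n) = (0, 0)"
    then have X: "0 \<le> X" "X < m" and Y: "0 \<le> Y" "Y < n"
      using div_bounds[OF m(1), of X 0] div_bounds[OF m(2), of Y 0] by auto
    then show "c (X, Y) = 0" using sweep_right[OF tile_cycle_path_like[OF c] m b P touch, of X] by auto
  qed
qed

lemma range_comp_shifted: "range ((\<lambda>(x, y). (x - a, y - b)) \<circ> p) = shifted a b (range p)"
  by (simp add: shifted_image image_comp)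

lemma range_comp_reflected: "range ((\<lambda>(x, y). (-1 - x, y)) \<circ> p) = reflected (range p)"
  by (simp add: reflected_image image_comp)

lemma range_comp_transposed: "range (prod.swap \<circ> p) = transposed (range p)"
  by (simp add: transposed_image image_comp)

lemma tile_cycle_shifted: "tile_cycle N p \<Longrightarrow> tile_cycle N ((\<lambda>(x, y). (x - a, y - b)) \<circ> p)"
  by (rule tile_cycle_map) (auto simp: adjacent_def near_def inj_def)

lemma tile_cycle_reflected: "tile_cycle N p \<Longrightarrow> tile_cycle N ((\<lambda>(x, y). (-1 - x, y)) \<circ> p)"
  by (rule tile_cycle_map) (auto simp: adjacent_def near_def inj_def)

lemma tile_cycle_transposed: "tile_cycle N p \<Longrightarrow> tile_cycle N (prod.swap \<circ> p)"
  by (rule tile_cycle_map) (auto simp: adjacent_def near_def)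

lemma sweep_r:
  assumes c: "tile_cycle N p" and m: "m > 0" "n > 0" and b: "disjoint_pair (dilated m n (range p)) u w c"
    and k: "p (k + 1) = (fst (p k) + 1, snd (p k))" and s: "sweepable m n p c k"
  shows "zero_on m n c (p k)"
proof -
  obtain a b' where ab: "p k = (a, b')" by force
  let ?f = "\<lambda>(x, y). (x - a, y - b')"
  let ?c = "\<lambda>(x, y). c (x + a * m, y + b' * n)"
  have z: "(X div m, Y div n) = ?f z \<longleftrightarrow> ((X + a * m) div m, (Y + b' * n) div n) = z" for X Y z
    using m by (cases z) auto
  have "sweepable m n (?f \<circ> p) ?c k"
    unfolding sweepable_def
  proof (intro allI impI)
    fix X Y assume h: "fst ((?f \<circ> p) k) * m - 1 \<le> X" "X \<le> fst ((?f \<circ> p) k) * m + m"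
       "snd ((?f \<circ> p) k) * n - 1 \<le> Y" "Y \<le> snd ((?f \<circ> p) k) * n + n"
       "(X div m, Y div n) \<notin> {(?f \<circ> p) k, (?f \<circ> p) (k + 1), (?f \<circ> p) (k + 2)}"
    have "((X + a * m) div m, (Y + b' * n) div n) \<notin> {p k, p (k + 1), p (k + 2)}"
      using h(5) by (simp add: z)
    then have "c (X + a * m, Y + b' * n) = 0"
      using s h(1-4) unfolding sweepable_def by (auto simp: ab)
    then show "?c (X, Y) = 0" by simp
  qed
  moreover have "disjoint_pair (dilated m n (range (?f \<circ> p))) (image_mset (\<lambda>(x, y). (x - a * m, y - b' * n)) u)
      (image_mset (\<lambda>(x, y). (x - a * m, y - b' * n)) w) ?c"
    using disjoint_pair_shifted[OF b, of "a * m" "b' * n"] unfolding range_comp_shifted dilated_shifted[OF m] by simp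
  ultimately have "zero_on m n ?c ((?f \<circ> p) k)"
    using sweep_right_origin[OF tile_cycle_shifted[OF c] m, of a b' _ _ ?c k] k ab by auto
  then have "c (X + a * m, Y + b' * n) = 0" if "((X + a * m) div m, (Y + b' * n) div n) = p k" for X Y
    using that unfolding zero_on_def comp_def z by simp
  from this[of "X - a * m" "Y - b' * n" for X Y] show ?thesis unfolding zero_on_def by simp
qed

lemma sweep_l:
  assumes c: "tile_cycle N p" and m: "m > 0" "n > 0" and b: "disjoint_pair (dilated m n (range p)) u w c"
    and k: "p (k + 1) = (fst (p k) - 1, snd (p k))" and s: "sweepable m n p c k"
  shows "zero_on m n c (p k)"
proof -
  obtain a b' where ab: "p k = (a, b')" by force
  let ?f = "\<lambda>(x, y). (-1 - x, y) :: int \<times> int"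
  let ?c = "\<lambda>(x, y). - c (-1 - x, y)"
  have z: "(X div m, Y div n) = ?f z \<longleftrightarrow> ((-1 - X) div m, Y div n) = z" for X Y z
    using neg_div[OF m(1), of X] by (cases z) auto
  have "sweepable m n (?f \<circ> p) ?c k"
    unfolding sweepable_def
  proof (intro allI impI)
    fix X Y assume h: "fst ((?f \<circ> p) k) * m - 1 \<le> X" "X \<le> fst ((?f \<circ> p) k) * m + m"
       "snd ((?f \<circ> p) k) * n - 1 \<le> Y" "Y \<le> snd ((?f \<circ> p) k) * n + n"
       "(X div m, Y div n) \<notin> {(?f \<circ> p) k, (?f \<circ> p) (k + 1), (?f \<circ> p) (k + 2)}"
    have "((-1 - X) div m, Y div n) \<notin> {p k, p (k + 1), p (k + 2)}"
      using h(5) by (simp add: z)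
    then have "c (-1 - X, Y) = 0"
      using s h(1-4) unfolding sweepable_def by (auto simp: ab left_diff_distrib)
    then show "?c (X, Y) = 0" by simp
  qed
  moreover have "disjoint_pair (dilated m n (range (?f \<circ> p))) (image_mset (\<lambda>(x, y). (- x, y)) u)
      (image_mset (\<lambda>(x, y). (- x, y)) w) ?c"
    using disjoint_pair_reflected[OF b] unfolding range_comp_reflected dilated_reflected[OF m(1)] .
  ultimately have "zero_on m n ?c ((?f \<circ> p) k)"
    using sweep_r[OF tile_cycle_reflected[OF c] m, of _ _ ?c k] k ab by auto
  then have "c (-1 - X, Y) = 0" if "((-1 - X) div m, Y div n) = p k" for X Y
    using that unfolding zero_on_def comp_def z by auto
  from this[of "-1 - X" for X] show ?thesis unfolding zero_on_def by simp
qed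

lemma sweep_transposed:
  assumes b: "disjoint_pair (dilated m n (range p)) u w c"
  shows "disjoint_pair (dilated n m (range (prod.swap \<circ> p))) (image_mset prod.swap u) (image_mset prod.swap w) (c \<circ> prod.swap)"
    and "sweepable m n p c k \<Longrightarrow> sweepable n m (prod.swap \<circ> p) (c \<circ> prod.swap) k"
    and "zero_on n m (c \<circ> prod.swap) ((prod.swap \<circ> p) k) \<Longrightarrow> zero_on m n c (p k)"
proof -
  show "disjoint_pair (dilated n m (range (prod.swap \<circ> p))) (image_mset prod.swap u) (image_mset prod.swap w) (c \<circ> prod.swap)"
    using disjoint_pair_transposed[OF b] unfolding range_comp_transposed dilated_transposed .
  have z: "(Y div n, X div m) = prod.swap z \<longleftrightarrow> (X div m, Y div n) = z" for X Y z
    by (cases z) auto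
  show "sweepable m n p c k \<Longrightarrow> sweepable n m (prod.swap \<circ> p) (c \<circ> prod.swap) k"
    unfolding sweepable_def by (auto simp: z)
  show "zero_on n m (c \<circ> prod.swap) ((prod.swap \<circ> p) k) \<Longrightarrow> zero_on m n c (p k)"
    unfolding zero_on_def comp_def z by auto
qed

text \<open>The position of the next tile is one of four; reflection and transposition reduce them
  to the tile on the right.\<close>

lemma sweep:
  assumes c: "tile_cycle N p" and m: "m > 0" "n > 0" and b: "disjoint_pair (dilated m n (range p)) u w c"
    and s: "sweepable m n p c k"
  shows "zero_on m n c (p k)"
proof -
  obtain x y where xy: "p k = (x, y)" by force
  obtain x' y' where xy': "p (k + 1) = (x', y')" by force
  have "\<bar>x - x'\<bar> + \<bar>y - y'\<bar> = 1" using tile_cycle_adjacent[OF c, of k] by (simp add: adjacent_def xy xy')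
  then consider "x' = x + 1" "y' = y" | "x' = x - 1" "y' = y" | "x' = x" "y' = y + 1" | "x' = x" "y' = y - 1"
    by linarith
  then show ?thesis
  proof cases
    case 1 then show ?thesis using sweep_r[OF c m b _ s] xy xy' by simp
  next
    case 2 then show ?thesis using sweep_l[OF c m b _ s] xy xy' by simp
  next
    case 3
    show ?thesis
      by (rule sweep_transposed(3)[OF b], rule sweep_r[OF tile_cycle_transposed[OF c] m(2,1) sweep_transposed(1)[OF b] _ sweep_transposed(2)[OF b s]])
         (use 3 xy xy' in simp)
  next
    case 4
    show ?thesis
      by (rule sweep_transposed(3)[OF b], rule sweep_l[OF tile_cycle_transposed[OF c] m(2,1) sweep_transposed(1)[OF b] _ sweep_transposed(2)[OF b s]])
         (use 4 xy xy' in simp)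
  qed
qed

section \<open>Vanishing of the height along the whole cycle\<close>

definition no_disjoint_pair :: "(int \<times> int) set \<Rightarrow> bool" where
  "no_disjoint_pair P \<longleftrightarrow> (\<forall>m n u w c. m > 0 \<longrightarrow> n > 0 \<longrightarrow> disjoint_pair (dilated m n P) u w c \<longrightarrow> u = {#})"

text \<open>Strong induction along the path, starting at the turn. A tile near p (k + j) has an
  index within two of k + j, so apart from the two tiles ahead only the two behind matter, and these
  are already cleared. One full period reaches every tile.\<close>

theorem good_corner_no_disjoint_pair:
  assumes c: "tile_cycle N p" and g: "good_corner (range p)"
    and k: "p k = (0, 0)" "p (k - 1) = (-1, 0)" "p (k + 1) = (0, 1)"
  shows "no_disjoint_pair (range p)"
  unfolding no_disjoint_pair_def
proof (intro allI impI)
  fix m n u w c' assume m: "(m::int) > 0" "(n::int) > 0" and b: "disjoint_pair (dilated m n (range p)) u w c'"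
  note tz = good_corner_turn_zero[OF tile_cycle_path_like[OF c] m b g]
  have z: "zero_on m n c' (p (k + int j))" for j
  proof (induction j rule: less_induct)
    case (less j)
    show ?case
    proof (cases j)
      case 0
      show ?thesis unfolding zero_on_def 0
      proof (intro allI impI)
        fix X Y assume "(X div m, Y div n) = p (k + int 0)"
        then have "0 \<le> X" "X < m" "0 \<le> Y" "Y < n"
          using div_bounds[OF m(1), of X 0] div_bounds[OF m(2), of Y 0] k by auto
        then show "c' (X, Y) = 0" using tz[of X Y] by simp
      qed
    next
      case (Suc j')
      have "sweepable m n p c' (k + int j)" unfolding sweepable_def
      proof (intro allI impI)
        fix X Y
        let ?z = "(X div m, Y div n)" and ?t = "p (k + int j)"
        assume h: "fst ?t * m - 1 \<le> X" "X \<le> fst ?t * m + m" "snd ?t * n - 1 \<le> Y" "Y \<le> snd ?t * n + n"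
          "?z \<notin> {?t, p (k + int j + 1), p (k + int j + 2)}"
        show "c' (X, Y) = 0"
        proof (cases "?z \<in> range p")
          case False
          then have "(X, Y) \<notin> dilated m n (range p)" by (simp add: dilated_def)
          then show ?thesis using is_height_zero[OF disjoint_pair_is_height[OF b]] by blast
        next
          case True
          then obtain i where i: "p i = ?z" by (metis imageE)
          have "fst ?t - 1 \<le> X div m" "X div m \<le> fst ?t + 1" "snd ?t - 1 \<le> Y div n" "Y div n \<le> snd ?t + 1"
            using h(1-4) m by (auto intro!: div_ge div_le simp: left_diff_distrib distrib_right)
          then have "near (p i) ?t" unfolding i near_def by auto
          then obtain d where d: "-2 \<le> d" "d \<le> 2" "?z = p (k + int j + d)" using tile_cycle_near[OF c] i by metis
          have "d \<noteq> 0" "d \<noteq> 1" "d \<noteq> 2" using h(5) d(3) by auto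
          then have "d = -1 \<or> d = -2 \<and> j' > 0 \<or> d = -2 \<and> j' = 0" using d(1,2) by linarith
          then show ?thesis
          proof (elim disjE conjE)
            assume "d = -1"
            then have "?z = p (k + int j')" using d(3) Suc by simp
            then show ?thesis using less[of j'] Suc unfolding zero_on_def by auto
          next
            assume "d = -2" "j' > 0"
            then have "?z = p (k + int (j' - 1))" using d(3) Suc by (simp add: of_nat_diff algebra_simps)
            then show ?thesis using less[of "j' - 1"] Suc unfolding zero_on_def by auto
          next
            \<comment> \<open>The tile before the turn has not been cleared. It meets the margin
              around the tile (0, 1) only in its last column, where the corner argument gives
              zero.\<close>
            assume "d = -2" "j' = 0"
            then have z: "?z = (-1, 0)" and t: "?t = (0, 1)" using d(3) Suc k by (simp_all add: add.commute)
            then have "X < 0" "0 \<le> Y" "Y < n"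
              using div_bounds[OF m(1), of X "-1"] div_bounds[OF m(2), of Y 0] by auto
            moreover have "-1 \<le> X" using h(1) t by simp
            ultimately show ?thesis using tz[of X Y] m by simp
          qed
        qed
      qed
      then show ?thesis by (rule sweep[OF c m b])
    qed
  qed
  have "c' x = 0" for x
  proof -
    obtain X Y where x: "x = (X, Y)" by force
    show ?thesis
    proof (cases "(X div m, Y div n) \<in> range p")
      case False
      then have "x \<notin> dilated m n (range p)" by (simp add: dilated_def x)
      then show ?thesis using is_height_zero[OF disjoint_pair_is_height[OF b]] by blast
    next
      case True
      then obtain i where i: "p i = (X div m, Y div n)" by (metis imageE)
      have N: "N > 0" using c unfolding tile_cycle_def by simp
      have "p i = p (k + int (nat ((i - k) mod N)))"
        using N by (intro tile_cycle_per[OF c]) (simp add: mod_eq_dvd_iff[symmetric] mod_simps)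
      then have "(X div m, Y div n) = p (k + int (nat ((i - k) mod N)))" using i by simp
      then show ?thesis using z[of "nat ((i - k) mod N)"] unfolding zero_on_def x by blast
    qed
  qed
  then show "u = {#}" using disjoint_pair_0[OF b] by blast
qed

section \<open>Invariance under the symmetries of the lattice\<close>

lemma no_disjoint_pair_transposed: assumes "no_disjoint_pair (transposed P)" shows "no_disjoint_pair P"
  unfolding no_disjoint_pair_def
proof (intro allI impI)
  fix m n u w c assume "(m::int) > 0" "(n::int) > 0" "disjoint_pair (dilated m n P) u w c"
  then show "u = {#}" using disjoint_pair_transposed[of "dilated m n P" u w c] assms unfolding no_disjoint_pair_def dilated_transposed[symmetric]
    by (metis image_mset_is_empty_iff)
qed

lemma no_disjoint_pair_reflected: assumes "no_disjoint_pair (reflected P)" shows "no_disjoint_pair P"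
  unfolding no_disjoint_pair_def
proof (intro allI impI)
  fix m n u w c assume m: "(m::int) > 0" "(n::int) > 0" "disjoint_pair (dilated m n P) u w c"
  then show "u = {#}" using disjoint_pair_reflected[of "dilated m n P" u w c] assms unfolding no_disjoint_pair_def dilated_reflected[OF m(1), symmetric]
    by (metis image_mset_is_empty_iff)
qed

lemma no_disjoint_pair_shifted: assumes "no_disjoint_pair (shifted a b P)" shows "no_disjoint_pair P"
  unfolding no_disjoint_pair_def
proof (intro allI impI)
  fix m n u w c assume m: "(m::int) > 0" "(n::int) > 0" "disjoint_pair (dilated m n P) u w c"
  then show "u = {#}" using disjoint_pair_shifted[of "dilated m n P" u w c "a * m" "b * n"] assms
    unfolding no_disjoint_pair_def dilated_shifted[OF m(1,2), symmetric]
    by (metis image_mset_is_empty_iff)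
qed

section \<open>Ends of blocks\<close>

text \<open>Coordinates of a tile relative to the tile (x0, y0), with the axes possibly exchanged
  (\<open>s\<close>) and reversed (\<open>e\<close>, \<open>d\<close>): the eight symmetries of the
  square, used to bring a block end into normal position.\<close>

definition frame :: "bool \<Rightarrow> int \<Rightarrow> int \<Rightarrow> int \<Rightarrow> int \<Rightarrow> int \<times> int \<Rightarrow> int \<times> int" where
  "frame s e d x0 y0 = (\<lambda>(x, y). if s then (e * (y - y0), d * (x - x0)) else (e * (x - x0), d * (y - y0)))"

definition sign_pair :: "int \<Rightarrow> int \<Rightarrow> bool" where
  "sign_pair e d \<longleftrightarrow> (e = 1 \<or> e = -1) \<and> (d = 1 \<or> d = -1)"

lemma frame_eq: "sign_pair e d \<Longrightarrow> frame s e d x0 y0 z = (a, b) \<longleftrightarrow>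
    z = (if s then (x0 + d * b, y0 + e * a) else (x0 + e * a, y0 + d * b))"
  unfolding sign_pair_def frame_def by (cases z; cases s) auto

lemma tile_cycle_frame:
  assumes "sign_pair e d" "tile_cycle N p" shows "tile_cycle N (frame s e d x0 y0 \<circ> p)"
proof (rule tile_cycle_map[OF assms(2)])
  show "inj (frame s e d x0 y0)" using assms(1) unfolding inj_def frame_def sign_pair_def by (cases s) auto
  fix z z' :: "int \<times> int"
  obtain a b a' b' where z: "z = (a, b)" "z' = (a', b')" by force
  have "\<bar>e * x - e * y\<bar> = \<bar>x - y\<bar>" "\<bar>d * x - d * y\<bar> = \<bar>x - y\<bar>" for x y
    using assms(1) unfolding sign_pair_def by (auto simp: abs_minus_commute)
  then have "\<bar>e * (x - w) - e * (y - w)\<bar> = \<bar>x - y\<bar>" "\<bar>d * (x - w) - d * (y - w)\<bar> = \<bar>x - y\<bar>" for x y w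
    by simp_all
  note r = this
  show "adjacent (frame s e d x0 y0 z) (frame s e d x0 y0 z') \<longleftrightarrow> adjacent z z'"
    unfolding adjacent_def frame_def z by (simp add: r add.commute)
  show "near (frame s e d x0 y0 z) (frame s e d x0 y0 z') \<longleftrightarrow> near z z'"
    unfolding near_def frame_def z by (auto simp: r)
qed

lemma no_disjoint_pair_frame_r:
  assumes "sign_pair e d" "no_disjoint_pair (range (frame False e d x0 y0 \<circ> p))" shows "no_disjoint_pair (range p)"
proof -
  have r: "range (frame False e d x0 y0 \<circ> p) = {(x, y). (x0 + e * x, y0 + d * y) \<in> range p}"
  proof -
    have "(a, b) \<in> range (frame False e d x0 y0 \<circ> p) \<longleftrightarrow> (x0 + e * a, y0 + d * b) \<in> range p" for a b
    proof -
      have "(a, b) \<in> range (frame False e d x0 y0 \<circ> p) \<longleftrightarrow> (\<exists>i. frame False e d x0 y0 (p i) = (a, b))"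
        by (auto simp: image_iff eq_commute)
      also have "\<dots> \<longleftrightarrow> (\<exists>i. p i = (x0 + e * a, y0 + d * b))" by (simp add: frame_eq[OF assms(1)])
      also have "\<dots> \<longleftrightarrow> (x0 + e * a, y0 + d * b) \<in> range p" by (auto simp: image_iff eq_commute)
      finally show ?thesis .
    qed
    then show ?thesis by auto
  qed
  have e: "e = 1 \<or> e = -1" and d: "d = 1 \<or> d = -1" using assms(1) unfolding sign_pair_def by auto
  define R where "R = range p"
  have R1: "no_disjoint_pair {(x, y). (x0 + e * x, y) \<in> R}" if "no_disjoint_pair {(x, y). (x0 + e * x, y0 + d * y) \<in> R}"
    using d
  proof
    assume "d = 1"
    then have "{(x, y). (x0 + e * x, y0 + d * y) \<in> R} = shifted 0 y0 {(x, y). (x0 + e * x, y) \<in> R}"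
      by (auto simp: shifted_def add.commute)
    then show ?thesis using that no_disjoint_pair_shifted by metis
  next
    assume "d = -1"
    \<comment> \<open>The additional shift by one compensates for \<open>reflected\<close> sending
      the tile x to -1 - x instead of -x.\<close>
    then have "{(x, y). (x0 + e * x, y0 + d * y) \<in> R} =
        transposed (reflected (transposed (shifted 0 (y0 + 1) {(x, y). (x0 + e * x, y) \<in> R})))"
      by (auto simp: algebra_simps)
    then show ?thesis using that no_disjoint_pair_shifted no_disjoint_pair_transposed no_disjoint_pair_reflected by metis
  qed
  have R2: "no_disjoint_pair R" if "no_disjoint_pair {(x, y). (x0 + e * x, y) \<in> R}"
    using e
  proof
    assume "e = 1"
    then have "{(x, y). (x0 + e * x, y) \<in> R} = shifted x0 0 R"
      by (auto simp: shifted_def add.commute)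
    then show ?thesis using that no_disjoint_pair_shifted by metis
  next
    assume "e = -1"
    then have "{(x, y). (x0 + e * x, y) \<in> R} = reflected (shifted (x0 + 1) 0 R)"
      by (auto simp: algebra_simps)
    then show ?thesis using that no_disjoint_pair_shifted no_disjoint_pair_transposed no_disjoint_pair_reflected by metis
  qed
  show ?thesis using R1 R2 assms(2) unfolding r R_def by blast
qed

lemma no_disjoint_pair_frame:
  assumes "sign_pair e d" "no_disjoint_pair (range (frame s e d x0 y0 \<circ> p))" shows "no_disjoint_pair (range p)"
proof (cases s)
  case False then show ?thesis using assms no_disjoint_pair_frame_r by simp
next
  case True
  have "frame s e d x0 y0 \<circ> p = frame False e d y0 x0 \<circ> (prod.swap \<circ> p)"
    using True by (auto simp: frame_def split: prod.splits)
  then have "no_disjoint_pair (range (prod.swap \<circ> p))" using assms no_disjoint_pair_frame_r by metis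
  then show ?thesis unfolding range_comp_transposed by (rule no_disjoint_pair_transposed)
qed

definition normal_end :: "(int \<Rightarrow> int \<times> int) \<Rightarrow> int \<Rightarrow> bool" where
  "normal_end q k \<longleftrightarrow> q (k - 2) = (-2, 0) \<and> q (k - 1) = (-1, 0) \<and> q k = (0, 0) \<and> q (k + 1) = (0, 1)"

text \<open>The ordered form of \<open>good_corner\<close>: it prescribes the actual predecessors
  and successors of the end, not merely the presence of tiles on the path.\<close>

definition normal_good :: "(int \<Rightarrow> int \<times> int) \<Rightarrow> int \<Rightarrow> bool" where
  "normal_good q k \<longleftrightarrow> normal_end q k \<and> (q (k + 2) = (0, 2) \<or> q (k + 2) = (1, 1) \<and>
     (q (k + 3) = (1, 2) \<and> q (k + 4) = (2, 2) \<or>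
      (\<exists>l\<ge>2. (\<forall>i. 0 \<le> i \<longrightarrow> i \<le> l \<longrightarrow> q (k - i) = (- i, 0)) \<and> q (k - l - 1) = (- l, -1) \<and>
        (q (k + 3) = (2, 1) \<or> q (k + 3) = (1, 2) \<and> q (k + 4) = (1, 3)))))"

lemma normal_good_no_disjoint_pair:
  assumes c: "tile_cycle N q" and g: "normal_good q k" shows "no_disjoint_pair (range q)"
proof (rule good_corner_no_disjoint_pair[OF c])
  have R: "q i = z \<Longrightarrow> z \<in> range q" for i z by blast
  have e: "normal_end q k" using g unfolding normal_good_def by blast
  show "q k = (0, 0)" "q (k - 1) = (-1, 0)" "q (k + 1) = (0, 1)" using e unfolding normal_end_def by auto
  have b: "(-2, 0) \<in> range q" "(-1, 0) \<in> range q" "(0, 0) \<in> range q" "(0, 1) \<in> range q"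
    using e R unfolding normal_end_def by metis+
  have l: "\<exists>f. f + 2 \<le> 0 \<and> (\<forall>i. f \<le> i \<longrightarrow> i \<le> 0 \<longrightarrow> (i, 0) \<in> range q) \<and> (f, -1) \<in> range q"
    if "l \<ge> 2" "\<And>i. 0 \<le> i \<Longrightarrow> i \<le> l \<Longrightarrow> q (k - i) = (- i, 0)" "q (k - l - 1) = (- l, -1)" for l
  proof (intro exI[of _ "-l"] conjI allI impI)
    show "-l + 2 \<le> 0" using that by simp
    show "(- l, - 1) \<in> range q" using that(3) R by metis
    fix i assume "-l \<le> i" "i \<le> 0"
    then have "q (k - (- i)) = (- (- i), 0)" by (intro that(2)) auto
    from R[OF this] show "(i, 0) \<in> range q" by simp
  qed
  from g consider "q (k + 2) = (0, 2)" | "q (k + 2) = (1, 1)" "q (k + 3) = (1, 2)" "q (k + 4) = (2, 2)" |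
    l where "q (k + 2) = (1, 1)" "l\<ge>2" "\<And>i. 0 \<le> i \<Longrightarrow> i \<le> l \<Longrightarrow> q (k - i) = (- i, 0)" "q (k - l - 1) = (- l, -1)"
      "q (k + 3) = (2, 1) \<or> q (k + 3) = (1, 2) \<and> q (k + 4) = (1, 3)"
    unfolding normal_good_def by blast
  then show "good_corner (range q)"
  proof cases
    case 1 then show ?thesis using b R[OF 1] unfolding good_corner_def by blast
  next
    case 2 then show ?thesis using b R[OF 2(1)] R[OF 2(2)] R[OF 2(3)] unfolding good_corner_def by blast
  next
    case (3 l)
    have "(2, 1) \<in> range q \<or> (1, 2) \<in> range q \<and> (1, 3) \<in> range q" using 3(5) R by blast
    then show ?thesis using b R[OF 3(1)] l[OF 3(2-4)] unfolding good_corner_def by blast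
  qed
qed

text \<open>All eight frames are tried at every index, but none of them reverses the sequence, so
  only ends in the direction of travel are tested.\<close>

definition no_good_end :: "(int \<Rightarrow> int \<times> int) \<Rightarrow> bool" where
  "no_good_end p \<longleftrightarrow> (\<forall>s e d x0 y0 k. sign_pair e d \<longrightarrow> \<not> normal_good (frame s e d x0 y0 \<circ> p) k)"

lemma no_disjoint_pair_if_good_end: "tile_cycle N p \<Longrightarrow> \<not> no_good_end p \<Longrightarrow> no_disjoint_pair (range p)"
  unfolding no_good_end_def using normal_good_no_disjoint_pair[OF tile_cycle_frame] no_disjoint_pair_frame by metis

lemma frame_frame:
  assumes "sign_pair e d" "sign_pair e' d'"
  shows "\<exists>s'' e'' d'' x'' y''. sign_pair e'' d'' \<and> frame s e d x0 y0 \<circ> frame s' e' d' x1 y1 = frame s'' e'' d'' x'' y''"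
proof (cases s)
  case True
  have eq: "frame s e d x0 y0 \<circ> frame s' e' d' x1 y1 = frame (\<not> s') (e * d') (d * e')
     (if s' then x1 + d' * y0 else x1 + e' * x0) (if s' then y1 + e' * x0 else y1 + d' * y0)"
    using assms True unfolding frame_def sign_pair_def by (auto simp: fun_eq_iff algebra_simps)
  have sg: "sign_pair (e * d') (d * e')" using assms unfolding sign_pair_def by auto
  show ?thesis by (intro exI conjI, fact sg, fact eq)
next
  case False
  have eq: "frame s e d x0 y0 \<circ> frame s' e' d' x1 y1 = frame s' (e * e') (d * d')
     (if s' then x1 + d' * y0 else x1 + e' * x0) (if s' then y1 + e' * x0 else y1 + d' * y0)"
    using assms False unfolding frame_def sign_pair_def by (auto simp: fun_eq_iff algebra_simps)
  have sg: "sign_pair (e * e') (d * d')" using assms unfolding sign_pair_def by auto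
  show ?thesis by (intro exI conjI, fact sg, fact eq)
qed

lemma no_good_end_frame:
  assumes "no_good_end p" "sign_pair e d" shows "no_good_end (frame s e d x0 y0 \<circ> p)"
  unfolding no_good_end_def
proof (intro allI impI)
  fix s' e' d' x1 y1 k assume "sign_pair e' d'"
  then obtain s'' e'' d'' x'' y'' where "sign_pair e'' d''"
    "frame s' e' d' x1 y1 \<circ> frame s e d x0 y0 = frame s'' e'' d'' x'' y''" using frame_frame[OF _ assms(2)] by metis
  then show "\<not> normal_good (frame s' e' d' x1 y1 \<circ> (frame s e d x0 y0 \<circ> p)) k"
    using assms(1) unfolding no_good_end_def comp_assoc[symmetric] by metis
qed

lemma frame_id: "frame False 1 1 0 0 \<circ> p = p" "sign_pair 1 1"
  by (auto simp: frame_def sign_pair_def fun_eq_iff)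

lemma no_good_end_normal: "no_good_end p \<Longrightarrow> \<not> normal_good p k"
  using frame_id(1)[of p] frame_id(2) unfolding no_good_end_def by metis

lemma tile_cycle_step:
  assumes "tile_cycle N q" "q i = (x, y)" "j = i + 1"
  shows "q j = (x + 1, y) \<or> q j = (x - 1, y) \<or> q j = (x, y + 1) \<or> q j = (x, y - 1)"
  using adjacent_cases[of x y "q (i + 1)"] tile_cycle_adjacent[OF assms(1), of i] assms(2,3) by simp

lemma tile_cycle_neq:
  assumes "tile_cycle N q" "i < j" "j < i + N" shows "q i \<noteq> q j"
proof
  assume "q i = q j"
  then have "N dvd (j - i)" using tile_cycle_inj[OF assms(1), of j i] by simp
  then show False using assms(2,3) zdvd_imp_le[of N "j - i"] by simp
qed

lemma tile_cycle_N: "tile_cycle N q \<Longrightarrow> N > 5" unfolding tile_cycle_def by blast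

text \<open>Adjacent tiles are consecutive, and N > 5 keeps i + 3 different from i + 1 and i - 1
  modulo N. Used to exclude that the path turns back beside itself.\<close>

lemma tile_cycle_no3:
  assumes c: "tile_cycle N q" and "j = i + 3" shows "\<not> adjacent (q i) (q j)"
proof
  assume "adjacent (q i) (q j)"
  from tile_cycle_nbr[OF c this] show False
    using tile_cycle_neq[OF c, of "i + 1" j] tile_cycle_neq[OF c, of "i - 1" j] tile_cycle_N[OF c] assms(2) by auto
qed

text \<open>A bad end leaves few continuations: going on upwards is an L-configuration, the other
  steps revisit a tile or touch the one three indices earlier, and turning right again at (1, 2)
  gives a ladder. With a Z-shaped incoming block the two continuations that remain would be good as
  well.\<close>

lemma normal_end_ext:
  assumes c: "tile_cycle N q" and e: "normal_end q k" and b: "\<not> normal_good q k"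
  shows "q (k + 2) = (1, 1)" and "q (k + 3) = (2, 1) \<or> q (k + 3) = (1, 2) \<and> q (k + 4) = (1, 3)"
   and "\<lbrakk>l \<ge> 2; \<And>i. 0 \<le> i \<Longrightarrow> i \<le> l \<Longrightarrow> q (k - i) = (- i, 0); q (k - l - 1) = (- l, -1)\<rbrakk> \<Longrightarrow> False"
proof -
  note N = tile_cycle_N[OF c]
  have q: "q (k - 2) = (-2, 0)" "q (k - 1) = (-1, 0)" "q k = (0, 0)" "q (k + 1) = (0, 1)"
    using e unfolding normal_end_def by auto
  have "q (k + 2) \<noteq> (0, 2)" using b e unfolding normal_good_def by blast
  moreover have "q (k + 2) \<noteq> (0, 0)" using tile_cycle_neq[OF c, of k "k + 2"] N q by auto
  moreover have "q (k + 2) \<noteq> (-1, 1)" using tile_cycle_no3[OF c, of "k + 2" "k - 1"] q by (auto simp: adjacent_def)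
  ultimately show 2: "q (k + 2) = (1, 1)" using tile_cycle_step[OF c q(4), of "k + 2"] by auto
  have "q (k + 3) \<noteq> (0, 1)" using tile_cycle_neq[OF c, of "k + 1" "k + 3"] N q by auto
  moreover have "q (k + 3) \<noteq> (1, 0)" using tile_cycle_no3[OF c, of "k + 3" k] q by (auto simp: adjacent_def)
  ultimately have 3: "q (k + 3) = (2, 1) \<or> q (k + 3) = (1, 2)" using tile_cycle_step[OF c 2, of "k + 3"] by auto
  show 4: "q (k + 3) = (2, 1) \<or> q (k + 3) = (1, 2) \<and> q (k + 4) = (1, 3)"
  proof (cases "q (k + 3) = (2, 1)")
    case False
    then have q3: "q (k + 3) = (1, 2)" using 3 by simp
    have "q (k + 4) \<noteq> (2, 2)" using b e 2 q3 unfolding normal_good_def by blast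
    moreover have "q (k + 4) \<noteq> (1, 1)" using tile_cycle_neq[OF c, of "k + 2" "k + 4"] N 2 by auto
    moreover have "q (k + 4) \<noteq> (0, 2)" using tile_cycle_no3[OF c, of "k + 4" "k + 1"] q by (auto simp: adjacent_def)
    ultimately show ?thesis using tile_cycle_step[OF c q3, of "k + 4"] q3 by auto
  qed simp
  show "\<lbrakk>l \<ge> 2; \<And>i. 0 \<le> i \<Longrightarrow> i \<le> l \<Longrightarrow> q (k - i) = (- i, 0); q (k - l - 1) = (- l, -1)\<rbrakk> \<Longrightarrow> False"
    using b e 2 4 unfolding normal_good_def by blast
qed

text \<open>Leaving upwards would make the block Z-shaped, and its end good.\<close>

lemma long_block_turn:
  assumes c: "tile_cycle N q" and b: "no_good_end q"
    and q: "q (s - 1) = (0, -1)" "q s = (0, 0)" "q (s + 1) = (1, 0)" "q (s + 2) = (2, 0)"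
  shows "\<exists>L\<ge>2. (\<forall>i. 0 \<le> i \<longrightarrow> i \<le> L \<longrightarrow> q (s + i) = (i, 0)) \<and> q (s + L + 1) = (L, -1) \<and>
    q (s + L + 2) = (L + 1, -1)"
proof -
  define S where "S = {L. 2 \<le> L \<and> (\<forall>i. 0 \<le> i \<longrightarrow> i \<le> L \<longrightarrow> q (s + i) = (i, 0))}"
  have "q (s + N) = (0, 0)" using tile_cycle_per[OF c, of "s + N" s] q by simp
  \<comment> \<open>A straight run of length N would be at (N, 0) for the index s + N, where the
    sequence is back at (0, 0).\<close>
  then have "L < N" if "L \<in> S" for L
  proof -
    have "q (s + N) = (N, 0)" if "N \<le> L"
      using \<open>L \<in> S\<close> tile_cycle_N[OF c] that unfolding S_def by simp
    then show ?thesis using \<open>q (s + N) = (0, 0)\<close> tile_cycle_N[OF c] by (cases "N \<le> L") auto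
  qed
  then have "S \<subseteq> {2..N}" unfolding S_def by force
  then have fin: "finite S" using finite_subset by blast
  have "q (s + i) = (i, 0)" if "0 \<le> i" "i \<le> 2" for i
  proof -
    have "i = 0 \<or> i = 1 \<or> i = 2" using that by auto
    then show ?thesis using q by (elim disjE) simp_all
  qed
  then have "2 \<in> S" unfolding S_def by simp
  then have M: "Max S \<in> S" using fin Max_in by blast
  define L where "L = Max S"
  have "L \<in> S" using M L_def by simp
  then have L: "2 \<le> L" "\<And>i. 0 \<le> i \<Longrightarrow> i \<le> L \<Longrightarrow> q (s + i) = (i, 0)" unfolding S_def by simp_all
  have "q (s + L + 1) \<noteq> (L + 1, 0)"
  proof
    assume a: "q (s + L + 1) = (L + 1, 0)"
    have "q (s + i) = (i, 0)" if "0 \<le> i" "i \<le> L + 1" for i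
      using L(2)[of i] a that by (cases "i = L + 1") (auto simp: add.assoc)
    then have "L + 1 \<in> S" unfolding S_def using L by simp
    then show False using Max_ge[OF fin, of "L + 1"] unfolding L_def by linarith
  qed
  moreover have qL: "q (s + L) = (L, 0)" "q (s + L - 1) = (L - 1, 0)" "q (s + L - 2) = (L - 2, 0)"
    using L(2)[of L] L(2)[of "L - 1"] L(2)[of "L - 2"] L(1) by (auto simp: algebra_simps)
  moreover have "q (s + L + 1) \<noteq> (L - 1, 0)"
    using tile_cycle_neq[OF c, of "s + L - 1" "s + L + 1"] tile_cycle_N[OF c] qL by auto
  ultimately have ud: "q (s + L + 1) = (L, 1) \<or> q (s + L + 1) = (L, -1)"
    using tile_cycle_step[OF c qL(1), of "s + L + 1"] by auto
  have "q (s + L + 1) \<noteq> (L, 1)"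
  proof
    assume a: "q (s + L + 1) = (L, 1)"
    define r where "r = frame False 1 1 L 0 \<circ> q"
    have s1: "sign_pair 1 1" by (simp add: sign_pair_def)
    have cr: "tile_cycle N r" "no_good_end r" unfolding r_def using tile_cycle_frame[OF s1 c] no_good_end_frame[OF b s1] by auto
    have e: "normal_end r (s + L)" using qL a unfolding normal_end_def r_def frame_def by (simp add: add.commute)
    have "r (s + L - i) = (- i, 0)" if "0 \<le> i" "i \<le> L" for i
      using L(2)[of "L - i"] that unfolding r_def frame_def by (simp add: algebra_simps)
    moreover have "r (s + L - L - 1) = (- L, -1)" using q unfolding r_def frame_def by simp
    ultimately show False using normal_end_ext(3)[OF cr(1) e no_good_end_normal[OF cr(2)] L(1)] by blast
  qed
  then have d: "q (s + L + 1) = (L, -1)" using ud by simp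
  \<comment> \<open>Turned upside down, the end is normal; being bad it continues to (1, 1) in this
    frame, which is (L + 1, -1) in the old one.\<close>
  define r where "r = frame False 1 (-1) L 0 \<circ> q"
  have s1: "sign_pair 1 (-1)" by (simp add: sign_pair_def)
  have cr: "tile_cycle N r" "no_good_end r" unfolding r_def using tile_cycle_frame[OF s1 c] no_good_end_frame[OF b s1] by auto
  have e: "normal_end r (s + L)" using qL d unfolding normal_end_def r_def frame_def by (simp add: add.commute)
  have "r (s + L + 2) = (1, 1)" using normal_end_ext(1)[OF cr(1) e no_good_end_normal[OF cr(2)]] .
  then have "q (s + L + 2) = (L + 1, -1)" unfolding r_def comp_def frame_eq[OF s1] by simp
  then show ?thesis using L d by blast
qed

text \<open>Straightness is expressed by vanishing second differences, which frames preserve. Only a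
  block of at least three tiles has an end in this sense.\<close>

definition block_end :: "(int \<Rightarrow> int \<times> int) \<Rightarrow> int \<Rightarrow> bool" where
  "block_end p k \<longleftrightarrow> fst (p (k - 2)) + fst (p k) = 2 * fst (p (k - 1)) \<and>
     snd (p (k - 2)) + snd (p k) = 2 * snd (p (k - 1)) \<and>
     \<not> (fst (p (k - 1)) + fst (p (k + 1)) = 2 * fst (p k) \<and>
        snd (p (k - 1)) + snd (p (k + 1)) = 2 * snd (p k))"

lemma block_end_frame: "sign_pair e d \<Longrightarrow> block_end (frame s e d x0 y0 \<circ> p) k \<longleftrightarrow> block_end p k"
  unfolding block_end_def sign_pair_def frame_def
  by (cases "p k"; cases "p (k - 1)"; cases "p (k - 2)"; cases "p (k + 1)"; cases s; auto)

lemma block_end_per: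
  assumes "tile_cycle N p" shows "block_end p (k + N) \<longleftrightarrow> block_end p k"
proof -
  have "p (k + N + j) = p (k + j)" for j by (rule tile_cycle_per[OF assms]) simp
  from this[of 0] this[of 1] this[of "-1"] this[of "-2"] show ?thesis unfolding block_end_def by simp
qed

text \<open>The signs are those of the last step of the block and of the turning step; the axes are
  exchanged when the block is vertical.\<close>

lemma end_frame:
  assumes c: "tile_cycle N p" and e: "block_end p k"
  shows "\<exists>s ep d x0 y0. sign_pair ep d \<and> normal_end (frame s ep d x0 y0 \<circ> p) k"
proof -
  obtain x y where pk: "p k = (x, y)" by force
  obtain x1 y1 where p1: "p (k - 1) = (x1, y1)" by force
  obtain x2 y2 where p2: "p (k - 2) = (x2, y2)" by force
  obtain x3 y3 where p3: "p (k + 1) = (x3, y3)" by force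
  have col: "x2 + x = 2 * x1" "y2 + y = 2 * y1" "\<not> (x1 + x3 = 2 * x \<and> y1 + y3 = 2 * y)"
    using e unfolding block_end_def pk p1 p2 p3 by auto
  have ne: "(x1, y1) \<noteq> (x3, y3)" using tile_cycle_neq[OF c, of "k - 1" "k + 1"] tile_cycle_N[OF c] p1 p3 by auto
  have a: "(x = x1 + 1 \<and> y = y1) \<or> (x = x1 - 1 \<and> y = y1) \<or> (x = x1 \<and> y = y1 + 1) \<or> (x = x1 \<and> y = y1 - 1)"
    using tile_cycle_step[OF c p1, of k] pk by auto
  have b: "(x3 = x + 1 \<and> y3 = y) \<or> (x3 = x - 1 \<and> y3 = y) \<or> (x3 = x \<and> y3 = y + 1) \<or> (x3 = x \<and> y3 = y - 1)"
    using tile_cycle_step[OF c pk, of "k + 1"] p3 by auto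
  show ?thesis
  proof (cases "y = y1")
    case True
    then have h: "x - x1 = 1 \<or> x - x1 = -1" "y3 - y = 1 \<or> y3 - y = -1" "x3 = x"
      using a b col ne by auto
    have "normal_end (frame False (x - x1) (y3 - y) x y \<circ> p) k"
      using True h col unfolding normal_end_def frame_def pk p1 p2 p3 comp_def by auto
    moreover have "sign_pair (x - x1) (y3 - y)" using h unfolding sign_pair_def by auto
    ultimately show ?thesis by blast
  next
    case False
    then have h: "y - y1 = 1 \<or> y - y1 = -1" "x3 - x = 1 \<or> x3 - x = -1" "y3 = y" "x = x1"
      using a b col ne by auto
    have "normal_end (frame True (y - y1) (x3 - x) x y \<circ> p) k"
      using False h col unfolding normal_end_def frame_def pk p1 p2 p3 comp_def by auto
    moreover have "sign_pair (y - y1) (x3 - x)" using h unfolding sign_pair_def by auto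
    ultimately show ?thesis by blast
  qed
qed

section \<open>The zig-zag walk through the block ends\<close>

lemma block_end_cong:
  assumes "tile_cycle N p" "p i = p j" shows "block_end p i \<longleftrightarrow> block_end p j"
proof -
  have d: "N dvd (i - j)" using tile_cycle_inj[OF assms] .
  have "p (i + l) = p (j + l)" for l by (rule tile_cycle_per[OF assms(1)]) (use d in simp)
  from this[of 0] this[of 1] this[of "-1"] this[of "-2"] show ?thesis unfolding block_end_def by simp
qed

text \<open>One straight piece that never ends would make the tiles an arithmetic progression, which
  contradicts periodicity.\<close>

lemma no_end_straight:
  assumes c: "tile_cycle N p" and ne: "\<And>k. \<not> block_end p k"
    and st: "fst (p (k - 2)) + fst (p k) = 2 * fst (p (k - 1))" "snd (p (k - 2)) + snd (p k) = 2 * snd (p (k - 1))"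
  shows False
proof -
  have "fst (p (k - 2 + int i)) + fst (p (k + int i)) = 2 * fst (p (k - 1 + int i)) \<and>
        snd (p (k - 2 + int i)) + snd (p (k + int i)) = 2 * snd (p (k - 1 + int i))" for i
  proof (induction i)
    case 0 then show ?case using st by simp
  next
    case (Suc i)
    have "k - 2 + int (Suc i) = k + int i - 1" "k + int (Suc i) = k + int i + 1" "k - 1 + int (Suc i) = k + int i"
      by auto
    moreover have "k - 2 + int i = k + int i - 2" "k - 1 + int i = k + int i - 1" by auto
    ultimately show ?case using Suc ne[of "k + int i"] unfolding block_end_def by metis
  qed
  note col = this
  have "fst (p (k + int i)) = fst (p k) + int i * (fst (p k) - fst (p (k - 1))) \<and>
        snd (p (k + int i)) = snd (p k) + int i * (snd (p k) - snd (p (k - 1))) \<and>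
        fst (p (k - 1 + int i)) = fst (p k) + (int i - 1) * (fst (p k) - fst (p (k - 1))) \<and>
        snd (p (k - 1 + int i)) = snd (p k) + (int i - 1) * (snd (p k) - snd (p (k - 1)))" for i
  proof (induction i)
    case (Suc i)
    have "k - 2 + int (Suc i) = k - 1 + int i" "k - 1 + int (Suc i) = k + int i" by auto
    then show ?case using Suc col[of "Suc i"] by (simp add: algebra_simps)
  qed simp
  from this[of "nat N"] have "fst (p (k + N)) = fst (p k) + N * (fst (p k) - fst (p (k - 1)))"
     "snd (p (k + N)) = snd (p k) + N * (snd (p k) - snd (p (k - 1)))" using tile_cycle_N[OF c] by auto
  moreover have "p (k + N) = p k" by (rule tile_cycle_per[OF c]) simp
  ultimately have "p k = p (k - 1)" using tile_cycle_N[OF c] by (auto simp: prod_eq_iff)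
  then show False using tile_cycle_neq[OF c, of "k - 1" k] tile_cycle_N[OF c] by auto
qed

text \<open>If no three consecutive tiles are in line, every step turns. A turn back beside the path
  is impossible, so the steps repeat with period two. The path is then an infinite staircase
  advancing by a fixed vector, and periodicity makes that vector zero.\<close>

lemma tile_cycle_end_exists:
  assumes c: "tile_cycle N p" shows "\<exists>k. block_end p k"
proof (rule ccontr)
  assume "\<not> ?thesis"
  then have ne: "\<And>k. \<not> block_end p k" by blast
  have step: "fst (p (k + 3)) - fst (p (k + 2)) = fst (p (k + 1)) - fst (p k) \<and>
      snd (p (k + 3)) - snd (p (k + 2)) = snd (p (k + 1)) - snd (p k)" for k
  proof -
    obtain x y where 0: "p k = (x, y)" by force
    obtain x1 y1 where 1: "p (k + 1) = (x1, y1)" by force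
    obtain x2 y2 where 2: "p (k + 2) = (x2, y2)" by force
    obtain x3 y3 where 3: "p (k + 3) = (x3, y3)" by force
    have n1: "\<not> (x + x2 = 2 * x1 \<and> y + y2 = 2 * y1)" using no_end_straight[OF c ne, of "k + 2"] 0 1 2
      by (auto simp: add.commute)
    have n2: "\<not> (x1 + x3 = 2 * x2 \<and> y1 + y3 = 2 * y2)" using no_end_straight[OF c ne, of "k + 3"] 1 2 3
      by (auto simp: add.commute)
    have ne: "(x, y) \<noteq> (x2, y2)" "(x1, y1) \<noteq> (x3, y3)"
      using tile_cycle_neq[OF c, of k "k + 2"] tile_cycle_neq[OF c, of "k + 1" "k + 3"] tile_cycle_N[OF c] 0 1 2 3 by auto
    have n3: "\<bar>x - x3\<bar> + \<bar>y - y3\<bar> \<noteq> 1" using tile_cycle_no3[OF c, of "k + 3" k] 0 3 by (simp add: adjacent_def)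
    have "(x1 = x + 1 \<and> y1 = y) \<or> (x1 = x - 1 \<and> y1 = y) \<or> (x1 = x \<and> y1 = y + 1) \<or> (x1 = x \<and> y1 = y - 1)"
      using tile_cycle_step[OF c 0, of "k + 1"] 1 by auto
    moreover have "(x2 = x1 + 1 \<and> y2 = y1) \<or> (x2 = x1 - 1 \<and> y2 = y1) \<or> (x2 = x1 \<and> y2 = y1 + 1) \<or> (x2 = x1 \<and> y2 = y1 - 1)"
      using tile_cycle_step[OF c 1, of "k + 2"] 2 by auto
    moreover have "(x3 = x2 + 1 \<and> y3 = y2) \<or> (x3 = x2 - 1 \<and> y3 = y2) \<or> (x3 = x2 \<and> y3 = y2 + 1) \<or> (x3 = x2 \<and> y3 = y2 - 1)"
      using tile_cycle_step[OF c 2, of "k + 3"] 3 by auto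
    ultimately show ?thesis using n1 n2 ne n3 unfolding 0 1 2 3
      by (elim disjE conjE) simp_all
  qed
  define gx where "gx = fst (p 2) - fst (p 0)"
  define gy where "gy = snd (p 2) - snd (p 0)"
  have g: "fst (p (int i + 2)) - fst (p (int i)) = gx \<and> snd (p (int i + 2)) - snd (p (int i)) = gy" for i
  proof (induction i)
    case 0 then show ?case by (simp add: gx_def gy_def)
  next
    case (Suc i)
    then show ?case using step[of "int i"] by (simp add: add.commute[of _ 1] algebra_simps)
  qed
  have "fst (p (2 * int i)) = fst (p 0) + int i * gx \<and> snd (p (2 * int i)) = snd (p 0) + int i * gy" for i
  proof (induction i)
    case (Suc i)
    have "2 * int (Suc i) = int (2 * i) + 2" by simp
    then show ?case using Suc g[of "2 * i"] by (simp add: algebra_simps)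
  qed simp
  from this[of "nat N"] have "fst (p (2 * N)) = fst (p 0) + N * gx" "snd (p (2 * N)) = snd (p 0) + N * gy"
    using tile_cycle_N[OF c] by auto
  moreover have "p (2 * N) = p 0" by (rule tile_cycle_per[OF c]) simp
  ultimately have "p 2 = p 0" using tile_cycle_N[OF c] by (auto simp: prod_eq_iff gx_def gy_def)
  then show False using tile_cycle_neq[OF c, of 0 2] tile_cycle_N[OF c] by auto
qed

text \<open>At a block end \<open>k\<close>, \<open>walk_vertex p k\<close> is the vertex shared by \<open>p k\<close>, \<open>p (k + 1)\<close>, \<open>p (k + 2)\<close>
  and \<open>outer_vertex p k\<close> is the vertex of \<open>p k\<close> on the outside of the turn; up to dilation they are
  the \<open>v\<close> and \<open>z\<close> of the zig-zag walk.\<close>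

definition walk_vertex :: "(int \<Rightarrow> int \<times> int) \<Rightarrow> int \<Rightarrow> int \<times> int" where
  "walk_vertex p k = (max (fst (p k)) (fst (p (k + 2))), max (snd (p k)) (snd (p (k + 2))))"

definition outer_vertex :: "(int \<Rightarrow> int \<times> int) \<Rightarrow> int \<Rightarrow> int \<times> int" where
  "outer_vertex p k = (max (fst (p k)) (3 * fst (p k) - fst (p (k - 1)) - fst (p (k + 1))),
             max (snd (p k)) (3 * snd (p k) - snd (p (k - 1)) - snd (p (k + 1))))"

text \<open>The sign vector \<open>(gx, gy)\<close> of \<open>p (k + 2) - p k\<close> describes the two opposite quadrants at
  \<open>walk_vertex p k\<close> that contain the intervals of the zig-zag walk before and after \<open>k\<close>.\<close>

definition walk_link :: "(int \<Rightarrow> int \<times> int) \<Rightarrow> int \<Rightarrow> int \<Rightarrow> bool" where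
  "walk_link p k k' \<longleftrightarrow>
    (\<forall>x y. min (fst (walk_vertex p k)) (fst (outer_vertex p k')) \<le> x \<longrightarrow> x < max (fst (walk_vertex p k)) (fst (outer_vertex p k')) \<longrightarrow>
       min (snd (walk_vertex p k)) (snd (outer_vertex p k')) \<le> y \<longrightarrow> y < max (snd (walk_vertex p k)) (snd (outer_vertex p k')) \<longrightarrow> (x, y) \<in> range p) \<and>
    fst (walk_vertex p k) \<noteq> fst (outer_vertex p k') \<and> snd (walk_vertex p k) \<noteq> snd (outer_vertex p k') \<and>
    (walk_vertex p k' = (fst (walk_vertex p k), snd (outer_vertex p k')) \<or> walk_vertex p k' = (fst (outer_vertex p k'), snd (walk_vertex p k))) \<and>
    (let gx = fst (p (k + 2)) - fst (p k); gy = snd (p (k + 2)) - snd (p k);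
         gx' = fst (p (k' + 2)) - fst (p k'); gy' = snd (p (k' + 2)) - snd (p k')
     in (gx = 1 \<or> gx = -1) \<and> (gy = 1 \<or> gy = -1) \<and>
        gx * (fst (outer_vertex p k') - fst (walk_vertex p k)) \<ge> 0 \<and> gy * (snd (outer_vertex p k') - snd (walk_vertex p k)) \<ge> 0 \<and>
        gx' * (fst (outer_vertex p k') - fst (walk_vertex p k')) \<le> 0 \<and> gy' * (snd (outer_vertex p k') - snd (walk_vertex p k')) \<le> 0 \<and>
        gx' * (fst (walk_vertex p k) - fst (walk_vertex p k')) \<le> 0 \<and> gy' * (snd (walk_vertex p k) - snd (walk_vertex p k')) \<le> 0)"

text \<open>The next long block begins with the tile after the end and runs parallel to the old
  block. Its first tile lies on the far side of the walk vertex, so the interval consists of the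
  remaining L tiles.\<close>

lemma link_step_long:
  assumes s: "sign_pair e d" and L: "L \<ge> 2" and q: "q = frame s e d x0 y0 \<circ> p"
    and 0: "q k = (0, 0)" and 1: "\<And>i. 0 \<le> i \<Longrightarrow> i \<le> L \<Longrightarrow> q (k + 1 + i) = (i, 1)"
    and 2: "q (k + 1 + L + 1) = (L, 0)" "q (k + 1 + L + 2) = (L + 1, 0)"
  shows "walk_link p k (k + 1 + L)"
proof -
  have p: "p i = (if s then (x0 + d * b, y0 + e * a) else (x0 + e * a, y0 + d * b))" if "q i = (a, b)" for i a b
    using that frame_eq[OF s] unfolding q comp_def by simp
  have k2: "q (k + 2) = (1, 1)" using 1[of 1] L by (simp add: add.assoc)
  have kL: "q (k + 1 + L) = (L, 1)" "q (k + 1 + L - 1) = (L - 1, 1)"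
    using 1[of L] 1[of "L - 1"] L by (simp_all add: algebra_simps)
  note P = p[OF 0] p[OF k2] p[OF kL(1)] p[OF kL(2)] p[OF 2(1)] p[OF 2(2)]
  have R: "(if s then (x0 + d, y0 + e * i) else (x0 + e * i, y0 + d)) \<in> range p" if "0 \<le> i" "i \<le> L" for i
    using p[OF 1[OF that]] by (metis mult.right_neutral rangeI)
  have R': "(x, y) \<in> range p" if "if s then x = x0 + d \<and> 0 \<le> e * (y - y0) \<and> e * (y - y0) \<le> L
      else y = y0 + d \<and> 0 \<le> e * (x - x0) \<and> e * (x - x0) \<le> L" for x y
  proof -
    have *: "e * (e * t) = t" for t using s unfolding sign_pair_def by auto
    show ?thesis using R[of "e * (if s then y - y0 else x - x0)"] that by (auto simp: * split: if_splits)
  qed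
  from s L show ?thesis unfolding sign_pair_def walk_link_def walk_vertex_def outer_vertex_def Let_def P
    apply (elim conjE disjE; cases s; simp add: max_def min_def algebra_simps)
    by (auto intro!: R')
qed

text \<open>The next long block begins two tiles after the end and is perpendicular to the old one.
  Its first tile has the walk vertex as a corner on the side facing the end, so the interval is the
  whole block.\<close>

lemma link_step_short:
  assumes s: "sign_pair e d" and L: "L \<ge> 2" and q: "q = frame s e d x0 y0 \<circ> p"
    and 0: "q k = (0, 0)" and 1: "\<And>i. 0 \<le> i \<Longrightarrow> i \<le> L \<Longrightarrow> q (k + 2 + i) = (1, 1 + i)"
    and 2: "q (k + 2 + L + 1) = (0, L + 1)" "q (k + 2 + L + 2) = (0, L + 2)"
  shows "walk_link p k (k + 2 + L)"
proof -
  have p: "p i = (if s then (x0 + d * b, y0 + e * a) else (x0 + e * a, y0 + d * b))" if "q i = (a, b)" for i a b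
    using that frame_eq[OF s] unfolding q comp_def by simp
  have k2: "q (k + 2) = (1, 1)" using 1[of 0] L by simp
  have kL: "q (k + 2 + L) = (1, 1 + L)" "q (k + 2 + L - 1) = (1, L)"
    using 1[of L] 1[of "L - 1"] L by (simp_all add: algebra_simps)
  note P = p[OF 0] p[OF k2] p[OF kL(1)] p[OF kL(2)] p[OF 2(1)] p[OF 2(2)]
  have R: "(if s then (x0 + d * (1 + i), y0 + e) else (x0 + e, y0 + d * (1 + i))) \<in> range p" if "0 \<le> i" "i \<le> L" for i
    using p[OF 1[OF that]] by (metis mult.right_neutral rangeI)
  have R': "(x, y) \<in> range p" if "if s then y = y0 + e \<and> 1 \<le> d * (x - x0) \<and> d * (x - x0) \<le> L + 1
      else x = x0 + e \<and> 1 \<le> d * (y - y0) \<and> d * (y - y0) \<le> L + 1" for x y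
  proof -
    have *: "d * (d * t) = t" for t using s unfolding sign_pair_def by auto
    show ?thesis using R[of "d * (if s then x - x0 else y - y0) - 1"] that by (auto simp: * split: if_splits)
  qed
  from s L show ?thesis unfolding sign_pair_def walk_link_def walk_vertex_def outer_vertex_def Let_def P
    apply (elim conjE disjE; cases s; simp add: max_def min_def algebra_simps)
    by (auto intro!: R')
qed

text \<open>Two continuations survive a bad end: a long block starting at k + 1 or one starting at k
  + 2. In both, \<open>long_block_turn\<close> finds its end, and by then the path has turned back
  as the walk requires.\<close>

lemma next_end:
  assumes c: "tile_cycle N p" and b: "no_good_end p" and e: "block_end p k"
  shows "\<exists>k'>k. block_end p k' \<and> (\<forall>j. k < j \<longrightarrow> j < k' \<longrightarrow> \<not> block_end p j) \<and> walk_link p k k'"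
proof -
  obtain s ep d x0 y0 where s: "sign_pair ep d" and se: "normal_end (frame s ep d x0 y0 \<circ> p) k"
    using end_frame[OF c e] by blast
  define q where "q = frame s ep d x0 y0 \<circ> p"
  have cq: "tile_cycle N q" "no_good_end q" unfolding q_def using tile_cycle_frame[OF s c] no_good_end_frame[OF b s] by auto
  have ie: "block_end p j \<longleftrightarrow> block_end q j" for j unfolding q_def using block_end_frame[OF s] by simp
  have se: "normal_end q k" using se q_def by simp
  then have q: "q (k - 2) = (-2, 0)" "q (k - 1) = (-1, 0)" "q k = (0, 0)" "q (k + 1) = (0, 1)"
    unfolding normal_end_def by auto
  note ext = normal_end_ext(1,2)[OF cq(1) se no_good_end_normal[OF cq(2)]]
  have s1: "sign_pair 1 1" by (simp add: sign_pair_def)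
  have ends: "\<not> block_end q (k + 1)" "\<not> block_end q (k + 2)" using q ext(1) unfolding block_end_def by (auto simp: algebra_simps)
  from ext(2) show ?thesis
  proof (elim disjE conjE)
    assume q3: "q (k + 3) = (2, 1)"
    define r where "r = frame False 1 1 0 1 \<circ> q"
    have cr: "tile_cycle N r" "no_good_end r" unfolding r_def using tile_cycle_frame[OF s1 cq(1)] no_good_end_frame[OF cq(2) s1] by auto
    have rq: "r i = (a, b) \<longleftrightarrow> q i = (a, b + 1)" for i a b
      unfolding r_def comp_def frame_eq[OF s1] by (simp add: add.commute)
    have "\<exists>L\<ge>2. (\<forall>i. 0 \<le> i \<longrightarrow> i \<le> L \<longrightarrow> r (k + 1 + i) = (i, 0)) \<and> r (k + 1 + L + 1) = (L, -1) \<and>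
      r (k + 1 + L + 2) = (L + 1, -1)"
      by (rule long_block_turn[OF cr]) (use q ext(1) q3 in \<open>simp_all add: rq algebra_simps\<close>)
    then obtain L where L: "L \<ge> 2" "\<And>i. 0 \<le> i \<Longrightarrow> i \<le> L \<Longrightarrow> q (k + 1 + i) = (i, 1)"
      "q (k + 1 + L + 1) = (L, 0)" "q (k + 1 + L + 2) = (L + 1, 0)" unfolding rq by auto
    have "walk_link p k (k + 1 + L)" by (rule link_step_long[OF s L(1) q_def q(3) L(2-4)])
    moreover have "block_end q (k + 1 + L)"
      using L(2)[of L] L(2)[of "L - 1"] L(2)[of "L - 2"] L(1,3) unfolding block_end_def
      by (simp add: algebra_simps)
    moreover have "\<not> block_end q j" if "k < j" "j < k + 1 + L" for j
    proof (cases "j \<le> k + 2")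
      case True then have "j = k + 1 \<or> j = k + 2" using that by linarith
      then show ?thesis using ends by auto
    next
      case False
      then show ?thesis using that L(2)[of "j - k - 2"] L(2)[of "j - k - 1"] L(2)[of "j - k"]
        unfolding block_end_def by (simp add: algebra_simps)
    qed
    ultimately show ?thesis using L(1) ie by (intro exI[of _ "k + 1 + L"]) auto
  next
    assume q3: "q (k + 3) = (1, 2)" "q (k + 4) = (1, 3)"
    \<comment> \<open>With the axes exchanged and (1, 1) as origin, the upward block runs to the
      right and the tile q (k + 1) lies just below its start.\<close>
    define r where "r = frame True 1 1 1 1 \<circ> q"
    have cr: "tile_cycle N r" "no_good_end r" unfolding r_def using tile_cycle_frame[OF s1 cq(1)] no_good_end_frame[OF cq(2) s1] by auto
    have rq: "r i = (a, b) \<longleftrightarrow> q i = (1 + b, 1 + a)" for i a b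
      unfolding r_def comp_def frame_eq[OF s1] by simp
    have "\<exists>L\<ge>2. (\<forall>i. 0 \<le> i \<longrightarrow> i \<le> L \<longrightarrow> r (k + 2 + i) = (i, 0)) \<and> r (k + 2 + L + 1) = (L, -1) \<and>
      r (k + 2 + L + 2) = (L + 1, -1)"
      by (rule long_block_turn[OF cr]) (use q ext(1) q3 in \<open>simp_all add: rq algebra_simps\<close>)
    then obtain L where L: "L \<ge> 2" "\<And>i. 0 \<le> i \<Longrightarrow> i \<le> L \<Longrightarrow> q (k + 2 + i) = (1, 1 + i)"
      "q (k + 2 + L + 1) = (0, L + 1)" "q (k + 2 + L + 2) = (0, L + 2)" unfolding rq by (auto simp: add.commute)
    have "walk_link p k (k + 2 + L)" by (rule link_step_short[OF s L(1) q_def q(3) L(2-4)])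
    moreover have "block_end q (k + 2 + L)"
      using L(2)[of L] L(2)[of "L - 1"] L(2)[of "L - 2"] L(1,3) unfolding block_end_def
      by (simp add: algebra_simps)
    moreover have "\<not> block_end q j" if "k < j" "j < k + 2 + L" for j
    proof (cases "j \<le> k + 3")
      case True then have "j = k + 1 \<or> j = k + 2 \<or> j = k + 3" using that by linarith
      moreover have "\<not> block_end q (k + 3)" using q ext(1) q3 unfolding block_end_def by (simp add: add.commute)
      ultimately show ?thesis using ends by auto
    next
      case False
      then show ?thesis using that L(2)[of "j - k - 3"] L(2)[of "j - k - 2"] L(2)[of "j - k - 1"]
        unfolding block_end_def by (simp add: algebra_simps)
    qed
    ultimately show ?thesis using L(1) ie by (intro exI[of _ "k + 2 + L"]) auto
  qed
qed

section \<open>Outer vertices of different block ends\<close>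

lemma normal_end_notin:
  assumes c: "tile_cycle N q" and e: "normal_end q k"
  shows "(1, 0) \<notin> range q" "(0, -1) \<notin> range q" "(1, -1) \<notin> range q" "(-1, 1) \<notin> range q"
    "q (k + 2) = (1, 1) \<Longrightarrow> (0, 2) \<notin> range q"
proof -
  have R: "q i = z \<Longrightarrow> z \<in> range q" for i z by blast
  have b: "(-2, 0) \<in> range q" "(-1, 0) \<in> range q" "(0, 0) \<in> range q" "(0, 1) \<in> range q"
    using e R unfolding normal_end_def by metis+
  note g = tile_cycle_path_like[OF c]
  show n: "(1, 0) \<notin> range q" "(0, -1) \<notin> range q" "(-1, 1) \<notin> range q"
    using path_like_nbrs[OF g b(3)] path_like_nbrs[OF g b(2)] b by auto
  then show "(1, -1) \<notin> range q" using path_like_diag(3)[OF g b(3)] by auto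
  show "q (k + 2) = (1, 1) \<Longrightarrow> (0, 2) \<notin> range q"
    using path_like_nbrs[OF g b(4)] b R[of "k + 2" "(1, 1)"] by auto
qed

text \<open>The outer vertex is the one that p k shares with the tile 3 p k - p (k - 1) - p (k + 1),
  diagonally opposite to the turn. In the frame of the end the four tiles around it are (0, 0), (1,
  0), (0, -1) and (1, -1), and only (0, 0) is on the path.\<close>

lemma outer_vertex_touch:
  assumes c: "tile_cycle N p" and e: "block_end p k" and t: "(x, y) \<in> range p"
    "fst (outer_vertex p k) - 1 \<le> x" "x \<le> fst (outer_vertex p k)" "snd (outer_vertex p k) - 1 \<le> y" "y \<le> snd (outer_vertex p k)"
  shows "(x, y) = p k"
proof -
  obtain s ep d x0 y0 where s: "sign_pair ep d" and se: "normal_end (frame s ep d x0 y0 \<circ> p) k"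
    using end_frame[OF c e] by blast
  define q where "q = frame s ep d x0 y0 \<circ> p"
  have cq: "tile_cycle N q" unfolding q_def using tile_cycle_frame[OF s c] by auto
  have se: "normal_end q k" using se q_def by simp
  have p: "p i = (if s then (x0 + d * b, y0 + ep * a) else (x0 + ep * a, y0 + d * b))" if "q i = (a, b)" for i a b
    using that frame_eq[OF s] unfolding q_def comp_def by simp
  have q: "q k = (0, 0)" "q (k - 1) = (-1, 0)" "q (k + 1) = (0, 1)" using se unfolding normal_end_def by auto
  note P = p[OF q(1)] p[OF q(2)] p[OF q(3)]
  have "frame s ep d x0 y0 (x, y) \<in> range q" using t(1) unfolding q_def by auto
  moreover have "frame s ep d x0 y0 (x, y) \<in> {(0, 0), (1, 0), (0, -1), (1, -1)}"
    using t(2-) s unfolding outer_vertex_def P sign_pair_def frame_def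
    by (elim conjE disjE; cases s; auto simp: max_def)
  ultimately have "frame s ep d x0 y0 (x, y) = (0, 0)" using normal_end_notin(1-3)[OF cq se] by auto
  then show ?thesis unfolding P frame_eq[OF s] by simp
qed

text \<open>Adjacent tiles are consecutive, so a row of tiles is traversed in order; the known tile
  p (k - 1) fixes the direction.\<close>

lemma left_straight:
  assumes c: "tile_cycle N q" and "q k = (0, 0)" "q (k - 1) = (-1, 0)"
    and h: "\<And>x. - t \<le> x \<Longrightarrow> x \<le> 0 \<Longrightarrow> (x, 0) \<in> range q"
  shows "int i \<le> t \<Longrightarrow> q (k - int i) = (- int i, 0)"
proof (induction i rule: less_induct)
  case (less i)
  consider "i = 0" | "i = 1" | j where "i = Suc (Suc j)" by (metis not0_implies_Suc One_nat_def)
  then show ?case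
  proof cases
    case 3
    have q1: "q (k - int (Suc j)) = (- int (Suc j), 0)" "q (k - int j) = (- int j, 0)"
      using less(1)[of "Suc j"] less(1)[of j] less(2) 3 by simp_all
    have "(- int i, 0) \<in> range q" using h less(2) by simp
    then obtain l where l: "q l = (- int i, 0)" by (metis imageE)
    have "adjacent (q (k - int (Suc j))) (q l)" unfolding q1 l using 3 by (simp add: adjacent_def)
    from tile_cycle_nbr[OF c this] show ?thesis
      using q1 l 3 by (auto simp: algebra_simps)
  qed (use assms in auto)
qed

text \<open>The rectangle of tiles spanned by the two ends avoids (1, 0), (0, -1) and (-1, 1), so it
  is a segment going up or left. Upwards it can only reach (0, 1), which is no end. To the left, two
  steps after the second end the path would still be on the same line, whereas after a bad end it is
  diagonally displaced; only distance one needs a separate look.\<close>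

lemma ends_separated_normal:
  assumes c: "tile_cycle N q" and b: "no_good_end q" and se: "normal_end q k" and e: "block_end q k'" "q k' \<noteq> q k"
    and h: "\<And>x y. min 0 (fst (q k')) \<le> x \<Longrightarrow> x \<le> max 0 (fst (q k')) \<Longrightarrow>
       min 0 (snd (q k')) \<le> y \<Longrightarrow> y \<le> max 0 (snd (q k')) \<Longrightarrow> (x, y) \<in> range q"
  shows False
proof -
  obtain a b' where ab: "q k' = (a, b')" by force
  have q: "q (k - 2) = (-2, 0)" "q (k - 1) = (-1, 0)" "q k = (0, 0)" "q (k + 1) = (0, 1)"
    using se unfolding normal_end_def by auto
  have q2: "q (k + 2) = (1, 1)" using normal_end_ext(1)[OF c se no_good_end_normal[OF b]] .
  note n = normal_end_notin[OF c se]
  have a: "a \<le> 0"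
  proof (rule ccontr)
    assume "\<not> a \<le> 0"
    then have "(1, 0) \<in> range q" by (intro h) (auto simp: ab)
    then show False using n(1) by blast
  qed
  have b0: "b' \<ge> 0"
  proof (rule ccontr)
    assume "\<not> b' \<ge> 0"
    then have "(0, -1) \<in> range q" by (intro h) (auto simp: ab)
    then show False using n(2) by blast
  qed
  have "a = 0 \<or> b' = 0"
  proof (rule ccontr)
    assume "\<not> (a = 0 \<or> b' = 0)"
    then have "(-1, 1) \<in> range q" using a b0 by (intro h) (auto simp: ab)
    then show False using n(4) by blast
  qed
  then show False
  proof
    assume a0: "a = 0"
    have "b' < 2"
    proof (rule ccontr)
      assume "\<not> b' < 2"
      then have "(0, 2) \<in> range q" by (intro h) (auto simp: ab a0)
      then show False using n(5)[OF q2] by blast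
    qed
    then have "b' = 1" using a0 ab q(3) e(2) b0 by (cases "b' = 0") auto
    then have "block_end q (k + 1)" using block_end_cong[OF c, of k' "k + 1"] e(1) ab a0 q by simp
    then show False using q q2 unfolding block_end_def by (auto simp: algebra_simps)
  next
    assume b1: "b' = 0"
    have st: "int i \<le> - a \<Longrightarrow> q (k - int i) = (- int i, 0)" for i
      by (rule left_straight[OF c q(3,2)]) (use h[of _ 0] ab b1 a in auto)
    have t0: "a \<noteq> 0" using b1 ab q(3) e(2) by auto
    have "q (k + a) = (a, 0)" using st[of "nat (- a)"] a by simp
    then have ie: "block_end q (k + a)" using block_end_cong[OF c, of k' "k + a"] e(1) ab b1 by simp
    show False
    proof (cases "a = -1")
      case True
      then show False using ie q unfolding block_end_def by (auto simp: algebra_simps)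
    next
      case False
      then have t2: "a \<le> -2" using a t0 by simp
      have z: "q (k + a) = (a, 0)" "q (k + a + 1) = (a + 1, 0)" "q (k + a + 2) = (a + 2, 0)"
        using st[of "nat (- a)"] st[of "nat (- a - 1)"] st[of "nat (- a - 2)"] t2 by (simp_all add: algebra_simps)
      obtain s ep d x0 y0 where s: "sign_pair ep d" and se': "normal_end (frame s ep d x0 y0 \<circ> q) (k + a)"
        using end_frame[OF c ie] by blast
      have r: "(frame s ep d x0 y0 \<circ> q) (k + a + 2) = (1, 1)"
        using normal_end_ext(1)[OF tile_cycle_frame[OF s c] se' no_good_end_normal[OF no_good_end_frame[OF b s]]] .
      have r': "(frame s ep d x0 y0 \<circ> q) (k + a) = (0, 0)" using se' unfolding normal_end_def by simp
      show False using r r' s unfolding comp_def z frame_eq[OF s] sign_pair_def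
        by (auto split: if_splits)
    qed
  qed
qed

lemma ends_separated:
  assumes c: "tile_cycle N p" and b: "no_good_end p" and e: "block_end p k" "block_end p k'" "p k' \<noteq> p k"
    and h: "\<And>x y. min (fst (p k)) (fst (p k')) \<le> x \<Longrightarrow> x \<le> max (fst (p k)) (fst (p k')) \<Longrightarrow>
       min (snd (p k)) (snd (p k')) \<le> y \<Longrightarrow> y \<le> max (snd (p k)) (snd (p k')) \<Longrightarrow> (x, y) \<in> range p"
  shows False
proof -
  obtain s ep d x0 y0 where s: "sign_pair ep d" and se: "normal_end (frame s ep d x0 y0 \<circ> p) k"
    using end_frame[OF c e(1)] by blast
  define q where "q = frame s ep d x0 y0 \<circ> p"
  have cq: "tile_cycle N q" "no_good_end q" unfolding q_def using tile_cycle_frame[OF s c] no_good_end_frame[OF b s] by auto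
  have se: "normal_end q k" using se q_def by simp
  have p: "p i = (if s then (x0 + d * b, y0 + ep * a) else (x0 + ep * a, y0 + d * b))" if "q i = (a, b)" for i a b
    using that frame_eq[OF s] unfolding q_def comp_def by simp
  have q: "q k = (0, 0)" using se unfolding normal_end_def by auto
  obtain a b' where ab: "q k' = (a, b')" by force
  have "block_end q k'" unfolding q_def using block_end_frame[OF s] e(2) by simp
  moreover have "q k' \<noteq> q k" using e(3) p[OF q] p[OF ab] unfolding q ab by auto
  moreover have "(x, y) \<in> range q" if xy: "min 0 (fst (q k')) \<le> x" "x \<le> max 0 (fst (q k'))"
       "min 0 (snd (q k')) \<le> y" "y \<le> max 0 (snd (q k'))" for x y
  proof -
    have "(if s then (x0 + d * y, y0 + ep * x) else (x0 + ep * x, y0 + d * y)) \<in> range p"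
      using s xy unfolding ab sign_pair_def
      by (elim conjE disjE; cases s; simp; intro h; simp add: p[OF q] p[OF ab] min_def max_def split: if_splits)
    then obtain i where "p i = (if s then (x0 + d * y, y0 + ep * x) else (x0 + ep * x, y0 + d * y))" by (metis imageE)
    then have "q i = (x, y)" unfolding q_def comp_def frame_eq[OF s] .
    then show ?thesis by (metis rangeI)
  qed
  ultimately show False by (rule ends_separated_normal[OF cq se])
qed

text \<open>Ends are enumerated in order by dependent choice. Since E 0 + N is again an end and none
  is skipped, the enumeration hits it, and r is the number of ends in one period.\<close>

theorem zigzag_data:
  assumes c: "tile_cycle N p" and b: "no_good_end p"
  shows "\<exists>r E. r \<ge> 1 \<and> (\<forall>i. block_end p (E i)) \<and> (\<forall>i. walk_link p (E i) (E (Suc i))) \<and> E r = E 0 + N \<and>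
    (\<forall>i j. 1 \<le> i \<longrightarrow> i < j \<longrightarrow> j \<le> r \<longrightarrow> p (E i) \<noteq> p (E j))"
proof -
  have "\<exists>E. \<forall>i::nat. block_end p (E i) \<and> (E i < E (Suc i) \<and>
     (\<forall>j. E i < j \<longrightarrow> j < E (Suc i) \<longrightarrow> \<not> block_end p j) \<and> walk_link p (E i) (E (Suc i)))"
    by (rule dependent_nat_choice) (use tile_cycle_end_exists[OF c] next_end[OF c b] in blast)+
  then obtain E :: "nat \<Rightarrow> int" where E: "\<And>i. block_end p (E i)" "\<And>i. E i < E (Suc i)"
     "\<And>i j. E i < j \<Longrightarrow> j < E (Suc i) \<Longrightarrow> \<not> block_end p j" "\<And>i. walk_link p (E i) (E (Suc i))" by blast
  have mono: "strict_mono E" using E(2) by (simp add: strict_mono_Suc_iff)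
  have ge: "E i \<ge> E 0 + int i" for i
  proof (induction i)
    case (Suc i) then show ?case using E(2)[of i] by simp
  qed simp
  have N: "N > 5" by (rule tile_cycle_N[OF c])
  define r where "r = (LEAST i. E i \<ge> E 0 + N)"
  have ex: "E (nat N) \<ge> E 0 + N" using ge[of "nat N"] N by simp
  then have r1: "E r \<ge> E 0 + N" unfolding r_def by (rule LeastI)
  then have r0: "r > 0" using N by (cases r) auto
  have r2: "E (r - 1) < E 0 + N" using not_less_Least[of "r - 1" "\<lambda>i. E i \<ge> E 0 + N"] r0 unfolding r_def by auto
  have "block_end p (E 0 + N)" using block_end_per[OF c] E(1) by simp
  then have "E r = E 0 + N" using E(3)[of "r - 1" "E 0 + N"] r0 r1 r2 by force
  moreover have "p (E i) \<noteq> p (E j)" if "1 \<le> i" "i < j" "j \<le> r" for i j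
  proof (rule tile_cycle_neq[OF c])
    show "E i < E j" using mono that by (simp add: strict_monoD)
    have "E 0 < E i" "E j \<le> E r" using mono that by (simp_all add: strict_monoD strict_mono_less_eq)
    then show "E j < E i + N" using \<open>E r = E 0 + N\<close> by simp
  qed
  ultimately show ?thesis using E(1,4) r0 by (intro exI[of _ r] exI[of _ E]) auto
qed

section \<open>Tensor products with a rectangle\<close>

lemma cell_eq: "cell (a, b) = {a..Suc a} \<times> {b..Suc b}"
  by (simp add: cell_def interval_def)

lemma cell_inj: "cell z = cell z' \<longleftrightarrow> z = z'"
proof
  assume h: "cell z = cell z'"
  have min: "(fst z, snd z) \<in> cell z \<and> (\<forall>w\<in>cell z. fst z \<le> fst w \<and> snd z \<le> snd w)" for z
    by (cases z) (auto simp: cell_eq)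
  show "z = z'" using min[of z] min[of z'] h by (metis dual_order.antisym fst_conv prod_eq_iff snd_conv)
qed simp

lemma cell_in_cells [simp]: "cell z \<in> cells"
  by (simp add: cells_def)

lemma finite_vertices: "finite S \<Longrightarrow> S \<subseteq> cells \<Longrightarrow> finite (vertices S)"
  unfolding vertices_def by (auto simp: cells_def cell_def interval_def)

lemma cell_sup:
  assumes "finite S" "S \<subseteq> cells" "cell (x, y) \<in> S"
  shows "x < sup_x S" "y < sup_y S"
proof -
  have "(Suc x, Suc y) \<in> cell (x, y)" by (simp add: cell_eq)
  then have "(Suc x, Suc y) \<in> vertices S" using assms(3) unfolding vertices_def by blast
  then have "Suc x \<in> fst ` vertices S" "Suc y \<in> snd ` vertices S" by force+
  then show "x < sup_x S" "y < sup_y S"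
    unfolding sup_x_def sup_y_def using finite_vertices[OF assms(1,2)]
    by (metis Max_ge Suc_le_eq finite_imageI)+
qed

lemma sup_attained:
  assumes "finite S" "S \<subseteq> cells" "S \<noteq> {}"
  shows "\<exists>x y. cell (x, y) \<in> S \<and> sup_x S = Suc x" "\<exists>x y. cell (x, y) \<in> S \<and> sup_y S = Suc y"
proof -
  obtain C where "C \<in> S" using assms(3) by blast
  then obtain z where "cell z \<in> S" using assms(2) by (auto simp: cells_def)
  moreover have "z \<in> cell z" by (cases z) (auto simp: cell_eq)
  ultimately have "z \<in> vertices S" unfolding vertices_def by blast
  then have ne: "vertices S \<noteq> {}" by blast
  note fin = finite_vertices[OF assms(1,2)]
  have "sup_x S \<in> fst ` vertices S" unfolding sup_x_def using fin ne by (intro Max_in) auto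
  then obtain vx vy where v: "(vx, vy) \<in> vertices S" "vx = sup_x S" by force
  then obtain x y where c: "cell (x, y) \<in> S" "(vx, vy) \<in> cell (x, y)"
    using assms(2) unfolding vertices_def cells_def by fastforce
  then have "sup_x S = Suc x" using cell_sup(1)[OF assms(1,2) c(1)] v(2) by (auto simp: cell_eq)
  then show "\<exists>x y. cell (x, y) \<in> S \<and> sup_x S = Suc x" using c by blast
  have "sup_y S \<in> snd ` vertices S" unfolding sup_y_def using fin ne by (intro Max_in) auto
  then obtain vx vy where v: "(vx, vy) \<in> vertices S" "vy = sup_y S" by force
  then obtain x y where c: "cell (x, y) \<in> S" "(vx, vy) \<in> cell (x, y)"
    using assms(2) unfolding vertices_def cells_def by fastforce
  then have "sup_y S = Suc y" using cell_sup(2)[OF assms(1,2) c(1)] v(2) by (auto simp: cell_eq)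
  then show "\<exists>x y. cell (x, y) \<in> S \<and> sup_y S = Suc y" using c by blast
qed

lemma sup_eqI:
  assumes "finite S" "S \<subseteq> cells"
  shows "cell (x, y) \<in> S \<Longrightarrow> (\<And>x' y'. cell (x', y') \<in> S \<Longrightarrow> x' \<le> x) \<Longrightarrow> sup_x S = Suc x"
    and "cell (x, y) \<in> S \<Longrightarrow> (\<And>x' y'. cell (x', y') \<in> S \<Longrightarrow> y' \<le> y) \<Longrightarrow> sup_y S = Suc y"
  using sup_attained[OF assms] cell_sup[OF assms] by (metis Suc_leI empty_iff le_antisym le_imp_less_Suc)+

lemma assoc_index:
  assumes "i < sup_y S" "j < sup_x S"
  shows "assoc_matrix S $$ (i, j) = (if cell (j, sup_y S - (i + 1)) \<in> S then 1 else 0)"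
proof -
  have "sup_y S - i = Suc (sup_y S - (i + 1))" using assms by simp
  then show ?thesis using assms unfolding assoc_matrix_def cell_def by simp
qed

lemma assoc_dim [simp]: "dim_row (assoc_matrix S) = sup_y S" "dim_col (assoc_matrix S) = sup_x S"
  by (simp_all add: assoc_matrix_def)

text \<open>The dimensions of the matrix fix the position of the top row, and its entries locate
  every cell. Applied in both directions, this is the uniqueness behind
  \<open>tensor\<close>.\<close>

lemma assoc_mono:
  assumes S: "finite S" "S \<subseteq> cells" and eq: "assoc_matrix S = assoc_matrix T"
  shows "S \<subseteq> T"
proof
  fix C assume "C \<in> S"
  then obtain x y where C: "C = cell (x, y)" "cell (x, y) \<in> S" using S(2) by (auto simp: cells_def)
  have d: "sup_y S = sup_y T" "sup_x S = sup_x T" using eq by (metis assoc_dim)+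
  have b: "x < sup_x S" "y < sup_y S" using cell_sup[OF S C(2)] by auto
  define i where "i = sup_y S - (y + 1)"
  have i: "i < sup_y S" "sup_y S - (i + 1) = y" using b unfolding i_def by auto
  have "assoc_matrix S $$ (i, x) = 1" using assoc_index[OF i(1) b(1)] C(2) i(2) by simp
  then have "assoc_matrix T $$ (i, x) = 1" unfolding eq .
  moreover have it1: "i < sup_y T" using i(1) unfolding d .
  moreover have it2: "x < sup_x T" using b(1) unfolding d .
  moreover have it3: "sup_y T - (i + 1) = y" using i(2) unfolding d .
  ultimately show "C \<in> T" unfolding assoc_index[OF it1 it2] it3 C(1) by (metis zero_neq_one)
qed

definition dilate :: "nat \<Rightarrow> nat \<Rightarrow> point set set \<Rightarrow> point set set" where
  "dilate m n P = {cell (x, y) | x y. cell (x div m, y div n) \<in> P}"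

lemma dilate_iff: "cell (x, y) \<in> dilate m n P \<longleftrightarrow> cell (x div m, y div n) \<in> P"
  unfolding dilate_def by (auto simp: cell_inj)

text \<open>The matrix of the rectangle consists of ones, so the Kronecker product repeats each
  entry in a block of n rows and m columns. Matrix rows count from the top, but the total height is
  a multiple of n, so counting from below cuts the rows into the same blocks.\<close>

lemma tensor_rectangle:
  assumes P: "finite P" "P \<subseteq> cells" "P \<noteq> {}" and m: "m \<ge> 1" "n \<ge> 1"
  shows "tensor P (rectangle m n) = dilate m n P"
proof -
  let ?T = "dilate m n P" and ?R = "rectangle m n"
  have "?R = cell ` ({..<m} \<times> {..<n})" unfolding rectangle_def by auto
  then have R: "finite ?R" "?R \<subseteq> cells" by (auto simp: cells_def)
  have Ri: "cell (x, y) \<in> ?R \<longleftrightarrow> x < m \<and> y < n" for x y unfolding rectangle_def by (auto simp: cell_inj)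
  have "sup_x ?R = Suc (m - 1)" by (rule sup_eqI(1)[OF R, of _ 0]) (use m in \<open>auto simp: Ri\<close>)
  moreover have "sup_y ?R = Suc (n - 1)" by (rule sup_eqI(2)[OF R, of 0]) (use m in \<open>auto simp: Ri\<close>)
  ultimately have sR: "sup_x ?R = m" "sup_y ?R = n" using m by simp_all
  have Rent: "assoc_matrix ?R $$ (i, j) = 1" if "i < n" "j < m" for i j
    using assoc_index[of i ?R j] that sR Ri by auto
  have Tsub: "?T \<subseteq> cells" unfolding dilate_def by auto
  have bd: "x < m * sup_x P" "y < n * sup_y P" if "cell (x, y) \<in> ?T" for x y
  proof -
    have "x div m < sup_x P" "y div n < sup_y P" using cell_sup[OF P(1,2)] that unfolding dilate_iff by blast+
    then show "x < m * sup_x P" "y < n * sup_y P" using m by (simp_all add: div_less_iff_less_mult mult.commute)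
  qed
  have "?T \<subseteq> cell ` ({..<m * sup_x P} \<times> {..<n * sup_y P})"
  proof
    fix C assume C: "C \<in> ?T"
    then obtain x y where "C = cell (x, y)" unfolding dilate_def by blast
    then show "C \<in> cell ` ({..<m * sup_x P} \<times> {..<n * sup_y P})" using bd C by auto
  qed
  then have Tfin: "finite ?T" by (rule finite_subset) simp
  obtain x y where x: "cell (x, y) \<in> P" "sup_x P = Suc x" using sup_attained(1)[OF P] by blast
  have dm: "(m * x + (m - 1)) div m = x" "m * x div m = x" for x using m by (auto intro!: div_nat_eqI)
  have dn: "(n * y + (n - 1)) div n = y" "n * y div n = y" for y using m by (auto intro!: div_nat_eqI)
  have "cell (m * x + (m - 1), n * y) \<in> ?T" unfolding dilate_iff dm dn by (rule x(1))
  moreover have "x' \<le> m * x + (m - 1)" if "cell (x', y') \<in> ?T" for x' y'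
    using bd(1)[OF that] x(2) m by (simp add: algebra_simps)
  ultimately have sx: "sup_x ?T = sup_x P * m" using sup_eqI(1)[OF Tfin Tsub] m x(2) by (simp add: algebra_simps)
  obtain x y where y: "cell (x, y) \<in> P" "sup_y P = Suc y" using sup_attained(2)[OF P] by blast
  have "cell (m * x, n * y + (n - 1)) \<in> ?T" unfolding dilate_iff dm dn by (rule y(1))
  moreover have "y' \<le> n * y + (n - 1)" if "cell (x', y') \<in> ?T" for x' y'
    using bd(2)[OF that] y(2) m by (simp add: algebra_simps)
  ultimately have sy: "sup_y ?T = sup_y P * n" using sup_eqI(2)[OF Tfin Tsub] m y(2) by (simp add: algebra_simps)
  have eq: "assoc_matrix ?T = kronecker (assoc_matrix P) (assoc_matrix ?R)"
  proof (rule eq_matI)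
    fix i j assume "i < dim_row (kronecker (assoc_matrix P) (assoc_matrix ?R))"
      "j < dim_col (kronecker (assoc_matrix P) (assoc_matrix ?R))"
    then have ij: "i < sup_y P * n" "j < sup_x P * m" by (simp_all add: kronecker_def sR)
    have d: "i div n < sup_y P" "j div m < sup_x P" using ij m by (simp_all add: div_less_iff_less_mult)
    have r: "i mod n < n" "j mod m < m" using m by simp_all
    have "sup_y P * n - (i + 1) = (sup_y P - (i div n + 1)) * n + (n - 1 - i mod n)"
    proof -
      obtain l where l: "sup_y P = i div n + 1 + l" using d(1) by (metis Suc_eq_plus1 Suc_leI le_Suc_ex)
      have "sup_y P * n = i div n * n + n + l * n" unfolding l by (simp add: algebra_simps)
      moreover have "i = i div n * n + i mod n" by simp
      ultimately have "sup_y P * n - (i + 1) = l * n + (n - 1 - i mod n)" using r(1) by linarith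
      then show ?thesis using l by simp
    qed
    then have dv: "(sup_y P * n - (i + 1)) div n = sup_y P - (i div n + 1)"
      using m by (simp add: div_add1_eq)
    have "kronecker (assoc_matrix P) (assoc_matrix ?R) $$ (i, j) =
      assoc_matrix P $$ (i div n, j div m) * assoc_matrix ?R $$ (i mod n, j mod m)"
      using ij by (simp add: kronecker_def sR)
    also have "\<dots> = (if cell (j div m, sup_y P - (i div n + 1)) \<in> P then 1 else 0)"
      using assoc_index[OF d] Rent[OF r] by simp
    also have "\<dots> = (if cell (j, sup_y P * n - (i + 1)) \<in> ?T then 1 else 0)"
      unfolding dilate_iff dv ..
    also have "\<dots> = assoc_matrix ?T $$ (i, j)"
      using assoc_index[of i ?T j] ij unfolding sx sy by simp
    finally show "assoc_matrix ?T $$ (i, j) = kronecker (assoc_matrix P) (assoc_matrix ?R) $$ (i, j)" ..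
  qed (simp_all add: kronecker_def sx sy sR)
  show ?thesis unfolding tensor_def
  proof (rule the_equality)
    show "finite ?T \<and> ?T \<subseteq> cells \<and> assoc_matrix ?T = kronecker (assoc_matrix P) (assoc_matrix ?R)"
      using Tfin Tsub eq by blast
    fix S assume "finite S \<and> S \<subseteq> cells \<and> assoc_matrix S = kronecker (assoc_matrix P) (assoc_matrix ?R)"
    then show "S = ?T" using assoc_mono[of S ?T] assoc_mono[of ?T S] Tfin Tsub eq by auto
  qed
qed

section \<open>Closed paths as cyclic sequences of tiles\<close>

definition int_tiles :: "point set set \<Rightarrow> (int \<times> int) set" where
  "int_tiles P = {(x, y). 0 \<le> x \<and> 0 \<le> y \<and> cell (nat x, nat y) \<in> P}"

text \<open>Two cells intersect in a product of two integer intervals with at most two elements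
  each. Being an edge, the product has two elements, so one factor has one element and the other has
  two.\<close>

lemma cell_Int_adjacent:
  assumes "cell (a, b) \<inter> cell (a', b') \<in> cell_edges C"
  shows "adjacent (int a, int b) (int a', int b')"
proof -
  have "\<exists>u v. cell (a, b) \<inter> cell (a', b') = {u, v} \<and> (v = (Suc (fst u), snd u) \<or> v = (fst u, Suc (snd u)))"
    using assms unfolding cell_edges_def by blast
  then obtain u v where uv: "cell (a, b) \<inter> cell (a', b') = {u, v}" "v = (Suc (fst u), snd u) \<or> v = (fst u, Suc (snd u))"
    by blast
  have "cell (a, b) \<inter> cell (a', b') = {max a a'..min (Suc a) (Suc a')} \<times> {max b b'..min (Suc b) (Suc b')}"
    unfolding cell_eq by auto
  then have "card ({max a a'..min (Suc a) (Suc a')} \<times> {max b b'..min (Suc b) (Suc b')}) = 2"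
    using uv by (metis Suc_n_not_n card_2_iff fst_conv snd_conv)
  then have c: "(Suc (min (Suc a) (Suc a')) - max a a') * (Suc (min (Suc b) (Suc b')) - max b b') = 2"
    by (simp add: card_cartesian_product)
  have "Suc (min (Suc a) (Suc a')) - max a a' \<le> 2" by simp
  then have "Suc (min (Suc a) (Suc a')) - max a a' = 0 \<or> Suc (min (Suc a) (Suc a')) - max a a' = 1 \<or>
     Suc (min (Suc a) (Suc a')) - max a a' = 2" by linarith
  then have "Suc (min (Suc a) (Suc a')) - max a a' = 1 \<and> Suc (min (Suc b) (Suc b')) - max b b' = 2 \<or>
     Suc (min (Suc a) (Suc a')) - max a a' = 2 \<and> Suc (min (Suc b) (Suc b')) - max b b' = 1"
  proof (elim disjE)
    assume z: "Suc (min (Suc a) (Suc a')) - max a a' = 0"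
    show ?thesis using c unfolding z by simp
  next
    assume z: "Suc (min (Suc a) (Suc a')) - max a a' = 1"
    show ?thesis using c unfolding z by linarith
  next
    assume z: "Suc (min (Suc a) (Suc a')) - max a a' = 2"
    show ?thesis using c unfolding z by linarith
  qed
  then show ?thesis unfolding adjacent_def by (auto simp: min_def max_def split: if_splits)
qed

lemma cell_Int_near:
  assumes "near (int a, int b) (int a', int b')" shows "cell (a, b) \<inter> cell (a', b') \<noteq> {}"
proof -
  have "(max a a', max b b') \<in> cell (a, b) \<inter> cell (a', b')"
    using assms unfolding near_def cell_eq by auto
  then show ?thesis by blast
qed

lemma closed_path_tile_cycle:
  assumes "closed_path P"
  shows "\<exists>N p. tile_cycle N p \<and> range p = int_tiles P"
proof -
  have pol: "P \<subseteq> cells" using assms unfolding closed_path_def polyomino_def by blast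
  obtain n :: nat and A where n: "n > 5" and PA: "P = A ` {1..n + 1}" and A1: "A 1 = A (n + 1)" and
    edge: "\<And>i. i \<in> {1..n} \<Longrightarrow> A i \<inter> A (i + 1) \<in> cell_edges (A i) \<inter> cell_edges (A (i + 1))" and
    inj: "\<And>i j. i \<in> {1..n} \<Longrightarrow> j \<in> {1..n} \<Longrightarrow> A i = A j \<Longrightarrow> i = j" and
    far: "\<And>i j. i \<in> {1..n} \<Longrightarrow> j \<in> {1..n} \<Longrightarrow> A i \<inter> A j \<noteq> {} \<Longrightarrow>
           \<exists>d\<in>{-2..2}. int j mod int n = (int i + d) mod int n"
    using assms unfolding closed_path_def by metis
  have "\<exists>z. A i = cell z" if "i \<in> {1..n + 1}" for i using PA pol that unfolding cells_def by blast
  then obtain a where a: "\<And>i. i \<in> {1..n + 1} \<Longrightarrow> A i = cell (a i)" by metis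
  \<comment> \<open>Representatives 1, ..., n of the residues; A (n + 1) = A 1 provides the step
    across the seam.\<close>
  define ix where "ix i = nat (i mod int n) + 1" for i
  have ix: "ix i \<in> {1..n}" for i
  proof -
    have "nat (i mod int n) < n" using n pos_mod_bound[of "int n" i] by (simp add: nat_less_iff)
    then show ?thesis unfolding ix_def by simp
  qed
  have ixi: "int (ix i) = i mod int n + 1" for i using n unfolding ix_def by simp
  define p where "p i = (int (fst (a (ix i))), int (snd (a (ix i))))" for i
  have ix': "ix i \<in> {1..n + 1}" for i using ix[of i] by auto
  have Acell: "A (ix i) = cell (fst (a (ix i)), snd (a (ix i)))" for i using a[OF ix'] by simp
  have p_A: "p i = p j \<longleftrightarrow> A (ix i) = A (ix j)" for i j
    unfolding p_def using a[OF ix'] by (auto simp: cell_inj prod_eq_iff)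
  have Asuc: "A (ix i + 1) = A (ix (i + 1))" for i
  proof (cases "ix i = n")
    case True
    then have "i mod int n = int n - 1" using ixi[of i] by simp
    then have "(i + 1) mod int n = 0" by (metis diff_add_cancel mod_add_left_eq mod_self)
    then show ?thesis using True A1 unfolding ix_def[of "i + 1"] by simp
  next
    case False
    then have "i mod int n + 1 < int n" using ix[of i] ixi[of i] by auto
    then have "(i + 1) mod int n = i mod int n + 1"
      using n by (metis mod_add_left_eq mod_pos_pos_trivial pos_mod_sign of_nat_0_less_iff add_nonneg_nonneg zero_le_one less_trans zero_less_numeral)
    then have "ix (i + 1) = ix i + 1" using ixi[of i] ixi[of "i + 1"] by linarith
    then show ?thesis by simp
  qed
  have "tile_cycle (int n) p" unfolding tile_cycle_def
  proof (intro conjI allI impI)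
    show "5 < int n" using n by simp
    show "p (i + int n) = p i" for i unfolding p_def ix_def by simp
    show "adjacent (p i) (p (i + 1))" for i
    proof -
      have "A (ix i) \<inter> A (ix (i + 1)) \<in> cell_edges (A (ix i))" using edge[OF ix[of i]] unfolding Asuc by blast
      then show ?thesis unfolding Acell[of i] Acell[of "i + 1"] p_def by (rule cell_Int_adjacent)
    qed
    show "int n dvd (i - j)" if "p i = p j" for i j
    proof -
      have "ix i = ix j" using that inj[OF ix ix] unfolding p_A by blast
      then have "i mod int n = j mod int n" using ixi[of i] ixi[of j] by simp
      then show ?thesis by (simp add: mod_eq_dvd_iff)
    qed
    show "\<exists>d\<in>{-2..2}. int n dvd (i - j - d)" if "near (p i) (p j)" for i j
    proof -
      have "A (ix j) \<inter> A (ix i) \<noteq> {}" using cell_Int_near that unfolding Acell[of i] Acell[of j] p_def by blast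
      then obtain d where d: "d \<in> {-2..2}" "int (ix i) mod int n = (int (ix j) + d) mod int n"
        using far[OF ix ix] by blast
      then have "int n dvd (int (ix i) - (int (ix j) + d))" by (simp add: mod_eq_dvd_iff)
      then have "int n dvd (i mod int n - (j mod int n + d))" unfolding ixi by (simp add: algebra_simps)
      moreover have "int n dvd (i - i mod int n)" "int n dvd (j - j mod int n)" by simp_all
      ultimately have "int n dvd ((i mod int n - (j mod int n + d)) + (i - i mod int n) - (j - j mod int n))"
        by (rule dvd_diff[OF dvd_add])
      then have "int n dvd (i - j - d)" by (simp add: algebra_simps)
      then show ?thesis using d(1) by blast
    qed
  qed
  moreover have "range p = int_tiles P"
  proof
    show "range p \<subseteq> int_tiles P"
    proof
      fix z assume "z \<in> range p"
      then obtain i where "z = p i" by blast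
      moreover have "A (ix i) \<in> P" using ix'[of i] PA by blast
      ultimately show "z \<in> int_tiles P" unfolding p_def int_tiles_def using Acell[of i] by simp
    qed
    show "int_tiles P \<subseteq> range p"
    proof
      fix z assume z: "z \<in> int_tiles P"
      obtain x y where xy: "z = (x, y)" by force
      have c: "0 \<le> x" "0 \<le> y" "cell (nat x, nat y) \<in> P" using z unfolding xy int_tiles_def by auto
      then obtain i where i: "i \<in> {1..n + 1}" "cell (nat x, nat y) = A i" using PA by blast
      \<comment> \<open>The last index n + 1 only repeats the tile of index 1.\<close>
      define j where "j = (if i = n + 1 then 1 else i)"
      have j: "j \<in> {1..n}" "A j = A i" using i(1) A1 n unfolding j_def by auto
      then have ij: "ix (int j - 1) = j" unfolding ix_def by (simp add: nat_diff_distrib)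
      have "j \<in> {1..n + 1}" using j(1) by simp
      from a[OF this] have "cell (nat x, nat y) = cell (a j)" using i(2) j(2) by simp
      then have "(nat x, nat y) = a (ix (int j - 1))" unfolding cell_inj ij .
      then have "z = p (int j - 1)" unfolding p_def xy using c by (metis fst_conv snd_conv int_nat_eq)
      then show "z \<in> range p" by blast
    qed
  qed
  ultimately show ?thesis by blast
qed

lemma int_tiles_dilate:
  assumes "m \<ge> 1" "n \<ge> 1"
  shows "int_tiles (dilate m n P) = dilated (int m) (int n) (int_tiles P)"
proof -
  have "(X, Y) \<in> int_tiles (dilate m n P) \<longleftrightarrow> (X, Y) \<in> dilated (int m) (int n) (int_tiles P)" for X Y
  proof (cases "0 \<le> X \<and> 0 \<le> Y")
    case True
    then have "nat (X div int m) = nat X div m" "nat (Y div int n) = nat Y div n"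
      by (simp_all add: nat_div_distrib)
    then show ?thesis using True assms
      by (simp add: int_tiles_def dilated_def dilate_iff pos_imp_zdiv_nonneg_iff)
  next
    case False
    then show ?thesis using assms by (auto simp: int_tiles_def dilated_def pos_imp_zdiv_nonneg_iff)
  qed
  then show ?thesis by auto
qed

section \<open>From swaps of multisets to the polyomino ideal\<close>

lemma inner_interval_iff:
  "inner_interval Q a b \<longleftrightarrow> proper a b \<and>
     (\<forall>x y. fst a \<le> x \<longrightarrow> x < fst b \<longrightarrow> snd a \<le> y \<longrightarrow> y < snd b \<longrightarrow> cell (x, y) \<in> Q)"
proof
  assume i: "inner_interval Q a b"
  have "cell (x, y) \<in> Q" if "fst a \<le> x" "x < fst b" "snd a \<le> y" "y < snd b" for x y
  proof -
    have "cell (x, y) \<subseteq> interval a b" using that by (auto simp: cell_eq interval_def)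
    then show ?thesis using i unfolding inner_interval_def by simp
  qed
  then show "proper a b \<and> (\<forall>x y. fst a \<le> x \<longrightarrow> x < fst b \<longrightarrow> snd a \<le> y \<longrightarrow> y < snd b \<longrightarrow> cell (x, y) \<in> Q)"
    using i unfolding inner_interval_def by blast
next
  assume h: "proper a b \<and> (\<forall>x y. fst a \<le> x \<longrightarrow> x < fst b \<longrightarrow> snd a \<le> y \<longrightarrow> y < snd b \<longrightarrow> cell (x, y) \<in> Q)"
  then have p: "fst a < fst b" "snd a < snd b" unfolding proper_def by auto
  have c: "cell (fst a, snd a) \<in> Q" "cell (fst b - 1, snd b - 1) \<in> Q"
    using h[THEN conjunct2, rule_format, of "fst a" "snd a"]
      h[THEN conjunct2, rule_format, of "fst b - 1" "snd b - 1"] p by auto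
  have "(fst a, snd a) \<in> cell (fst a, snd a)" "(fst b, snd b) \<in> cell (fst b - 1, snd b - 1)"
    using p by (simp_all add: cell_def interval_def mem_Times_iff)
  then have "a \<in> vertices Q" "b \<in> vertices Q" using c unfolding vertices_def by (metis UnionI prod.collapse)+
  moreover have "C \<in> Q" if C: "C \<in> cells" "C \<subseteq> interval a b" for C
  proof -
    obtain x y where xy: "C = cell (x, y)" using C(1) unfolding cells_def by auto
    have "(x, y) \<in> interval a b" "(Suc x, Suc y) \<in> interval a b" using C(2) unfolding xy cell_eq by auto
    then show ?thesis using h unfolding xy interval_def by auto
  qed
  ultimately show "inner_interval Q a b" using h unfolding inner_interval_def by blast
qed

text \<open>Induction on the size: if swaps can produce a common point, it is cancelled on both
  sides without affecting the height. If they cannot, the pair is disjoint, hence empty.\<close>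

lemma is_height_swap_connected:
  assumes nb: "\<And>u w c. disjoint_pair Q u w c \<Longrightarrow> u = {#}"
  shows "is_height Q u w c \<Longrightarrow> swap_connected Q u w"
proof (induction "size u" arbitrary: u w c rule: less_induct)
  case less
  show ?case
  proof (cases "\<exists>u' w' z. swap_connected Q u u' \<and> swap_connected Q w w' \<and> z \<in># u' \<and> z \<in># w'")
    case True
    then obtain u' w' z where e: "swap_connected Q u u'" "swap_connected Q w w'" and z: "z \<in># u'" "z \<in># w'" by blast
    obtain u1 w1 where uw: "u' = add_mset z u1" "w' = add_mset z w1" using z by (metis mset_add)
    obtain d where d: "is_height Q u' u d" using swap_connected_is_height[OF swap_connected_sym[OF e(1)]] by auto
    obtain d' where d': "is_height Q w w' d'" using swap_connected_is_height[OF e(2)] by auto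
    obtain h where h: "is_height Q u' w' h" using is_height_trans[OF is_height_trans[OF d less(2)] d'] by auto
    have "is_height Q u1 w1 h"
    proof (rule is_heightI)
      show "h z = 0" if "z \<notin> Q" for z using is_height_zero[OF h that] .
      fix x y show "int (count u1 (x, y)) - int (count w1 (x, y)) = h (x, y) - h (x - 1, y) - h (x, y - 1) + h (x - 1, y - 1)"
        using is_height_diff[OF h, of x y] by (simp add: uw split: if_splits)
    qed
    moreover have "size u1 < size u" using swap_connected_size[OF e(1)] uw by simp
    ultimately have "swap_connected Q u1 w1" using less(1) by blast
    then have "swap_connected Q u' w'" unfolding uw by (rule swap_connected_add)
    then show ?thesis using e swap_connected_sym[OF e(2)] by (meson rtranclp_trans)
  next
    case False
    then have b: "disjoint_pair Q u w c" by (intro disjoint_pairI[OF less(2)]) blast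
    have "u = {#}" "w = {#}" using nb[OF b] nb[OF disjoint_pair_swap[OF b]] by auto
    then show ?thesis by simp
  qed
qed

definition int_point :: "point \<Rightarrow> int \<times> int" where
  "int_point v = (int (fst v), int (snd v))"

definition mset_exponent :: "(int \<times> int) multiset \<Rightarrow> (point \<Rightarrow>\<^sub>0 nat)" where
  "mset_exponent W = (\<Sum>z\<in>#W. ev (nat (fst z), nat (snd z)))"

lemma mset_exponent_add [simp]: "mset_exponent (add_mset z W) = ev (nat (fst z), nat (snd z)) + mset_exponent W"
  by (simp add: mset_exponent_def)

lemma mset_exponent_keys:
  assumes "set_mset W \<subseteq> int_point ` V" shows "Poly_Mapping.keys (mset_exponent W) \<subseteq> V"
  using assms
proof (induction W)
  case (add z W)
  then show ?case by (auto simp: keys_add_nat int_point_def)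
qed (simp add: mset_exponent_def)

text \<open>A swap multiplies an inner binomial, or its negative, by a monomial, depending on the
  order of the corners; a degenerate swap changes nothing.\<close>

lemma corner_swap_mon:
  fixes Q :: "point set set" and Id :: "'k::field mpoly set"
  defines "Id \<equiv> polyomino_ideal Q"
  assumes corner_swap: "corner_swap (int_tiles Q) U W" and U: "set_mset U \<subseteq> int_point ` vertices Q"
  shows "set_mset W \<subseteq> int_point ` vertices Q \<and> mon (mset_exponent U) - mon (mset_exponent W) \<in> Id"
proof -
  have id: "Id = polyomino_ideal Q" by (simp add: Id_def)
  obtain x1 x2 y1 y2 r where f: "full_rect (int_tiles Q) x1 x2 y1 y2"
    and UW: "U = add_mset (x1, y1) (add_mset (x2, y2) r)" "W = add_mset (x1, y2) (add_mset (x2, y1) r)"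
    using corner_swap unfolding corner_swap_def by blast
  obtain a1 b1 a2 b2 where n: "x1 = int a1" "y1 = int b1" "x2 = int a2" "y2 = int b2"
    using U unfolding UW int_point_def by auto
  have r: "set_mset r \<subseteq> int_point ` vertices Q" using U UW by auto
  show ?thesis
  proof (cases "x1 = x2 \<or> y1 = y2")
    case True
    then have "U = W" unfolding UW by (auto simp: add_mset_commute)
    then show ?thesis using U Id_zero unfolding id by simp
  next
    case False
    define a where "a = (min a1 a2, min b1 b2)"
    define b where "b = (max a1 a2, max b1 b2)"
    have inn: "inner_interval Q a b" unfolding inner_interval_iff
    proof (intro conjI allI impI)
      show "proper a b" using False n unfolding proper_def a_def b_def by auto
      fix x y assume "fst a \<le> x" "x < fst b" "snd a \<le> y" "y < snd b"
      then have "min x1 x2 \<le> int x \<and> int x < max x1 x2 \<and> min y1 y2 \<le> int y \<and> int y < max y1 y2"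
        unfolding a_def b_def n by auto
      then have "(int x, int y) \<in> int_tiles Q" using f unfolding full_rect_def by blast
      then show "cell (x, y) \<in> Q" by (simp add: int_tiles_def)
    qed
    have vs: "(a1, b2) \<in> vertices Q" "(a2, b1) \<in> vertices Q"
      using inner_interval_corners[OF inn] unfolding a_def b_def by (auto simp: min_def max_def split: if_splits)
    have W: "set_mset W \<subseteq> int_point ` vertices Q"
      using r vs unfolding UW n by (auto simp: int_point_def image_iff) (metis fst_conv snd_conv)+
    have k: "Poly_Mapping.keys (mset_exponent r) \<subseteq> vertices Q" using mset_exponent_keys[OF r] .
    have m: "mon (mset_exponent r + (ev a + ev b)) - mon (mset_exponent r + (ev (fst a, snd b) + ev (fst b, snd a))) \<in> Id"
      unfolding id by (rule Id_move[OF inn k])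
    have m': "mon (mset_exponent r + (ev (fst a, snd b) + ev (fst b, snd a))) - mon (mset_exponent r + (ev a + ev b)) \<in> Id"
      using Id_uminus[of _ Q] m unfolding id by fastforce
    have "mset_exponent U = mset_exponent r + (ev (a1, b1) + ev (a2, b2))" "mset_exponent W = mset_exponent r + (ev (a1, b2) + ev (a2, b1))"
      unfolding UW n by (simp_all add: add_ac)
    moreover have "(ev a + ev b = ev (a1, b1) + ev (a2, b2) \<and>
        ev (fst a, snd b) + ev (fst b, snd a) = ev (a1, b2) + ev (a2, b1)) \<or>
       (ev a + ev b = ev (a1, b2) + ev (a2, b1) \<and>
        ev (fst a, snd b) + ev (fst b, snd a) = ev (a1, b1) + ev (a2, b2))"
      unfolding a_def b_def by (cases "a1 \<le> a2"; cases "b1 \<le> b2") (simp_all add: min_def max_def add.commute)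
    ultimately have "mon (mset_exponent U) - mon (mset_exponent W) \<in> Id" using m m' by auto
    then show ?thesis using W by blast
  qed
qed

lemma swap_connected_mon:
  fixes Q :: "point set set"
  assumes "swap_connected (int_tiles Q) U W" and U: "set_mset U \<subseteq> int_point ` vertices Q"
  shows "set_mset W \<subseteq> int_point ` vertices Q \<and> mon (mset_exponent U) - mon (mset_exponent W) \<in> (polyomino_ideal Q :: 'k::field mpoly set)"
  using assms(1)
proof (induction rule: rtranclp_induct)
  case base then show ?case using U Id_zero by simp
next
  case (step W W')
  then have W: "set_mset W \<subseteq> int_point ` vertices Q"
    and m: "mon (mset_exponent U) - mon (mset_exponent W) \<in> (polyomino_ideal Q :: 'k mpoly set)" by auto
  have s: "set_mset W' \<subseteq> int_point ` vertices Q" "mon (mset_exponent W) - mon (mset_exponent W') \<in> (polyomino_ideal Q :: 'k mpoly set)"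
    using corner_swap_mon[OF step(2) W] by auto
  show ?case using s(1) Id_add[OF m s(2)] by simp
qed

text \<open>The monomial map records, for each missing cell in a large box, how many factors lie in
  the lower left quadrant at that cell. For monomials in the vertices, equal images mean that the
  height of the pair vanishes off the polyomino.\<close>

theorem prime_if_no_disjoint_pair:
  fixes Q :: "point set set"
  assumes fin: "finite Q" "Q \<subseteq> cells" and nb: "\<And>u w c. disjoint_pair (int_tiles Q) u w c \<Longrightarrow> u = {#}"
  shows "primeideal (polyomino_ideal Q :: 'k::field mpoly set) (poly_ring (vertices Q))"
proof -
  define V where "V = vertices Q"
  have finV: "finite V" unfolding V_def by (rule finite_vertices[OF fin])
  have "finite (fst ` V \<union> snd ` V)" using finV by simp
  then obtain M where M': "\<And>x. x \<in> fst ` V \<union> snd ` V \<Longrightarrow> x \<le> M" by (meson finite_nat_set_iff_bounded_le)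
  have M: "fst v \<le> M" "snd v \<le> M" if "v \<in> V" for v using M' that by auto
  define C :: "(point \<Rightarrow>\<^sub>0 nat) \<Rightarrow> int \<Rightarrow> int \<Rightarrow> nat" where
    "C t x y = (\<Sum>v\<in>V. if int (fst v) \<le> x \<and> int (snd v) \<le> y then Poly_Mapping.lookup t v else 0)" for t x y
  \<comment> \<open>A finite box suffices: beyond the largest coordinate M the quadrant counts no
    longer change.\<close>
  define D where "D = {s \<in> {..M} \<times> {..M}. cell s \<notin> Q}"
  have finD: "finite D" unfolding D_def by simp
  define f where "f t = (\<Sum>s\<in>D. Poly_Mapping.single (prod_encode s) (C t (int (fst s)) (int (snd s))))" for t
  have C_add: "C (s + t) x y = C s x y + C t x y" for s t x y
    unfolding C_def by (simp add: lookup_add sum.distrib[symmetric] if_distrib cong: if_cong)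
  have f_lookup: "Poly_Mapping.lookup (f t) (prod_encode s) = C t (int (fst s)) (int (snd s))" if "s \<in> D" for s t
    using finD that by (simp add: f_def lookup_sum lookup_single when_def prod_encode_eq)
  have C_ev: "C (ev v) x y = (if int (fst v) \<le> x \<and> int (snd v) \<le> y then 1 else 0)" if "v \<in> V" for v x y
  proof -
    have "C (ev v) x y = (\<Sum>v'\<in>V. if v' = v then (if int (fst v) \<le> x \<and> int (snd v) \<le> y then 1 else 0) else 0)"
      unfolding C_def by (intro sum.cong) (auto simp: lookup_single when_def)
    then show ?thesis using finV that by simp
  qed
  define U where "U t = (\<Sum>v\<in>V. replicate_mset (Poly_Mapping.lookup t v) (int_point v))" for t
  have int_point_inj: "int_point v = int_point v' \<longleftrightarrow> v = v'" for v v' by (auto simp: int_point_def prod_eq_iff)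
  have cntU: "int (count (U t) (x, y)) = (\<Sum>v\<in>V. if int_point v = (x, y) then int (Poly_Mapping.lookup t v) else 0)" for t x y
    unfolding U_def by (simp add: count_sum if_distrib eq_commute[of "(x, y)"] cong: if_cong)
  have setU: "set_mset (U t) \<subseteq> int_point ` V" for t
    unfolding U_def using finV by (induction V rule: finite_induct) (auto simp: in_replicate_mset)
  have mset_exponent_plus: "mset_exponent (A + B) = mset_exponent A + mset_exponent B" for A B by (simp add: mset_exponent_def)
  have mset_exponent_rep: "mset_exponent (replicate_mset k (int_point v)) = Poly_Mapping.single v k" for k v
    by (induction k) (simp_all add: int_point_def mset_exponent_def[of "{#}"] single_add[symmetric])
  have mset_exponent_sum: "finite A \<Longrightarrow> mset_exponent (\<Sum>v\<in>A. g v) = (\<Sum>v\<in>A. mset_exponent (g v))" for A and g :: "point \<Rightarrow> _"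
    by (induction A rule: finite_induct) (simp_all add: mset_exponent_plus mset_exponent_def[of "{#}"])
  have monUU: "mset_exponent (U t) = t" if "Poly_Mapping.keys t \<subseteq> V" for t
  proof -
    have "mset_exponent (U t) = (\<Sum>v\<in>V. Poly_Mapping.single v (Poly_Mapping.lookup t v))"
      unfolding U_def by (simp add: mset_exponent_sum[OF finV] mset_exponent_rep)
    also have "\<dots> = (\<Sum>v\<in>Poly_Mapping.keys t. Poly_Mapping.single v (Poly_Mapping.lookup t v))"
      using finV that by (intro sum.mono_neutral_right) (auto simp: in_keys_iff)
    also have "\<dots> = t" by (rule sum_single_lookup[symmetric])
    finally show ?thesis .
  qed
  show ?thesis
  proof (rule prime_if_connected[where f = f])
    show "f (s + t) = f s + f t" for s t unfolding f_def C_add by (simp add: single_add sum.distrib)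
  next
    fix a b assume i: "inner_interval Q a b"
    note cs = inner_interval_corners[OF i, folded V_def]
    have eq: "C (ev a + ev b) (int x) (int y) = C (ev (fst a, snd b) + ev (fst b, snd a)) (int x) (int y)"
      if "(x, y) \<in> D" for x y
    proof -
      have "cell (x, y) \<notin> Q" using that unfolding D_def by auto
      then have no: "\<not> (fst a \<le> x \<and> x < fst b \<and> snd a \<le> y \<and> y < snd b)" "fst a < fst b" "snd a < snd b"
        using i unfolding inner_interval_iff proper_def by blast+
      show ?thesis unfolding C_add C_ev[OF cs(1)] C_ev[OF cs(2)] C_ev[OF cs(3)] C_ev[OF cs(4)]
        using no by auto
    qed
    show "f (ev a + ev b) = f (ev (fst a, snd b) + ev (fst b, snd a))"
      unfolding f_def by (rule sum.cong) (use eq in auto)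
  next
    fix s t assume k: "Poly_Mapping.keys s \<subseteq> vertices Q" "Poly_Mapping.keys t \<subseteq> vertices Q" and st: "f s = f t"
    define c where "c = (\<lambda>(x, y). int (C s x y) - int (C t x y))"
    have clip: "C r x y = C r (min x (int M)) (min y (int M))" for r x y
      unfolding C_def using M by (intro sum.cong) auto
    have cz: "c (x, y) = 0" if "(x, y) \<notin> int_tiles Q" for x y
    proof (cases "0 \<le> x \<and> 0 \<le> y")
      case False
      then have "C r x y = 0" for r unfolding C_def by (intro sum.neutral) auto
      then show ?thesis unfolding c_def by simp
    next
      case True
      define x' where "x' = min (nat x) M"
      define y' where "y' = min (nat y) M"
      have xy: "min x (int M) = int x'" "min y (int M) = int y'" using True unfolding x'_def y'_def by auto
      \<comment> \<open>The upper right vertex of a cell of the polyomino lies in the box, so for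
        such a cell clipping to the box would not have moved (x, y).\<close>
      have "cell (x', y') \<notin> Q"
      proof
        assume c: "cell (x', y') \<in> Q"
        have "(Suc x', Suc y') \<in> cell (x', y')" by (simp add: cell_eq)
        then have "(Suc x', Suc y') \<in> V" using c unfolding V_def vertices_def by blast
        then have "Suc x' \<le> M" "Suc y' \<le> M" using M by fastforce+
        then have "x' = nat x" "y' = nat y" unfolding x'_def y'_def by auto
        then show False using c that True by (simp add: int_tiles_def)
      qed
      then have "(x', y') \<in> D" unfolding D_def x'_def y'_def by auto
      then have "C s (int x') (int y') = C t (int x') (int y')" using f_lookup[of "(x', y')"] st by (metis fst_conv snd_conv)
      then show ?thesis unfolding c_def using clip[of s x y] clip[of t x y] xy by simp
    qed
    have Cd: "int (C r x y) - int (C r (x - 1) y) - int (C r x (y - 1)) + int (C r (x - 1) (y - 1)) = int (count (U r) (x, y))"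
      for r x y
      unfolding cntU C_def of_nat_sum sum_subtractf[symmetric] sum.distrib[symmetric]
      by (intro sum.cong) (auto simp: int_point_def)
    have "is_height (int_tiles Q) (U s) (U t) c"
    proof (rule is_heightI)
      show "c z = 0" if "z \<notin> int_tiles Q" for z using cz that by (cases z) auto
      fix x y show "int (count (U s) (x, y)) - int (count (U t) (x, y)) =
        c (x, y) - c (x - 1, y) - c (x, y - 1) + c (x - 1, y - 1)"
        unfolding c_def Cd[symmetric] by simp
    qed
    then have "swap_connected (int_tiles Q) (U s) (U t)" by (rule is_height_swap_connected[rotated]) (rule nb)
    then have "mon (mset_exponent (U s)) - mon (mset_exponent (U t)) \<in> (polyomino_ideal Q :: 'k mpoly set)"
      using swap_connected_mon setU unfolding V_def by blast
    then show "(mon s :: 'k mpoly) - mon t \<in> polyomino_ideal Q"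
      using monUU k unfolding V_def by simp
  qed
qed

section \<open>The rectangle with two given opposite corners\<close>

definition lower_corner :: "point \<Rightarrow> point \<Rightarrow> point" where
  "lower_corner v z = (min (fst v) (fst z), min (snd v) (snd z))"

definition upper_corner :: "point \<Rightarrow> point \<Rightarrow> point" where
  "upper_corner v z = (max (fst v) (fst z), max (snd v) (snd z))"

text \<open>The points v and z are diagonal or anti-diagonal according to whether both coordinates
  change in the same direction; u is the corner that v' leaves over.\<close>

lemma lower_upper_corner_corners:
  assumes "fst v \<noteq> fst z" "snd v \<noteq> snd z" and "v' = (fst v, snd z) \<or> v' = (fst z, snd v)"
  shows "\<exists>u. {v, z} = diag_corners (lower_corner v z) (upper_corner v z) \<and> {u, v'} = antidiag_corners (lower_corner v z) (upper_corner v z) \<or>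
     {v, z} = antidiag_corners (lower_corner v z) (upper_corner v z) \<and> {u, v'} = diag_corners (lower_corner v z) (upper_corner v z)"
proof -
  define u where "u = (if v' = (fst v, snd z) then (fst z, snd v) else (fst v, snd z))"
  have u: "{u, v'} = {(fst v, snd z), (fst z, snd v)}" using assms unfolding u_def by auto
  have vz: "{v, z} = {(fst v, snd v), (fst z, snd z)}" by simp
  show ?thesis
  proof (cases "(fst v < fst z) = (snd v < snd z)")
    case True
    then have "{v, z} = diag_corners (lower_corner v z) (upper_corner v z) \<and> {u, v'} = antidiag_corners (lower_corner v z) (upper_corner v z)"
      unfolding u vz diag_corners_def antidiag_corners_def lower_corner_def upper_corner_def using assms(1,2)
      by (cases "fst v < fst z") (auto simp: min_def max_def)
    then show ?thesis by blast
  next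
    case False
    then have "{v, z} = antidiag_corners (lower_corner v z) (upper_corner v z) \<and> {u, v'} = diag_corners (lower_corner v z) (upper_corner v z)"
      unfolding u vz diag_corners_def antidiag_corners_def lower_corner_def upper_corner_def using assms(1,2)
      by (cases "fst v < fst z") (auto simp: min_def max_def)
    then show ?thesis by blast
  qed
qed

lemma inner_edge_intervals:
  assumes i: "inner_interval Q a b"
  shows "y0 = snd a \<or> y0 = snd b \<Longrightarrow> edge_interval Q (fst a, y0) (fst b, y0)"
    and "x0 = fst a \<or> x0 = fst b \<Longrightarrow> edge_interval Q (x0, snd a) (x0, snd b)"
proof -
  have p: "fst a < fst b" "snd a < snd b"
    and c: "\<And>x y. fst a \<le> x \<Longrightarrow> x < fst b \<Longrightarrow> snd a \<le> y \<Longrightarrow> y < snd b \<Longrightarrow> cell (x, y) \<in> Q"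
    using i unfolding inner_interval_iff proper_def by auto
  note cs = inner_interval_corners[OF i]
  have e: "{s, t} \<in> edges Q" if "cell z \<in> Q" "s \<in> cell z" "t \<in> cell z"
    "t = (Suc (fst s), snd s) \<or> t = (fst s, Suc (snd s))" for s t z
    unfolding edges_def cell_edges_def using that by blast
  show "edge_interval Q (fst a, y0) (fst b, y0)" if y0: "y0 = snd a \<or> y0 = snd b"
    unfolding edge_interval_def horizontal_edge_interval_def
  proof (intro disjI1 conjI ballI)
    show "(fst a, y0) \<in> vertices Q" "(fst b, y0) \<in> vertices Q" using y0 cs by auto
    show "fst (fst a, y0) \<le> fst (fst b, y0)" "snd (fst a, y0) = snd (fst b, y0)" using p by auto
    fix x assume "x \<in> {fst (fst a, y0)..<fst (fst b, y0)}"
    then have x: "fst a \<le> x" "x < fst b" by auto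
    have "cell (x, if y0 = snd a then y0 else y0 - 1) \<in> Q" by (rule c) (use x y0 p in auto)
    then show "{(x, snd (fst a, y0)), (Suc x, snd (fst a, y0))} \<in> edges Q"
      by (rule e) (use y0 p in \<open>auto simp: cell_def interval_def\<close>)
  qed
  show "edge_interval Q (x0, snd a) (x0, snd b)" if x0: "x0 = fst a \<or> x0 = fst b"
    unfolding edge_interval_def vertical_edge_interval_def
  proof (intro disjI2 conjI ballI)
    show "(x0, snd a) \<in> vertices Q" "(x0, snd b) \<in> vertices Q" using x0 cs by auto
    show "fst (x0, snd a) = fst (x0, snd b)" "snd (x0, snd a) \<le> snd (x0, snd b)" using p by auto
    fix y assume "y \<in> {snd (x0, snd a)..<snd (x0, snd b)}"
    then have y: "snd a \<le> y" "y < snd b" by auto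
    have "cell (if x0 = fst a then x0 else x0 - 1, y) \<in> Q" by (rule c) (use y x0 p in auto)
    then show "{(fst (x0, snd a), y), (fst (x0, snd a), Suc y)} \<in> edges Q"
      by (rule e) (use x0 p in \<open>auto simp: cell_def interval_def\<close>)
  qed
qed

lemma lower_upper_corner_edge:
  assumes "inner_interval Q (lower_corner v z) (upper_corner v z)" and "v' = (fst v, snd z) \<or> v' = (fst z, snd v)"
  shows "\<exists>a b. edge_interval Q a b \<and> v \<in> interval a b \<and> v' \<in> interval a b"
  using assms(2)
proof
  assume v': "v' = (fst v, snd z)"
  have "edge_interval Q (fst v, snd (lower_corner v z)) (fst v, snd (upper_corner v z))"
    by (rule inner_edge_intervals(2)[OF assms(1)]) (auto simp: lower_corner_def upper_corner_def)
  moreover have "v \<in> interval (fst v, snd (lower_corner v z)) (fst v, snd (upper_corner v z))"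
    "v' \<in> interval (fst v, snd (lower_corner v z)) (fst v, snd (upper_corner v z))"
    by (auto simp: v' lower_corner_def upper_corner_def interval_def mem_Times_iff)
  ultimately show ?thesis by blast
next
  assume v': "v' = (fst z, snd v)"
  have "edge_interval Q (fst (lower_corner v z), snd v) (fst (upper_corner v z), snd v)"
    by (rule inner_edge_intervals(1)[OF assms(1)]) (auto simp: lower_corner_def upper_corner_def)
  moreover have "v \<in> interval (fst (lower_corner v z), snd v) (fst (upper_corner v z), snd v)"
    "v' \<in> interval (fst (lower_corner v z), snd v) (fst (upper_corner v z), snd v)"
    by (auto simp: v' lower_corner_def upper_corner_def interval_def mem_Times_iff)
  ultimately show ?thesis by blast
qed

text \<open>Division by m is monotone and onto, so every intermediate quotient is attained; t * m,
  raised to the lower bound if necessary, is a witness.\<close>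

lemma div_hull:
  fixes x x' m t :: nat
  assumes "m > 0" "min (x div m) (x' div m) \<le> t" "t \<le> max (x div m) (x' div m)"
  shows "\<exists>X. min x x' \<le> X \<and> X \<le> max x x' \<and> X div m = t"
proof -
  have mono: "mono (\<lambda>x. x div m)" by (simp add: div_le_mono monoI)
  have t: "min x x' div m \<le> t" "t \<le> max x x' div m"
    using assms(2,3) min_of_mono[OF mono, of x x'] max_of_mono[OF mono, of x x'] by simp_all
  then have le: "t * m \<le> max x x'" using assms(1) by (simp add: less_eq_div_iff_mult_less_eq)
  have "max (min x x') (t * m) div m = t"
    using max_of_mono[OF mono, of "min x x'" "t * m"] t(1) assms(1) by simp
  with le show ?thesis by (intro exI[of _ "max (min x x') (t * m)"]) auto
qed

section \<open>The zig-zag walk in the dilated path\<close>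

context
  fixes N :: int and p :: "int \<Rightarrow> int \<times> int" and P :: "point set set" and m n :: nat
  assumes c: "tile_cycle N p" and ab: "no_good_end p" and rp: "range p = int_tiles P" and m: "m \<ge> 1" "n \<ge> 1"
begin

definition scaled :: "int \<times> int \<Rightarrow> point" where
  "scaled w = (m * nat (fst w), n * nat (snd w))"

lemma p_nonneg: "fst (p i) \<ge> 0" "snd (p i) \<ge> 0"
proof -
  have "p i \<in> int_tiles P" using rp by blast
  then show "fst (p i) \<ge> 0" "snd (p i) \<ge> 0" by (auto simp: int_tiles_def)
qed

lemma VZ_nonneg: "fst (walk_vertex p k) \<ge> 0" "snd (walk_vertex p k) \<ge> 0" "fst (outer_vertex p k) \<ge> 0" "snd (outer_vertex p k) \<ge> 0"
  unfolding walk_vertex_def outer_vertex_def using p_nonneg[of k] by auto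

lemma cell_tile: "cell (x, y) \<in> dilate m n P \<longleftrightarrow> (int (x div m), int (y div n)) \<in> range p"
  unfolding dilate_iff rp int_tiles_def by (simp add: nat_div_distrib flip: zdiv_int)

lemma min_mult: "min (m * a) (m * b) = m * min a b" "max (m * a) (m * b) = m * max a b"
   "min (n * a) (n * b) = n * min a b" "max (n * a) (n * b) = n * max a b"
  by (simp_all add: nat_mult_min_right nat_mult_max_right)

lemma walk_link_inner:
  assumes l: "walk_link p k k'"
  shows "inner_interval (dilate m n P) (lower_corner (scaled (walk_vertex p k)) (scaled (outer_vertex p k'))) (upper_corner (scaled (walk_vertex p k)) (scaled (outer_vertex p k')))"
    (is "inner_interval ?Q ?a ?b")
proof -
  define a b a' b' where d: "a = nat (fst (walk_vertex p k))" "b = nat (snd (walk_vertex p k))"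
     "a' = nat (fst (outer_vertex p k'))" "b' = nat (snd (outer_vertex p k'))"
  have i: "fst (walk_vertex p k) = int a" "snd (walk_vertex p k) = int b" "fst (outer_vertex p k') = int a'" "snd (outer_vertex p k') = int b'"
    unfolding d using VZ_nonneg by auto
  have ne: "a \<noteq> a'" "b \<noteq> b'" and t: "\<And>x y. min (int a) (int a') \<le> x \<Longrightarrow> x < max (int a) (int a') \<Longrightarrow>
       min (int b) (int b') \<le> y \<Longrightarrow> y < max (int b) (int b') \<Longrightarrow> (x, y) \<in> range p"
    using l unfolding walk_link_def i by simp_all
  have ab: "?a = (m * min a a', n * min b b')" "?b = (m * max a a', n * max b b')"
    unfolding lower_corner_def upper_corner_def scaled_def d by (simp_all add: min_mult)
  show ?thesis unfolding inner_interval_iff ab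
  proof (intro conjI allI impI)
    show "proper (m * min a a', n * min b b') (m * max a a', n * max b b')"
      using ne m unfolding proper_def by auto
    fix x y assume h: "fst (m * min a a', n * min b b') \<le> x" "x < fst (m * max a a', n * max b b')"
      "snd (m * min a a', n * min b b') \<le> y" "y < snd (m * max a a', n * max b b')"
    have "min a a' \<le> x div m" "x div m < max a a'" "min b b' \<le> y div n" "y div n < max b b'"
      using h m by (simp_all add: less_eq_div_iff_mult_less_eq div_less_iff_less_mult mult.commute)
    then have "(int (x div m), int (y div n)) \<in> range p" by (intro t) linarith+
    then show "cell (x, y) \<in> ?Q" unfolding cell_tile .
  qed
qed

lemma walk_link_ne:
  assumes l: "walk_link p k k'"
  shows "fst (scaled (walk_vertex p k)) \<noteq> fst (scaled (outer_vertex p k'))" "snd (scaled (walk_vertex p k)) \<noteq> snd (scaled (outer_vertex p k'))"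
    "scaled (walk_vertex p k') = (fst (scaled (walk_vertex p k)), snd (scaled (outer_vertex p k'))) \<or> scaled (walk_vertex p k') = (fst (scaled (outer_vertex p k')), snd (scaled (walk_vertex p k)))"
proof -
  have "fst (walk_vertex p k) \<noteq> fst (outer_vertex p k')" "snd (walk_vertex p k) \<noteq> snd (outer_vertex p k')"
    and v: "walk_vertex p k' = (fst (walk_vertex p k), snd (outer_vertex p k')) \<or> walk_vertex p k' = (fst (outer_vertex p k'), snd (walk_vertex p k))"
    using l unfolding walk_link_def by simp_all
  then show "fst (scaled (walk_vertex p k)) \<noteq> fst (scaled (outer_vertex p k'))" "snd (scaled (walk_vertex p k)) \<noteq> snd (scaled (outer_vertex p k'))"
    using m VZ_nonneg unfolding scaled_def by (simp_all add: eq_nat_nat_iff)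
  show "scaled (walk_vertex p k') = (fst (scaled (walk_vertex p k)), snd (scaled (outer_vertex p k'))) \<or> scaled (walk_vertex p k') = (fst (scaled (outer_vertex p k')), snd (scaled (walk_vertex p k)))"
    using v unfolding scaled_def by auto
qed

text \<open>One coordinate of the intersection of two consecutive intervals. The sign g puts one
  interval on one side of c and the other on the opposite side, so only the scaled c
  remains.\<close>

lemma quadrant:
  assumes g: "(g::int) = 1 \<or> g = -1" and nn: "a \<ge> 0" "b \<ge> 0" "c \<ge> 0" "d \<ge> 0" "e \<ge> 0"
    and 1: "g * (a - c) \<le> 0" "g * (b - c) \<le> 0" and 2: "g * (d - e) \<ge> 0" and ce: "c = e"
    and x: "min (k * nat a) (k * nat b) \<le> x" "x \<le> max (k * nat a) (k * nat b)"
      "min (k * nat e) (k * nat d) \<le> x" "x \<le> max (k * nat e) (k * nat d)"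
  shows "x = k * nat c"
  using g
proof
  assume "g = 1"
  then have o: "nat a \<le> nat c" "nat b \<le> nat c" "nat c \<le> nat d" using 1 2 ce by auto
  have h: "k * nat a \<le> k * nat c" "k * nat b \<le> k * nat c" "k * nat c \<le> k * nat d" using o by (simp_all add: mult_le_mono2)
  have "x \<le> k * nat c" using x(2) max.boundedI[OF h(1,2)] by (rule order_trans)
  moreover have "k * nat c \<le> x" using min.boundedI[OF order_refl h(3)] x(3)[folded ce] by (rule order_trans)
  ultimately show ?thesis by (rule order_antisym)
next
  assume "g = -1"
  then have o: "nat a \<ge> nat c" "nat b \<ge> nat c" "nat c \<ge> nat d" using 1 2 ce by auto
  have h: "k * nat a \<ge> k * nat c" "k * nat b \<ge> k * nat c" "k * nat c \<ge> k * nat d" using o by (simp_all add: mult_le_mono2)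
  have "x \<le> k * nat c" using x(4)[folded ce] max.boundedI[OF order_refl h(3)] by (rule order_trans)
  moreover have "k * nat c \<le> x" using min.boundedI[OF h(1,2)] x(1) by (rule order_trans)
  ultimately show ?thesis by (rule order_antisym)
qed

text \<open>The end of one link and the start of the next need only agree as tiles, not as indices;
  this covers the closing step of the walk, where the indices differ by N.\<close>

lemma walk_link_Int:
  assumes l: "walk_link p k k'" "walk_link p h h'" and e: "p k' = p h" "p (k' + 2) = p (h + 2)"
  shows "interval (lower_corner (scaled (walk_vertex p k)) (scaled (outer_vertex p k'))) (upper_corner (scaled (walk_vertex p k)) (scaled (outer_vertex p k'))) \<inter>
    interval (lower_corner (scaled (walk_vertex p h)) (scaled (outer_vertex p h'))) (upper_corner (scaled (walk_vertex p h)) (scaled (outer_vertex p h'))) = {scaled (walk_vertex p k')}"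
    (is "?A \<inter> ?B = _")
proof -
  have V: "walk_vertex p h = walk_vertex p k'" unfolding walk_vertex_def e ..
  define gx where "gx = fst (p (h + 2)) - fst (p h)"
  define gy where "gy = snd (p (h + 2)) - snd (p h)"
  have g: "gx = 1 \<or> gx = -1" "gy = 1 \<or> gy = -1"
    "gx * (fst (outer_vertex p h') - fst (walk_vertex p k')) \<ge> 0" "gy * (snd (outer_vertex p h') - snd (walk_vertex p k')) \<ge> 0"
    using l(2) unfolding walk_link_def Let_def gx_def gy_def V by simp_all
  have g': "gx * (fst (outer_vertex p k') - fst (walk_vertex p k')) \<le> 0" "gy * (snd (outer_vertex p k') - snd (walk_vertex p k')) \<le> 0"
    "gx * (fst (walk_vertex p k) - fst (walk_vertex p k')) \<le> 0" "gy * (snd (walk_vertex p k) - snd (walk_vertex p k')) \<le> 0"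
    using l(1) unfolding walk_link_def Let_def gx_def gy_def e by simp_all
  have "z = scaled (walk_vertex p k')" if "z \<in> ?A" "z \<in> ?B" for z
  proof -
    obtain x y where z: "z = (x, y)" by force
    have h: "min (m * nat (fst (walk_vertex p k))) (m * nat (fst (outer_vertex p k'))) \<le> x" "x \<le> max (m * nat (fst (walk_vertex p k))) (m * nat (fst (outer_vertex p k')))"
      "min (n * nat (snd (walk_vertex p k))) (n * nat (snd (outer_vertex p k'))) \<le> y" "y \<le> max (n * nat (snd (walk_vertex p k))) (n * nat (snd (outer_vertex p k')))"
      "min (m * nat (fst (walk_vertex p k'))) (m * nat (fst (outer_vertex p h'))) \<le> x" "x \<le> max (m * nat (fst (walk_vertex p k'))) (m * nat (fst (outer_vertex p h')))"
      "min (n * nat (snd (walk_vertex p k'))) (n * nat (snd (outer_vertex p h'))) \<le> y" "y \<le> max (n * nat (snd (walk_vertex p k'))) (n * nat (snd (outer_vertex p h')))"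
      using that unfolding z interval_def lower_corner_def upper_corner_def scaled_def V by (simp_all del: min_mult)
    have "x = m * nat (fst (walk_vertex p k'))"
      by (rule quadrant[OF g(1) VZ_nonneg(1) VZ_nonneg(3) VZ_nonneg(1) VZ_nonneg(3) VZ_nonneg(1) g'(3,1) g(3) refl h(1,2,5,6)])
    moreover have "y = n * nat (snd (walk_vertex p k'))"
      by (rule quadrant[OF g(2) VZ_nonneg(2) VZ_nonneg(4) VZ_nonneg(2) VZ_nonneg(4) VZ_nonneg(2) g'(4,2) g(4) refl h(3,4,7,8)])
    ultimately show ?thesis unfolding z scaled_def by simp
  qed
  moreover have "scaled (walk_vertex p k') \<in> ?A" using walk_link_ne(3)[OF l(1)]
    by (auto simp: interval_def lower_corner_def upper_corner_def mem_Times_iff)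
  moreover have "scaled (walk_vertex p k') \<in> ?B" unfolding V by (auto simp: interval_def lower_corner_def upper_corner_def mem_Times_iff)
  ultimately show ?thesis by blast
qed

text \<open>An inner interval through a vertex contains a cell at that vertex. At a scaled outer
  vertex such a cell lies in a tile touching the outer vertex, and the only one on the path is p
  k.\<close>

lemma touching_cell:
  assumes e: "block_end p k" and i: "inner_interval (dilate m n P) a b" and z: "scaled (outer_vertex p k) \<in> interval a b"
  shows "\<exists>x y. fst a \<le> x \<and> x < fst b \<and> snd a \<le> y \<and> y < snd b \<and> (int (x div m), int (y div n)) = p k"
proof -
  have p: "fst a < fst b" "snd a < snd b"
    and cl: "\<And>x y. fst a \<le> x \<Longrightarrow> x < fst b \<Longrightarrow> snd a \<le> y \<Longrightarrow> y < snd b \<Longrightarrow> cell (x, y) \<in> dilate m n P"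
    using i unfolding inner_interval_iff proper_def by auto
  \<comment> \<open>If the vertex is the upper bound of the range, the cell just before it is taken,
    which lies in the preceding tile.\<close>
  have near: "\<exists>x. A \<le> x \<and> x < B \<and> int (x div k) \<le> Z \<and> Z - 1 \<le> int (x div k)"
    if "A < B" "A \<le> k * nat Z" "k * nat Z \<le> B" "Z \<ge> 0" "k \<ge> 1" for A B k :: nat and Z
  proof (cases "k * nat Z < B")
    case True
    then show ?thesis using that by (intro exI[of _ "k * nat Z"]) auto
  next
    case False
    then have B: "B = k * nat Z" using that by simp
    then have "nat Z \<ge> 1" using that(1) by (cases "nat Z") auto
    then have "k * nat Z - 1 = k * (nat Z - 1) + (k - 1)" using that(5) by (simp add: algebra_simps)
    moreover have "(k * (nat Z - 1) + (k - 1)) div k = nat Z - 1" using that(5) by (intro div_nat_eqI) auto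
    ultimately have "(k * nat Z - 1) div k = nat Z - 1" by simp
    then show ?thesis using that B \<open>nat Z \<ge> 1\<close> by (intro exI[of _ "k * nat Z - 1"]) auto
  qed
  have z': "fst a \<le> m * nat (fst (outer_vertex p k))" "m * nat (fst (outer_vertex p k)) \<le> fst b"
    "snd a \<le> n * nat (snd (outer_vertex p k))" "n * nat (snd (outer_vertex p k)) \<le> snd b"
    using z unfolding interval_def scaled_def by auto
  obtain x where x: "fst a \<le> x" "x < fst b" "int (x div m) \<le> fst (outer_vertex p k)" "fst (outer_vertex p k) - 1 \<le> int (x div m)"
    using near[OF p(1) z'(1,2) VZ_nonneg(3) m(1)] by auto
  obtain y where y: "snd a \<le> y" "y < snd b" "int (y div n) \<le> snd (outer_vertex p k)" "snd (outer_vertex p k) - 1 \<le> int (y div n)"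
    using near[OF p(2) z'(3,4) VZ_nonneg(4) m(2)] by auto
  have "(int (x div m), int (y div n)) \<in> range p" using cl[OF x(1,2) y(1,2)] unfolding cell_tile .
  then have "(int (x div m), int (y div n)) = p k" using outer_vertex_touch[OF c e] x y by blast
  then show ?thesis using x y by blast
qed

text \<open>An inner interval through both outer vertices has a cell in each of the two tiles, so it
  meets every tile of the rectangle they span, and \<open>ends_separated\<close> applies.\<close>

lemma zs_separated:
  assumes e: "block_end p k" "block_end p k'" "p k \<noteq> p k'" and i: "inner_interval (dilate m n P) a b"
    and z: "scaled (outer_vertex p k) \<in> interval a b" "scaled (outer_vertex p k') \<in> interval a b"
  shows False
proof -
  have cl: "\<And>x y. fst a \<le> x \<Longrightarrow> x < fst b \<Longrightarrow> snd a \<le> y \<Longrightarrow> y < snd b \<Longrightarrow> cell (x, y) \<in> dilate m n P"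
    using i unfolding inner_interval_iff proper_def by auto
  obtain x y where x: "fst a \<le> x" "x < fst b" "snd a \<le> y" "y < snd b" "p k = (int (x div m), int (y div n))"
    using touching_cell[OF e(1) i z(1)] by auto
  obtain x' y' where x': "fst a \<le> x'" "x' < fst b" "snd a \<le> y'" "y' < snd b" "p k' = (int (x' div m), int (y' div n))"
    using touching_cell[OF e(2) i z(2)] by auto
  show False
  proof (rule ends_separated[OF c ab e(1,2) e(3)[symmetric]])
    fix s t assume h: "min (fst (p k)) (fst (p k')) \<le> s" "s \<le> max (fst (p k)) (fst (p k'))"
      "min (snd (p k)) (snd (p k')) \<le> t" "t \<le> max (snd (p k)) (snd (p k'))"
    then have "0 \<le> s" "0 \<le> t" using p_nonneg[of k] p_nonneg[of k'] by linarith+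
    then obtain s' t' where st: "s = int s'" "t = int t'" by (metis nonneg_int_cases)
    have s: "min (x div m) (x' div m) \<le> s'" "s' \<le> max (x div m) (x' div m)"
      and t: "min (y div n) (y' div n) \<le> t'" "t' \<le> max (y div n) (y' div n)"
      using h unfolding x(5) x'(5) st fst_conv snd_conv by linarith+
    obtain X where X: "min x x' \<le> X" "X \<le> max x x'" "X div m = s'" using div_hull[OF _ s] m by auto
    obtain Y where Y: "min y y' \<le> Y" "Y \<le> max y y'" "Y div n = t'" using div_hull[OF _ t] m by auto
    have "cell (X, Y) \<in> dilate m n P" by (rule cl) (use X(1,2) Y(1,2) x x' in linarith)+
    then show "(s, t) \<in> range p" unfolding cell_tile X(3) Y(3) st .
  qed
qed

theorem zigzag_exists: "\<exists>r I. zigzag_walk (dilate m n P) r I"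
proof -
  obtain r E where r: "r \<ge> 1" and en: "\<And>i. block_end p (E i)" and l: "\<And>i. walk_link p (E i) (E (Suc i))"
    and Er: "E r = E 0 + N" and ne: "\<And>i j. 1 \<le> i \<Longrightarrow> i < j \<Longrightarrow> j \<le> r \<Longrightarrow> p (E i) \<noteq> p (E j)"
    using zigzag_data[OF c ab] by (elim exE conjE) blast
  let ?Q = "dilate m n P"
  \<comment> \<open>The walk counts from 1: its interval i goes from the walk vertex of the end i -
    1 to the outer vertex of the end i.\<close>
  define v where "v i = scaled (walk_vertex p (E (i - 1)))" for i
  define z where "z i = scaled (outer_vertex p (E i))" for i
  define I where "I i = interval (lower_corner (v i) (z i)) (upper_corner (v i) (z i))" for i
  have li: "walk_link p (E (i - 1)) (E i)" if "i \<ge> 1" for i using l[of "i - 1"] that by simp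
  have v': "v (i + 1) = scaled (walk_vertex p (E i))" for i unfolding v_def by simp
  have inn: "inner_interval ?Q (lower_corner (v i) (z i)) (upper_corner (v i) (z i))" if "i \<ge> 1" for i
    unfolding v_def z_def by (rule walk_link_inner[OF li[OF that]])
  have vz: "v (i + 1) = (fst (v i), snd (z i)) \<or> v (i + 1) = (fst (z i), snd (v i))" if "i \<ge> 1" for i
    unfolding v' unfolding v_def z_def by (rule walk_link_ne(3)[OF li[OF that]])
  have "\<exists>u. {v i, z i} = diag_corners (lower_corner (v i) (z i)) (upper_corner (v i) (z i)) \<and>
       {u, v (i + 1)} = antidiag_corners (lower_corner (v i) (z i)) (upper_corner (v i) (z i)) \<or>
       {v i, z i} = antidiag_corners (lower_corner (v i) (z i)) (upper_corner (v i) (z i)) \<and>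
       {u, v (i + 1)} = diag_corners (lower_corner (v i) (z i)) (upper_corner (v i) (z i))" if "i \<ge> 1" for i
    by (rule lower_upper_corner_corners[OF _ _ vz[OF that]]) (use walk_link_ne[OF li[OF that]] in \<open>auto simp: v_def z_def\<close>)
  then obtain u where u: "\<And>i. i \<ge> 1 \<Longrightarrow> {v i, z i} = diag_corners (lower_corner (v i) (z i)) (upper_corner (v i) (z i)) \<and>
       {u i, v (i + 1)} = antidiag_corners (lower_corner (v i) (z i)) (upper_corner (v i) (z i)) \<or>
       {v i, z i} = antidiag_corners (lower_corner (v i) (z i)) (upper_corner (v i) (z i)) \<and>
       {u i, v (i + 1)} = diag_corners (lower_corner (v i) (z i)) (upper_corner (v i) (z i))" by metis
  have zI: "z i \<in> interval (lower_corner (v i) (z i)) (upper_corner (v i) (z i))" for i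
    by (auto simp: interval_def lower_corner_def upper_corner_def mem_Times_iff)
  have sep: False if "i \<in> {1..r}" "j \<in> {1..r}" "i \<noteq> j" "inner_interval ?Q a b" "z i \<in> interval a b" "z j \<in> interval a b" for i j a b
  proof -
    have "p (E i) \<noteq> p (E j)" using ne[of i j] ne[of j i] that(1-3) by (cases "i < j") auto
    then show False using zs_separated[OF en en _ that(4)] that(5,6) unfolding z_def by blast
  qed
  have N: "p (E r) = p (E 0)" "p (E r + 2) = p (E 0 + 2)"
    unfolding Er by (rule tile_cycle_per[OF c]; simp)+
  have "zigzag_walk ?Q r I" unfolding zigzag_walk_def
  proof (intro conjI, goal_cases)
    case 1 show ?case by fact
  next
    case 2 show ?case
    proof (rule inj_onI, rule ccontr)
      fix i j assume h: "i \<in> {1..r}" "j \<in> {1..r}" "I i = I j" "i \<noteq> j"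
      have "z i \<in> I i" "z j \<in> I i" using zI[of i] zI[of j] h(3) unfolding I_def by simp_all
      then show False using sep[OF h(1,2,4) inn[of i]] h(1) unfolding I_def by simp
    qed
  next
    case 3 show ?case
    proof (rule exI[of _ v], rule exI[of _ z], rule exI[of _ u], intro conjI ballI impI notI)
      fix i assume i: "i \<in> {1..r}"
      show "\<exists>a b. inner_interval ?Q a b \<and> I i = interval a b \<and>
             ({v i, z i} = diag_corners a b \<and> {u i, v (i + 1)} = antidiag_corners a b \<or>
              {v i, z i} = antidiag_corners a b \<and> {u i, v (i + 1)} = diag_corners a b)"
        using inn[of i] u[of i] i unfolding I_def by fastforce
      show "\<exists>a b. edge_interval ?Q a b \<and> v i \<in> interval a b \<and> v (i + 1) \<in> interval a b"
        by (rule lower_upper_corner_edge[OF inn vz]) (use i in auto)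
      show False if "j \<in> {1..r}" "i \<noteq> j" "\<exists>a b. inner_interval ?Q a b \<and> z i \<in> interval a b \<and> z j \<in> interval a b" for j
        using sep[OF i that(1,2)] that(3) by blast
    next
      have V: "walk_vertex p (E r) = walk_vertex p (E 0)" unfolding walk_vertex_def N ..
      show "v 1 = v (r + 1)" unfolding v' by (simp add: v_def V)
      have "I r \<inter> I 1 = {scaled (walk_vertex p (E r))}"
        unfolding I_def v_def z_def using walk_link_Int[OF li[OF r] l[of 0] N] by simp
      then show "I 1 \<inter> I r = {v 1}" unfolding V by (simp add: v_def Int_commute)
    next
      fix i assume i: "i \<in> {1..<r}"
      then have "i \<ge> 1" by simp
      from walk_link_Int[OF li[OF this] l[of i] refl refl]
      show "I i \<inter> I (i + 1) = {v (i + 1)}" unfolding v' unfolding I_def v_def z_def by simp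
    qed
  qed
  then show ?thesis by blast
qed

end

text \<open>Whether the path has a good block end decides both sides, independently of m and n:
  without one there is a walk, with one the ideal is prime, and by \<open>zigzag_not_prime\<close>
  the two exclude each other.\<close>

theorem theorem4p19:
  fixes P Q :: "point set set" and m n :: nat
  assumes "closed_path P" and "m \<ge> 1" and "n \<ge> 1"
    and "Q = tensor P (rectangle m n)"
  shows "primeideal (polyomino_ideal Q :: 'k::field mpoly set) (poly_ring (vertices Q))
    \<longleftrightarrow> \<not> (\<exists>r I. zigzag_walk Q r I)"
proof -
  have P: "finite P" "P \<subseteq> cells" "P \<noteq> {}" using assms(1) unfolding closed_path_def polyomino_def by blast+
  have Q: "Q = dilate m n P" unfolding assms(4) by (rule tensor_rectangle[OF P assms(2,3)])
  obtain N p where p: "tile_cycle N p" "range p = int_tiles P" using closed_path_tile_cycle[OF assms(1)] by blast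
  show ?thesis
  proof (cases "no_good_end p")
    case True
    then obtain r I where "zigzag_walk Q r I" using zigzag_exists[OF p(1) True p(2) assms(2,3)] Q by blast
    then show ?thesis using zigzag_not_prime by blast
  next
    case False
    have "no_disjoint_pair (int_tiles P)" using no_disjoint_pair_if_good_end[OF p(1) False] p(2) by simp
    then have "u = {#}" if "disjoint_pair (int_tiles Q) u w c" for u w c
      using that assms(2,3) unfolding Q int_tiles_dilate[OF assms(2,3)] no_disjoint_pair_def by force
    moreover have "finite Q" "Q \<subseteq> cells"
    proof -
      show "Q \<subseteq> cells" unfolding Q dilate_def by auto
      have "Q \<subseteq> cell ` ({..<m * sup_x P} \<times> {..<n * sup_y P})"
      proof
        fix C assume "C \<in> Q"
        then obtain x y where C: "C = cell (x, y)" "cell (x div m, y div n) \<in> P" unfolding Q dilate_def by blast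
        have "x div m < sup_x P" "y div n < sup_y P" using cell_sup[OF P(1,2) C(2)] by blast+
        then have "x < m * sup_x P" "y < n * sup_y P"
          using assms(2,3) by (simp_all add: div_less_iff_less_mult mult.commute)
        then show "C \<in> cell ` ({..<m * sup_x P} \<times> {..<n * sup_y P})" using C(1) by auto
      qed
      then show "finite Q" by (rule finite_subset) simp
    qed
    ultimately have "primeideal (polyomino_ideal Q :: 'k mpoly set) (poly_ring (vertices Q))"
      using prime_if_no_disjoint_pair by blast
    then show ?thesis using zigzag_not_prime by blast
  qed
qed

end
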